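(* Let $(G,V,\|\cdot\|)$ be a sub-Finsler Lie group endowed with a strongly convex norm, and let $\mathfrak g$ be the Lie algebra of $G$. For all $p\in G$ and $\lambda\in\mathfrak g^*$, there exists a unique normal curve $\gamma:[0,1]\to G$ with associated covector $\lambda$ satisfying $\gamma(0)=p$. Moreover, $\gamma\in C^{1,1}([0,1],G)$.
   Context: A polarization of a Lie group $G$ is a linear subspace $V$ of its Lie algebra $\mathfrak g$; it is bracket-generating if the Lie algebra generated by $V$ is $\mathfrak g$. A sub-Finsler Lie group is a triple $(G,V,\|\cdot\|)$ with $G$ a Lie group, $V$ a bracket-generating polarization and $\|\cdot\|$ a norm on $V$. For an interval $I$, an absolutely continuous curve $\gamma:I\to G$ is horizontal if $\dot\gamma(t)\in \mathrm dL_{\gamma(t)}V$ for a.e. $t$ ($L$ = left translation); its control is $u(t)=\mathrm dL_{\gamma(t)}^{-1}\dot\gamma(t)\in V$. The energy is $\mathrm E:V\to\mathbb R$, $\mathrm E(v)=\frac12\|v\|^2$. The subdifferential of $\mathrm E$ at $w\in V$ is $\partial_w\mathrm E=\{\eta\in V^*:\eta(v-w)\le \mathrm E(v)-\mathrm E(w)\ \forall v\in V\}$. A horizontal curve $\gamma:I\to G$ with control $u\in L^2(I,V)$ is a normal curve with associated covector $\lambda\in\mathfrak g^*$ if $\lambda\circ\mathrm{Ad}_{\gamma(t)}|_V\in\partial_{u(t)}\mathrm E$ for a.e. $t\in I$. A norm on $V$ is strongly convex if its energy $\mathrm E$ is strongly convex, i.e. there is a Euclidean norm $N$ on $V$ such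 that $\mathrm E(tv+(1-t)w)\le t\mathrm E(v)+(1-t)\mathrm E(w)-t(1-t)N(w-v)^2$ for all $v,w\in V$, $t\in[0,1]$. *)

theory Defs
  imports "HOL-Analysis.Analysis"
begin

section \<open>Smooth maps and Lie groups\<close>

text \<open>
  \<open>Ck_on k S f\<close>: the function \<open>f\<close> is of class \<open>C\<^sup>k\<close> on the set \<open>S\<close>. It is used for open \<open>S\<close> only.
\<close>
primrec Ck_on :: "nat \<Rightarrow> 'a::euclidean_space set \<Rightarrow> ('a \<Rightarrow> 'b::euclidean_space) \<Rightarrow> bool" where
  "Ck_on 0 S f \<longleftrightarrow> continuous_on S f"
| "Ck_on (Suc k) S f \<longleftrightarrow>
     f differentiable_on S \<and> (\<forall>v. Ck_on k S (\<lambda>x. frechet_derivative f (at x) v))"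

definition smooth_on :: "'a::euclidean_space set \<Rightarrow> ('a \<Rightarrow> 'b::euclidean_space) \<Rightarrow> bool" where
  "smooth_on S f \<longleftrightarrow> (\<forall>k. Ck_on k S f)"

text \<open>A chart is a pair of its domain and its coordinate map.\<close>
type_synonym ('g, 'e) chart = "'g set \<times> ('g \<Rightarrow> 'e)"

abbreviation chart_dom :: "('g, 'e) chart \<Rightarrow> 'g set" where
  "chart_dom \<equiv> fst"

abbreviation coord :: "('g, 'e) chart \<Rightarrow> 'g \<Rightarrow> 'e" where
  "coord \<equiv> snd"

definition chart_img :: "('g, 'e) chart \<Rightarrow> 'e set" where
  "chart_img c = coord c ` chart_dom c"

definition coord_inv :: "('g, 'e) chart \<Rightarrow> 'e \<Rightarrow> 'g" where
  "coord_inv c = inv_into (chart_dom c) (coord c)"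

definition is_chart :: "('g::topological_space, 'e::euclidean_space) chart \<Rightarrow> bool" where
  "is_chart c \<longleftrightarrow> open (chart_dom c) \<and> open (chart_img c) \<and>
     homeomorphism (chart_dom c) (chart_img c) (coord c) (coord_inv c)"

text \<open>
  The group operations of a Lie group are written additively, as in the library class
  \<^class>\<open>group_add\<close>; this class does not assume commutativity. So \<open>0\<close> is the identity element,
  \<open>g + x\<close> the product and \<open>g + x - g\<close> the conjugate of \<open>x\<close> by \<open>g\<close>. The manifold structure is given
  by a smooth atlas with values in the type \<open>'e\<close>, so that the dimension is \<open>DIM('e)\<close>.
\<close>
locale lie_group =
  fixes A :: "('g::{topological_group_add, t2_space, second_countable_topology},
               'e::euclidean_space) chart set"
  assumes charts: "\<And>c. c \<in> A \<Longrightarrow> is_chart c"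
    and atlas_covers: "(\<Union>c\<in>A. chart_dom c) = UNIV"
    and smooth_transition: "\<And>c d. c \<in> A \<Longrightarrow> d \<in> A \<Longrightarrow>
      smooth_on (coord c ` (chart_dom c \<inter> chart_dom d)) (\<lambda>x. coord d (coord_inv c x))"
    and smooth_mult: "\<And>b c d. b \<in> A \<Longrightarrow> c \<in> A \<Longrightarrow> d \<in> A \<Longrightarrow>
      smooth_on {(x, y). x \<in> chart_img b \<and> y \<in> chart_img c \<and> coord_inv b x + coord_inv c y \<in> chart_dom d}
        (\<lambda>(x, y). coord d (coord_inv b x + coord_inv c y))"
    and smooth_inverse: "\<And>c d. c \<in> A \<Longrightarrow> d \<in> A \<Longrightarrow>
      smooth_on {x. x \<in> chart_img c \<and> - coord_inv c x \<in> chart_dom d}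
        (\<lambda>x. coord d (- coord_inv c x))"


section \<open>The Lie algebra\<close>

text \<open>
  Fix a chart \<open>\<kappa>\<close> around the identity. A tangent vector at the identity is represented by its
  coordinates in \<open>\<kappa>\<close>; this identifies the Lie algebra of the group, as a vector space, with \<open>'e\<close>.

  \<open>dL \<kappa> c g X\<close> is the image of \<open>X\<close> under the differential at the identity of the left translation
  by \<open>g\<close>, expressed in the coordinates \<open>c\<close> around \<open>g\<close>.
\<close>
definition dL :: "('g::group_add, 'e::euclidean_space) chart \<Rightarrow> ('g, 'e) chart \<Rightarrow> 'g \<Rightarrow> 'e \<Rightarrow> 'e" where
  "dL \<kappa> c g X = frechet_derivative (\<lambda>x. coord c (g + coord_inv \<kappa> x)) (at (coord \<kappa> 0)) X"

definition Ad :: "('g::group_add, 'e::euclidean_space) chart \<Rightarrow> 'g \<Rightarrow> 'e \<Rightarrow> 'e" where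
  "Ad \<kappa> g X = frechet_derivative (\<lambda>x. coord \<kappa> (g + coord_inv \<kappa> x - g)) (at (coord \<kappa> 0)) X"

text \<open>The left-invariant vector field with value \<open>X\<close> at the identity, on \<^term>\<open>chart_img \<kappa>\<close>.\<close>
definition left_inv_field :: "('g::group_add, 'e::euclidean_space) chart \<Rightarrow> 'e \<Rightarrow> 'e \<Rightarrow> 'e" where
  "left_inv_field \<kappa> X x = dL \<kappa> \<kappa> (coord_inv \<kappa> x) X"

text \<open>
  The value at the identity of the commutator of the left-invariant vector fields \<open>X\<close> and \<open>Y\<close>,
  by the coordinate formula \<open>[X, Y] = DY X - DX Y\<close>.
\<close>
definition lie_bracket :: "('g::group_add, 'e::euclidean_space) chart \<Rightarrow> 'e \<Rightarrow> 'e \<Rightarrow> 'e" where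
  "lie_bracket \<kappa> X Y =
     frechet_derivative (left_inv_field \<kappa> Y) (at (coord \<kappa> 0)) X
     - frechet_derivative (left_inv_field \<kappa> X) (at (coord \<kappa> 0)) Y"

definition lie_subalgebra :: "('g::group_add, 'e::euclidean_space) chart \<Rightarrow> 'e set \<Rightarrow> bool" where
  "lie_subalgebra \<kappa> W \<longleftrightarrow> subspace W \<and> (\<forall>X\<in>W. \<forall>Y\<in>W. lie_bracket \<kappa> X Y \<in> W)"

definition bracket_generating :: "('g::group_add, 'e::euclidean_space) chart \<Rightarrow> 'e set \<Rightarrow> bool" where
  "bracket_generating \<kappa> V \<longleftrightarrow> lie_subalgebra \<kappa> hull V = UNIV"


section \<open>Norms on a subspace and their energies\<close>

definition norm_on :: "'e::real_vector set \<Rightarrow> ('e \<Rightarrow> real) \<Rightarrow> bool" where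
  "norm_on V N \<longleftrightarrow>
     (\<forall>v\<in>V. 0 \<le> N v \<and> (N v = 0 \<longleftrightarrow> v = 0)) \<and>
     (\<forall>c. \<forall>v\<in>V. N (c *\<^sub>R v) = \<bar>c\<bar> * N v) \<and>
     (\<forall>v\<in>V. \<forall>w\<in>V. N (v + w) \<le> N v + N w)"

definition inner_product_on :: "'e::real_vector set \<Rightarrow> ('e \<Rightarrow> 'e \<Rightarrow> real) \<Rightarrow> bool" where
  "inner_product_on V B \<longleftrightarrow>
     (\<forall>u\<in>V. \<forall>v\<in>V. \<forall>w\<in>V. B (u + v) w = B u w + B v w) \<and>
     (\<forall>c. \<forall>v\<in>V. \<forall>w\<in>V. B (c *\<^sub>R v) w = c * B v w) \<and>
     (\<forall>v\<in>V. \<forall>w\<in>V. B v w = B w v) \<and>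
     (\<forall>v\<in>V. v \<noteq> 0 \<longrightarrow> 0 < B v v)"

definition euclidean_norm_on :: "'e::real_vector set \<Rightarrow> ('e \<Rightarrow> real) \<Rightarrow> bool" where
  "euclidean_norm_on V M \<longleftrightarrow> (\<exists>B. inner_product_on V B \<and> (\<forall>v\<in>V. M v = sqrt (B v v)))"

definition energy :: "('e \<Rightarrow> real) \<Rightarrow> 'e \<Rightarrow> real" where
  "energy N v = (N v)\<^sup>2 / 2"

definition strongly_convex_norm_on :: "'e::real_vector set \<Rightarrow> ('e \<Rightarrow> real) \<Rightarrow> bool" where
  "strongly_convex_norm_on V N \<longleftrightarrow> norm_on V N \<and>
     (\<exists>M. euclidean_norm_on V M \<and>
       (\<forall>v\<in>V. \<forall>w\<in>V. \<forall>t\<in>{0..1}.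
          energy N (t *\<^sub>R v + (1 - t) *\<^sub>R w)
            \<le> t * energy N v + (1 - t) * energy N w - t * (1 - t) * (M (w - v))\<^sup>2))"

text \<open>
  A linear functional on \<open>V\<close> is represented by any function on \<open>'e\<close> whose restriction to \<open>V\<close> it is.
\<close>
definition linear_functional_on :: "'e::real_vector set \<Rightarrow> ('e \<Rightarrow> real) \<Rightarrow> bool" where
  "linear_functional_on V \<eta> \<longleftrightarrow>
     (\<forall>v\<in>V. \<forall>w\<in>V. \<eta> (v + w) = \<eta> v + \<eta> w) \<and> (\<forall>c. \<forall>v\<in>V. \<eta> (c *\<^sub>R v) = c * \<eta> v)"

definition subdifferential_on :: "'e::real_vector set \<Rightarrow> ('e \<Rightarrow> real) \<Rightarrow> 'e \<Rightarrow> ('e \<Rightarrow> real) set" where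
  "subdifferential_on V E w =
     {\<eta>. linear_functional_on V \<eta> \<and> (\<forall>v\<in>V. \<eta> (v - w) \<le> E v - E w)}"

locale sub_finsler_lie_group = lie_group A
  for A :: "('g::{topological_group_add, t2_space, second_countable_topology},
             'e::euclidean_space) chart set" +
  fixes \<kappa> :: "('g, 'e) chart" and V :: "'e set" and N :: "'e \<Rightarrow> real"
  assumes identity_chart: "\<kappa> \<in> A" "0 \<in> chart_dom \<kappa>"
    and polarization: "subspace V"
    and bracket_generating: "bracket_generating \<kappa> V"
    and norm: "norm_on V N"


section \<open>Curves\<close>

definition abs_continuous_on :: "real \<Rightarrow> real \<Rightarrow> (real \<Rightarrow> 'e::real_normed_vector) \<Rightarrow> bool" where
  "abs_continuous_on a b f \<longleftrightarrow>
     (\<forall>\<epsilon>>0. \<exists>\<delta>>0. \<forall>n (s :: nat \<Rightarrow> real) t.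
        (\<forall>i<n. a \<le> s i \<and> s i \<le> t i \<and> t i \<le> b) \<and>
        disjoint_family_on (\<lambda>i. {s i<..<t i}) {..<n} \<and>
        (\<Sum>i<n. t i - s i) < \<delta>
        \<longrightarrow> (\<Sum>i<n. norm (f (t i) - f (s i))) < \<epsilon>)"

text \<open>
  Regularity of a curve in the group is regularity in coordinates, on all compact subintervals on
  which the curve stays in a chart. By compactness, finitely many of these cover a compact \<open>I\<close>.
\<close>
definition abs_continuous_curve ::
  "('g::topological_space, 'e::euclidean_space) chart set \<Rightarrow> real set \<Rightarrow> (real \<Rightarrow> 'g) \<Rightarrow> bool" where
  "abs_continuous_curve A I \<gamma> \<longleftrightarrow> continuous_on I \<gamma> \<and>
     (\<forall>c\<in>A. \<forall>a b. a < b \<and> {a..b} \<subseteq> I \<and> \<gamma> ` {a..b} \<subseteq> chart_dom c \<longrightarrow>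
        abs_continuous_on a b (\<lambda>t. coord c (\<gamma> t)))"

definition C11_curve ::
  "('g::topological_space, 'e::euclidean_space) chart set \<Rightarrow> real set \<Rightarrow> (real \<Rightarrow> 'g) \<Rightarrow> bool" where
  "C11_curve A I \<gamma> \<longleftrightarrow> continuous_on I \<gamma> \<and>
     (\<forall>c\<in>A. \<forall>a b. a < b \<and> {a..b} \<subseteq> I \<and> \<gamma> ` {a..b} \<subseteq> chart_dom c \<longrightarrow>
        (\<exists>d L. (\<forall>t\<in>{a..b}. ((\<lambda>t. coord c (\<gamma> t)) has_vector_derivative d t) (at t within {a..b})) \<and>
               L-lipschitz_on {a..b} d))"

definition has_control ::
  "('g::group_add, 'e::euclidean_space) chart set \<Rightarrow> ('g, 'e) chart \<Rightarrow> 'e set \<Rightarrow>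
   real set \<Rightarrow> (real \<Rightarrow> 'g) \<Rightarrow> (real \<Rightarrow> 'e) \<Rightarrow> bool" where
  "has_control A \<kappa> V I \<gamma> u \<longleftrightarrow>
     (AE t in lebesgue_on I. u t \<in> V \<and>
        (\<forall>c\<in>A. \<gamma> t \<in> chart_dom c \<longrightarrow>
           ((\<lambda>s. coord c (\<gamma> s)) has_vector_derivative dL \<kappa> c (\<gamma> t) (u t)) (at t within I)))"

text \<open>
  Since \<open>V\<close> is finite-dimensional, square-integrability may be expressed with the norm of \<open>'e\<close>.
\<close>
definition square_integrable_on :: "real set \<Rightarrow> (real \<Rightarrow> 'e::euclidean_space) \<Rightarrow> bool" where
  "square_integrable_on I u \<longleftrightarrow>
     u \<in> borel_measurable (lebesgue_on I) \<and> integrable (lebesgue_on I) (\<lambda>t. (norm (u t))\<^sup>2)"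

definition normal_curve ::
  "('g::topological_group_add, 'e::euclidean_space) chart set \<Rightarrow> ('g, 'e) chart \<Rightarrow> 'e set \<Rightarrow>
   ('e \<Rightarrow> real) \<Rightarrow> ('e \<Rightarrow> real) \<Rightarrow> real set \<Rightarrow> (real \<Rightarrow> 'g) \<Rightarrow> bool" where
  "normal_curve A \<kappa> V N \<eta> I \<gamma> \<longleftrightarrow>
     abs_continuous_curve A I \<gamma> \<and>
     (\<exists>u. has_control A \<kappa> V I \<gamma> u \<and> square_integrable_on I u \<and>
          (AE t in lebesgue_on I.
             (\<lambda>X. \<eta> (Ad \<kappa> (\<gamma> t) X)) \<in> subdifferential_on V (energy N) (u t)))"

end

theory Submission
  imports Defs
begin

text \<open>
  Since the energy \<open>E\<close> is strongly convex, a covector \<open>\<mu>\<close> is a subgradient of \<open>E\<close> at exactly one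
  vector of \<open>V\<close>, which depends on \<open>\<mu>\<close> in a Lipschitz way. Hence the control of a normal curve is
  \<open>u = U (\<gamma>)\<close> for a locally Lipschitz map \<open>U\<close> on the group, and normal curves are the integral curves of
  a locally Lipschitz vector field: an absolutely continuous curve that solves the equation almost
  everywhere solves it everywhere, is unique, and has a Lipschitz derivative. For the existence up to
  time \<open>1\<close>, the Hamiltonian, i.e. the convex conjugate of \<open>E\<close> at \<open>\<eta> \<circ> Ad (\<gamma> t)\<close>, is conserved because
  \<open>[u, u] = 0\<close>. It bounds the control, so that by left translation to the identity the time of local
  existence is the same at every point of the curve.
\<close>

subsection \<open>Calculus of \<open>C\<^sup>k\<close> maps\<close>

text \<open>Differentiability of the Hamiltonian is never established; convexity replaces it. The
  optimal control at a covector is a subgradient of the Hamiltonian there, and comparing two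
  covectors in both orders squeezes the increment of the Hamiltonian between a linear term and the
  same term plus a quadratic error. Conservation thus only needs the linear term to be stationary.

  The bound on the control is available only once a curve exists, but the existence proof needs it
  beforehand. So the control is first truncated in norm. This merely rescales it, which does not
  disturb the argument from the vanishing bracket.

  The existence time is uniform for two reasons. The equation is solved for the coordinates of - p +
  \<gamma>, near the identity, where the differentials of the translations have a bound independent
  of p. And the Picard time is determined by a radius and a speed bound alone, whereas the Lipschitz
  constant of the field may vary with p.\<close>

lemma has_derivative_cong_open:
  assumes "open S" "x \<in> S" "\<And>y. y \<in> S \<Longrightarrow> f y = g y"
  shows "(f has_derivative D) (at x) \<longleftrightarrow> (g has_derivative D) (at x)"
  using assms by (metis has_derivative_transform_within_open)

lemma frechet_derivative_cong_open:
  assumes "open S" "x \<in> S" "\<And>y. y \<in> S \<Longrightarrow> f y = g y"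
  shows "frechet_derivative f (at x) = frechet_derivative g (at x)"
  unfolding frechet_derivative_def using has_derivative_cong_open[OF assms] by simp

lemma differentiable_cong_open:
  assumes "open S" "x \<in> S" "\<And>y. y \<in> S \<Longrightarrow> f y = g y"
  shows "f differentiable (at x) \<longleftrightarrow> g differentiable (at x)"
  unfolding differentiable_def using has_derivative_cong_open[OF assms] by simp

lemma differentiable_on_open_iff:
  "open S \<Longrightarrow> f differentiable_on S \<longleftrightarrow> (\<forall>x\<in>S. f differentiable (at x))"
  unfolding differentiable_on_def by (metis at_within_open)

lemma frechet_derivative_has_derivative:
  "f differentiable (at x) \<Longrightarrow> (f has_derivative frechet_derivative f (at x)) (at x)"
  by (simp add: frechet_derivative_works)

lemma frechet_derivative_eqI: "(f has_derivative D) (at x) \<Longrightarrow> frechet_derivative f (at x) = D"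
  using frechet_derivative_at by metis

text \<open>The derivative of a sum, product or composition is known in closed form on S only. The
  closure lemmas below show the closed form to be smooth and pass to
  \<open>frechet_derivative\<close> by this lemma; since S is open, derivatives on S depend on the
  values on S alone.\<close>

lemma Ck_on_cong_imp:
  assumes "open S" "\<And>x. x \<in> S \<Longrightarrow> f x = g x" "Ck_on k S f"
  shows "Ck_on k S g"
  using assms(2,3)
proof (induction k arbitrary: f g)
  case 0
  then show ?case using continuous_on_cong[of S S f g] by simp
next
  case (Suc k)
  have "g differentiable_on S"
    using Suc.prems differentiable_cong_open[OF assms(1), of _ f g]
    by (auto simp: differentiable_on_open_iff[OF assms(1)])
  moreover have "Ck_on k S (\<lambda>x. frechet_derivative g (at x) v)" for v
  proof (rule Suc.IH)
    show "frechet_derivative f (at x) v = frechet_derivative g (at x) v" if "x \<in> S" for x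
      using frechet_derivative_cong_open[OF assms(1) that, of f g] Suc.prems(1) by simp
    show "Ck_on k S (\<lambda>x. frechet_derivative f (at x) v)" using Suc.prems(2) by simp
  qed
  ultimately show ?case by simp
qed

lemma Ck_on_subset: "Ck_on k S f \<Longrightarrow> T \<subseteq> S \<Longrightarrow> Ck_on k T f"
  by (induction k arbitrary: f) (auto intro: continuous_on_subset differentiable_on_subset)

lemma Ck_on_SucD: "Ck_on (Suc k) S f \<Longrightarrow> Ck_on k S f"
  by (induction k arbitrary: f) (auto intro: differentiable_imp_continuous_on)

lemma Ck_on_differentiable:
  "Ck_on (Suc k) S f \<Longrightarrow> open S \<Longrightarrow> x \<in> S \<Longrightarrow> f differentiable (at x)"
  by (auto simp: differentiable_on_open_iff)

lemma Ck_on_Union: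
  assumes "\<And>i. i \<in> I \<Longrightarrow> open (S i)" "\<And>i. i \<in> I \<Longrightarrow> Ck_on k (S i) f"
  shows "Ck_on k (\<Union>i\<in>I. S i) f"
  using assms(2)
proof (induction k arbitrary: f)
  case 0
  then show ?case using continuous_on_open_Union[of "S ` I" f] assms(1) by auto
next
  case (Suc k)
  have "f differentiable_on (\<Union>i\<in>I. S i)"
    using Suc.prems assms(1) by (subst differentiable_on_open_iff) (auto simp: differentiable_on_open_iff)
  then show ?case using Suc by auto
qed

section \<open>Closure properties of \<open>Ck_on\<close>\<close>

lemma Ck_on_const: "Ck_on k S (\<lambda>x. c)"
  by (induction k arbitrary: c) auto

lemma Ck_on_add:
  assumes "open S"
  shows "Ck_on k S f \<Longrightarrow> Ck_on k S g \<Longrightarrow> Ck_on k S (\<lambda>x. f x + g x)"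
proof (induction k arbitrary: f g)
  case 0
  then show ?case by (auto intro: continuous_intros)
next
  case (Suc k)
  have d: "((\<lambda>x. f x + g x) has_derivative
      (\<lambda>v. frechet_derivative f (at x) v + frechet_derivative g (at x) v)) (at x)" if "x \<in> S" for x
    using Ck_on_differentiable[OF Suc.prems(1) assms that] Ck_on_differentiable[OF Suc.prems(2) assms that]
    by (intro has_derivative_add frechet_derivative_has_derivative)
  have "(\<lambda>x. f x + g x) differentiable_on S"
    using d by (auto simp: differentiable_on_open_iff[OF assms] differentiable_def)
  moreover have "Ck_on k S (\<lambda>x. frechet_derivative (\<lambda>x. f x + g x) (at x) v)" for v
  proof (rule Ck_on_cong_imp[OF assms])
    show "Ck_on k S (\<lambda>x. frechet_derivative f (at x) v + frechet_derivative g (at x) v)"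
      using Suc by simp
  qed (simp add: frechet_derivative_eqI[OF d])
  ultimately show ?case by simp
qed

lemma Ck_on_sum:
  assumes "open S" "\<And>i. i \<in> I \<Longrightarrow> Ck_on k S (f i)"
  shows "Ck_on k S (\<lambda>x. \<Sum>i\<in>I. f i x)"
  using assms(2) by (induction I rule: infinite_finite_induct) (auto simp: Ck_on_const Ck_on_add[OF assms(1)])

lemma Ck_on_linear_compose:
  assumes "open S" "bounded_linear L"
  shows "Ck_on k S f \<Longrightarrow> Ck_on k S (\<lambda>x. L (f x))"
proof (induction k arbitrary: f)
  case 0
  then show ?case using bounded_linear.continuous_on[OF assms(2)] by auto
next
  case (Suc k)
  have d: "((\<lambda>x. L (f x)) has_derivative (\<lambda>v. L (frechet_derivative f (at x) v))) (at x)" if "x \<in> S" for x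
    using Ck_on_differentiable[OF Suc.prems(1) assms(1) that]
    by (intro bounded_linear.has_derivative[OF assms(2)] frechet_derivative_has_derivative)
  have "(\<lambda>x. L (f x)) differentiable_on S"
    using d by (auto simp: differentiable_on_open_iff[OF assms(1)] differentiable_def)
  moreover have "Ck_on k S (\<lambda>x. frechet_derivative (\<lambda>x. L (f x)) (at x) v)" for v
  proof (rule Ck_on_cong_imp[OF assms(1)])
    show "Ck_on k S (\<lambda>x. L (frechet_derivative f (at x) v))" using Suc by simp
  qed (simp add: frechet_derivative_eqI[OF d])
  ultimately show ?case by simp
qed

lemma Ck_on_scaleR:
  fixes s :: "'a::euclidean_space \<Rightarrow> real"
  assumes "open S"
  shows "Ck_on k S s \<Longrightarrow> Ck_on k S f \<Longrightarrow> Ck_on k S (\<lambda>x. s x *\<^sub>R f x)"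
proof (induction k arbitrary: s f)
  case 0
  then show ?case by (auto intro: continuous_intros)
next
  case (Suc k)
  have d: "((\<lambda>x. s x *\<^sub>R f x) has_derivative
      (\<lambda>v. s x *\<^sub>R frechet_derivative f (at x) v + frechet_derivative s (at x) v *\<^sub>R f x)) (at x)"
    if "x \<in> S" for x
    using Ck_on_differentiable[OF Suc.prems(1) assms that] Ck_on_differentiable[OF Suc.prems(2) assms that]
    by (intro has_derivative_scaleR frechet_derivative_has_derivative)
  have "(\<lambda>x. s x *\<^sub>R f x) differentiable_on S"
    using d by (auto simp: differentiable_on_open_iff[OF assms] differentiable_def)
  moreover have "Ck_on k S (\<lambda>x. frechet_derivative (\<lambda>x. s x *\<^sub>R f x) (at x) v)" for v
  proof (rule Ck_on_cong_imp[OF assms])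
    \<comment> \<open>Each summand pairs a differentiated factor with an undifferentiated one; the
      latter is lowered by one order so that the induction hypothesis fits both.\<close>
    show "Ck_on k S (\<lambda>x. s x *\<^sub>R frechet_derivative f (at x) v + frechet_derivative s (at x) v *\<^sub>R f x)"
      using Suc.prems Suc.prems[THEN Ck_on_SucD]
      by (intro Ck_on_add[OF assms] Suc.IH) simp_all
  qed (simp add: frechet_derivative_eqI[OF d])
  ultimately show ?case by simp
qed

lemma Ck_on_linear: "open S \<Longrightarrow> bounded_linear L \<Longrightarrow> Ck_on k S L"
proof (cases k)
  case (Suc j)
  assume "open S" "bounded_linear L"
  then show ?thesis unfolding Suc
    by (simp add: bounded_linear_imp_differentiable_on frechet_derivative_eqI[OF bounded_linear_imp_has_derivative] Ck_on_const)
qed (simp add: linear_continuous_on)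

lemma linear_sum_Basis:
  fixes D :: "'a::euclidean_space \<Rightarrow> 'b::real_vector"
  assumes "linear D"
  shows "D v = (\<Sum>i\<in>Basis. (v \<bullet> i) *\<^sub>R D i)"
  by (subst euclidean_representation[symmetric, of v])
    (simp only: linear_sum[OF assms] linear_scale[OF assms])

text \<open>\<open>Ck_on\<close> controls derivatives in fixed directions, but the chain rule
  applies the derivative of g to a vector moving with x. Expanding that vector in
  \<open>Basis\<close> leaves scalar coefficients times derivatives of g in fixed directions, to
  which the induction hypothesis applies.\<close>

lemma Ck_on_compose:
  assumes "open S" "open T" "f ` S \<subseteq> T"
  shows "Ck_on k S f \<Longrightarrow> Ck_on k T g \<Longrightarrow> Ck_on k S (\<lambda>x. g (f x))"
proof (induction k arbitrary: g)
  case 0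
  then show ?case using assms(3) by (auto intro: continuous_on_compose2)
next
  case (Suc k)
  have fT: "f x \<in> T" if "x \<in> S" for x using assms(3) that by auto
  have dg: "g differentiable (at (f x))" if "x \<in> S" for x
    using Ck_on_differentiable[OF Suc.prems(2) assms(2) fT[OF that]] .
  have d: "((\<lambda>x. g (f x)) has_derivative
      (\<lambda>v. frechet_derivative g (at (f x)) (frechet_derivative f (at x) v))) (at x)" if "x \<in> S" for x
    using has_derivative_compose[OF
        frechet_derivative_has_derivative[OF Ck_on_differentiable[OF Suc.prems(1) assms(1) that]]
        frechet_derivative_has_derivative[OF dg[OF that]]] .
  have "(\<lambda>x. g (f x)) differentiable_on S"
    using d by (auto simp: differentiable_on_open_iff[OF assms(1)] differentiable_def)
  moreover have "Ck_on k S (\<lambda>x. frechet_derivative (\<lambda>x. g (f x)) (at x) v)" for v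
  proof (rule Ck_on_cong_imp[OF assms(1)])
    have "Ck_on k S (\<lambda>x. frechet_derivative f (at x) v \<bullet> i)" for i
      using Suc.prems(1) by (intro Ck_on_linear_compose[OF assms(1) bounded_linear_inner_left]) simp
    moreover have "Ck_on k S (\<lambda>x. frechet_derivative g (at (f x)) i)" for i
      using Suc.prems(2) Ck_on_SucD[OF Suc.prems(1)] by (intro Suc.IH) simp_all
    ultimately show "Ck_on k S (\<lambda>x. \<Sum>i\<in>Basis. (frechet_derivative f (at x) v \<bullet> i) *\<^sub>R
        frechet_derivative g (at (f x)) i)"
      by (intro Ck_on_sum[OF assms(1)] Ck_on_scaleR[OF assms(1)])
    show "(\<Sum>i\<in>Basis. (frechet_derivative f (at x) v \<bullet> i) *\<^sub>R frechet_derivative g (at (f x)) i)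
        = frechet_derivative (\<lambda>x. g (f x)) (at x) v" if "x \<in> S" for x
      unfolding frechet_derivative_eqI[OF d[OF that]]
      using linear_sum_Basis[OF linear_frechet_derivative[OF dg[OF that]]] by metis
  qed
  ultimately show ?case by simp
qed

lemma Ck_on_Pair:
  assumes "open S" "Ck_on k S f" "Ck_on k S g"
  shows "Ck_on k S (\<lambda>x. (f x, g x))"
proof -
  have "Ck_on k S (\<lambda>x. (f x, 0) + (0, g x))"
    using assms
    by (intro Ck_on_add[OF assms(1)] Ck_on_linear_compose[OF assms(1), of "\<lambda>y. (y, 0)"]
          Ck_on_linear_compose[OF assms(1), of "\<lambda>y. (0, y)"] bounded_linear_Pair)
      (auto intro: bounded_linear_ident bounded_linear_zero)
  then show ?thesis by simp
qed

text \<open>The sum of the norms of the partial derivatives is continuous and dominates the operator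
  norm, so its maximum over a small closed ball serves as K.\<close>

lemma C1_has_derivative_bounded:
  assumes "open S" "Ck_on 1 S f" "x \<in> S"
  obtains r K where "r > 0" "K \<ge> 0" "cball x r \<subseteq> S"
    "\<forall>y\<in>cball x r. onorm (frechet_derivative f (at y)) \<le> K"
proof -
  obtain r where r: "r > 0" "cball x r \<subseteq> S" using assms open_contains_cball by blast
  let ?n = "\<lambda>y. \<Sum>i\<in>Basis. norm (frechet_derivative f (at y) i)"
  have "continuous_on (cball x r) ?n"
    using assms(2) r(2) by (intro continuous_intros) (auto intro: continuous_on_subset)
  moreover have "cball x r \<noteq> {}" using r(1) by simp
  ultimately obtain y0 where y0: "\<And>y. y \<in> cball x r \<Longrightarrow> ?n y \<le> ?n y0"
    using continuous_attains_sup[of "cball x r" ?n] compact_cball by metis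
  have "onorm (frechet_derivative f (at y)) \<le> ?n y0" if y: "y \<in> cball x r" for y
  proof (rule onorm_le)
    fix v
    have "f differentiable (at y)"
      using Ck_on_differentiable[of 0 S f y] assms y r(2) by auto
    then have "norm (frechet_derivative f (at y) v)
        = norm (\<Sum>i\<in>Basis. (v \<bullet> i) *\<^sub>R frechet_derivative f (at y) i)"
      using linear_sum_Basis[OF linear_frechet_derivative] by metis
    also have "\<dots> \<le> (\<Sum>i\<in>Basis. norm v * norm (frechet_derivative f (at y) i))"
      by (rule sum_norm_le) (auto intro!: mult_right_mono simp: Basis_le_norm)
    also have "\<dots> = norm v * ?n y" by (simp add: sum_distrib_left)
    also have "\<dots> \<le> ?n y0 * norm v" using y0[OF y] by (simp add: mult.commute mult_left_mono)
    finally show "norm (frechet_derivative f (at y) v) \<le> ?n y0 * norm v" .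
  qed
  then show ?thesis using r by (intro that[of r "?n y0"]) (simp_all add: sum_nonneg)
qed

subsection \<open>Locally Lipschitz maps\<close>

text \<open>The time-independent case of the library's \<open>local_lipschitz\<close>.\<close>

definition loc_lip :: "'a::metric_space set \<Rightarrow> ('a \<Rightarrow> 'b::metric_space) \<Rightarrow> bool" where
  "loc_lip S f \<longleftrightarrow> (\<forall>x\<in>S. \<exists>r>0. \<exists>L. L-lipschitz_on (S \<inter> ball x r) f)"

lemma C1_loc_lip:
  assumes "open S" "Ck_on 1 S f"
  shows "loc_lip S f"
  unfolding loc_lip_def
proof
  fix x assume x: "x \<in> S"
  from C1_has_derivative_bounded[OF assms x]
  obtain r K where r: "r > 0" and K: "K \<ge> 0" "cball x r \<subseteq> S"
    "\<forall>y\<in>cball x r. onorm (frechet_derivative f (at y)) \<le> K" .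
  have "K-lipschitz_on (cball x r) f"
  proof (rule bounded_derivative_imp_lipschitz)
    show "(f has_derivative frechet_derivative f (at y)) (at y within cball x r)"
      if "y \<in> cball x r" for y
    proof -
      have "f differentiable (at y)"
        using that K(2) assms by (intro Ck_on_differentiable[of 0 S]) auto
      then show ?thesis
        by (rule has_derivative_at_withinI[OF frechet_derivative_has_derivative])
    qed
    show "onorm (frechet_derivative f (at y)) \<le> K" if "y \<in> cball x r" for y
      using K(3) that by blast
  qed (rule convex_cball, rule K(1))
  then have "K-lipschitz_on (S \<inter> ball x r) f" by (rule lipschitz_on_subset) auto
  then show "\<exists>r>0. \<exists>L. L-lipschitz_on (S \<inter> ball x r) f" using r by blast
qed

lemma loc_lip_const: "loc_lip S (\<lambda>x. c)"
  unfolding loc_lip_def using lipschitz_on_constant zero_less_one by blast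

lemma loc_lip_lipschitz: "L-lipschitz_on S f \<Longrightarrow> loc_lip S f"
  unfolding loc_lip_def by (meson Int_lower1 lipschitz_on_subset zero_less_one)

lemma loc_lip_imp_continuous_on:
  assumes "loc_lip S f" shows "continuous_on S f"
  unfolding continuous_on_eq_continuous_within
proof
  fix x assume x: "x \<in> S"
  then obtain r L where r: "r > 0" "L-lipschitz_on (S \<inter> ball x r) f"
    using assms unfolding loc_lip_def by blast
  then have "continuous (at x within S \<inter> ball x r) f"
    using lipschitz_on_continuous_on[OF r(2)] x by (simp add: continuous_on_eq_continuous_within)
  moreover have "at x within S \<inter> ball x r = at x within S"
    using r(1) by (intro at_within_nhd[of _ "ball x r"]) auto
  ultimately show "continuous (at x within S) f" by (simp add: continuous_within)
qed

lemma loc_lip_common: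
  assumes "loc_lip S f" "loc_lip S g" "x \<in> S"
  obtains r L M where "r > 0" "L-lipschitz_on (S \<inter> ball x r) f" "M-lipschitz_on (S \<inter> ball x r) g" "r \<le> 1"
proof -
  obtain r L where r: "r > 0" "L-lipschitz_on (S \<inter> ball x r) f"
    using assms unfolding loc_lip_def by blast
  obtain s M where s: "s > 0" "M-lipschitz_on (S \<inter> ball x s) g"
    using assms unfolding loc_lip_def by blast
  \<comment> \<open>The cap at 1 lets \<open>loc_lip_scaleR\<close> bound each factor on the ball by
    its size at the centre plus its Lipschitz constant.\<close>
  show ?thesis
  proof (rule that[of "min 1 (min r s)" L M])
    show "L-lipschitz_on (S \<inter> ball x (min 1 (min r s))) f"
      by (rule lipschitz_on_subset[OF r(2)]) auto
    show "M-lipschitz_on (S \<inter> ball x (min 1 (min r s))) g"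
      by (rule lipschitz_on_subset[OF s(2)]) auto
  qed (use r s in auto)
qed

lemma loc_lip_add:
  fixes f g :: "'a::metric_space \<Rightarrow> 'b::real_normed_vector"
  assumes "loc_lip S f" "loc_lip S g"
  shows "loc_lip S (\<lambda>x. f x + g x)"
  unfolding loc_lip_def
proof
  fix x assume "x \<in> S"
  from loc_lip_common[OF assms this] obtain r L M where
    "r > 0" "L-lipschitz_on (S \<inter> ball x r) f" "M-lipschitz_on (S \<inter> ball x r) g" .
  then show "\<exists>r>0. \<exists>L. L-lipschitz_on (S \<inter> ball x r) (\<lambda>x. f x + g x)"
    using lipschitz_on_add by blast
qed

lemma loc_lip_sum:
  fixes f :: "'i \<Rightarrow> 'a::metric_space \<Rightarrow> 'b::real_normed_vector"
  assumes "\<And>i. i \<in> I \<Longrightarrow> loc_lip S (f i)"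
  shows "loc_lip S (\<lambda>x. \<Sum>i\<in>I. f i x)"
  using assms by (induction I rule: infinite_finite_induct) (auto simp: loc_lip_const loc_lip_add)

lemma loc_lip_scaleR:
  fixes f :: "'a::metric_space \<Rightarrow> 'b::real_normed_vector"
  assumes "loc_lip S s" "loc_lip S f"
  shows "loc_lip S (\<lambda>x. s x *\<^sub>R f x)"
  unfolding loc_lip_def
proof
  fix x assume x: "x \<in> S"
  from loc_lip_common[OF assms this] obtain r L M where r:
    "r > 0" "L-lipschitz_on (S \<inter> ball x r) s" "M-lipschitz_on (S \<inter> ball x r) f" "r \<le> 1" .
  have L: "L \<ge> 0" "M \<ge> 0" using r lipschitz_on_nonneg by auto
  have xr: "x \<in> S \<inter> ball x r" using x r by auto
  have sb: "\<bar>s y\<bar> \<le> \<bar>s x\<bar> + L" if "y \<in> S \<inter> ball x r" for y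
  proof -
    have "\<bar>s y - s x\<bar> \<le> L * dist y x" using lipschitz_onD[OF r(2) that xr] by (simp add: dist_real_def)
    also have "\<dots> \<le> L * 1" using that L r(4) by (intro mult_left_mono) (auto simp: dist_commute)
    finally show ?thesis by auto
  qed
  have fb: "norm (f y) \<le> norm (f x) + M" if "y \<in> S \<inter> ball x r" for y
  proof -
    have "norm (f y - f x) \<le> M * dist y x" using lipschitz_onD[OF r(3) that xr] by (simp add: dist_norm)
    also have "\<dots> \<le> M * 1" using that L r(4) by (intro mult_left_mono) (auto simp: dist_commute)
    finally show ?thesis using norm_triangle_sub[of "f y" "f x"] by auto
  qed
  have "((\<bar>s x\<bar> + L) * M + (norm (f x) + M) * L)-lipschitz_on (S \<inter> ball x r) (\<lambda>x. s x *\<^sub>R f x)"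
  proof (rule lipschitz_onI)
    fix y z assume yz: "y \<in> S \<inter> ball x r" "z \<in> S \<inter> ball x r"
    have "s y *\<^sub>R f y - s z *\<^sub>R f z = s y *\<^sub>R (f y - f z) + (s y - s z) *\<^sub>R f z"
      by (simp add: algebra_simps)
    then have "dist (s y *\<^sub>R f y) (s z *\<^sub>R f z) \<le> \<bar>s y\<bar> * dist (f y) (f z) + dist (s y) (s z) * norm (f z)"
      unfolding dist_norm by (metis norm_scaleR norm_triangle_ineq real_norm_def)
    also have "\<dots> \<le> (\<bar>s x\<bar> + L) * (M * dist y z) + (L * dist y z) * (norm (f x) + M)"
      using sb[OF yz(1)] fb[OF yz(2)] lipschitz_onD[OF r(2) yz] lipschitz_onD[OF r(3) yz] L
      by (intro add_mono mult_mono) auto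
    finally show "dist (s y *\<^sub>R f y) (s z *\<^sub>R f z)
        \<le> ((\<bar>s x\<bar> + L) * M + (norm (f x) + M) * L) * dist y z" by (simp add: algebra_simps)
  qed (use L in auto)
  then show "\<exists>r>0. \<exists>L. L-lipschitz_on (S \<inter> ball x r) (\<lambda>x. s x *\<^sub>R f x)" using r(1) by blast
qed

lemma loc_lip_compose:
  assumes "loc_lip S f" "loc_lip T g" "f ` S \<subseteq> T"
  shows "loc_lip S (\<lambda>x. g (f x))"
  unfolding loc_lip_def
proof
  fix x assume x: "x \<in> S"
  then obtain r L where r: "r > 0" "L-lipschitz_on (S \<inter> ball x r) f"
    using assms(1) unfolding loc_lip_def by blast
  obtain s M where s: "s > 0" "M-lipschitz_on (T \<inter> ball (f x) s) g"
    using assms(2,3) x unfolding loc_lip_def by blast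
  have L: "L \<ge> 0" using r lipschitz_on_nonneg by auto
  \<comment> \<open>Any radius q with L q < s keeps f inside the ball where g is Lipschitz; the
    \<open>+ 1\<close> covers L = 0.\<close>
  define q where "q = min r (s / (L + 1))"
  have q: "q > 0" "q \<le> r" using r s L by (auto simp: q_def)
  have Lq: "L * q < s"
  proof -
    have "L * q \<le> L * (s / (L + 1))" using L by (intro mult_left_mono) (auto simp: q_def)
    also have "\<dots> < s" using L s by (simp add: field_simps)
    finally show ?thesis .
  qed
  have f: "L-lipschitz_on (S \<inter> ball x q) f" by (rule lipschitz_on_subset[OF r(2)]) (use q in auto)
  have "f y \<in> T \<inter> ball (f x) s" if "y \<in> S \<inter> ball x q" for y
  proof -
    have y: "y \<in> S" "dist x y < q" using that by auto
    have "dist (f x) (f y) \<le> L * dist x y" using lipschitz_onD[OF f] x y q by auto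
    also have "\<dots> \<le> L * q" using y L by (intro mult_left_mono) auto
    finally show ?thesis using Lq assms(3) y by auto
  qed
  then have "f ` (S \<inter> ball x q) \<subseteq> T \<inter> ball (f x) s" by blast
  then have "M-lipschitz_on (f ` (S \<inter> ball x q)) g" using s(2) lipschitz_on_subset by blast
  then show "\<exists>r>0. \<exists>L. L-lipschitz_on (S \<inter> ball x r) (\<lambda>x. g (f x))"
    using lipschitz_on_compose2[OF f] q(1) by blast
qed

lemma loc_lip_compact:
  assumes "loc_lip S f" "compact K" "K \<subseteq> S"
  obtains L where "L-lipschitz_on K f"
proof -
  \<comment> \<open>A one-point set of times makes the library theorem on time-dependent maps
    applicable.\<close>
  have "local_lipschitz {0::real} K (\<lambda>_. f)"
  proof (rule local_lipschitzI)
    fix x assume "x \<in> K"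
    then obtain r L where r: "r > 0" "L-lipschitz_on (S \<inter> ball x r) f"
      using assms unfolding loc_lip_def by blast
    have "L-lipschitz_on (cball x (r/2) \<inter> K) f"
      by (rule lipschitz_on_subset[OF r(2)]) (use r assms in auto)
    then show "\<exists>u>0. \<exists>L. \<forall>t\<in>cball t u \<inter> {0}. L-lipschitz_on (cball x u \<inter> K) f" for t :: real
      using r(1) by (intro exI[of _ "r/2"]) auto
  qed
  from local_lipschitz_compact_implies_lipschitz[OF this assms(2)] that show ?thesis by auto
qed

lemma loc_lip_cong: "(\<And>x. x \<in> S \<Longrightarrow> f x = g x) \<Longrightarrow> loc_lip S f \<Longrightarrow> loc_lip S g"
  unfolding loc_lip_def by (metis IntE lipschitz_on_transform)

text \<open>For R > 0, the radial retraction onto the ball of radius R. It is written as a multiple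
  of w because \<open>energy_level_stationary\<close> needs the control to be a multiple of the
  optimal one.\<close>

definition truncate_norm :: "real \<Rightarrow> 'a::real_normed_vector \<Rightarrow> 'a" where
  "truncate_norm R w = (R / max R (norm w)) *\<^sub>R w"

lemma truncate_norm_id: "R > 0 \<Longrightarrow> norm w \<le> R \<Longrightarrow> truncate_norm R w = w"
  by (simp add: truncate_norm_def)

lemma norm_truncate_norm_le:
  assumes "R > 0" shows "norm (truncate_norm R w) \<le> R"
proof -
  have "R * norm w \<le> R * max R (norm w)" using assms by (intro mult_left_mono) auto
  then show ?thesis using assms by (simp add: truncate_norm_def divide_le_eq max_def)
qed

lemma truncate_norm_lipschitz:
  assumes R: "R > 0" shows "2-lipschitz_on UNIV (truncate_norm R)"
proof (rule lipschitz_onI)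
  fix v w :: 'a
  define a b where "a = max R (norm v)" and "b = max R (norm w)"
  have ab: "a \<ge> R" "b \<ge> R" "norm w \<le> b" "a > 0" "b > 0" "\<bar>b - a\<bar> \<le> norm (v - w)"
    using R norm_triangle_ineq3[of v w] by (auto simp: a_def b_def)
  \<comment> \<open>The first term changes the vector, the second the factor. Each is at most norm
    (v - w), whence the constant 2.\<close>
  have "truncate_norm R v - truncate_norm R w = (R / a) *\<^sub>R (v - w) + (R / a - R / b) *\<^sub>R w"
    by (simp add: truncate_norm_def a_def b_def algebra_simps)
  then have "dist (truncate_norm R v) (truncate_norm R w) \<le> \<bar>R / a\<bar> * norm (v - w) + \<bar>R / a - R / b\<bar> * norm w"
    unfolding dist_norm by (metis norm_scaleR norm_triangle_ineq)
  also have "\<bar>R / a\<bar> * norm (v - w) \<le> 1 * norm (v - w)"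
    using ab R by (intro mult_right_mono) auto
  also have "\<bar>R / a - R / b\<bar> * norm w \<le> norm (v - w)"
  proof -
    have "R / a - R / b = (R / a) * ((b - a) / b)" using ab by (simp add: field_simps)
    then have "\<bar>R / a - R / b\<bar> * norm w = (R / a) * (\<bar>b - a\<bar> * (norm w / b))"
      using ab R by (simp add: abs_mult)
    also have "\<dots> \<le> 1 * (norm (v - w) * 1)"
      using ab R by (intro mult_mono mult_nonneg_nonneg) auto
    finally show ?thesis by simp
  qed
  finally show "dist (truncate_norm R v) (truncate_norm R w) \<le> 2 * dist v w"
    by (simp add: dist_norm)
qed simp

subsection \<open>Absolutely continuous functions\<close>

lemma AE_lebesgue_on_negligible:
  fixes S :: "'a::euclidean_space set"
  assumes "AE t in lebesgue_on S. P t" "S \<in> sets lebesgue"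
  obtains E where "negligible E" "\<And>t. t \<in> S \<Longrightarrow> t \<notin> E \<Longrightarrow> P t"
proof -
  obtain E where E: "E \<in> null_sets (lebesgue_on S)" "{t \<in> space (lebesgue_on S). \<not> P t} \<subseteq> E"
    using assms(1) unfolding eventually_ae_filter by blast
  have "negligible E"
    using E(1) null_sets_restrict_space[OF assms(2)] by (simp add: negligible_iff_null_sets)
  with E(2) show ?thesis by (intro that[of E]) auto
qed

lemma abs_continuous_onE:
  assumes "abs_continuous_on a b f" "\<epsilon> > 0"
  obtains \<delta> where "\<delta> > 0" "\<forall>n (s :: nat \<Rightarrow> real) t. (\<forall>i<n. a \<le> s i \<and> s i \<le> t i \<and> t i \<le> b) \<and>
      disjoint_family_on (\<lambda>i. {s i<..<t i}) {..<n} \<and> (\<Sum>i<n. t i - s i) < \<delta> \<longrightarrow>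
      (\<Sum>i<n. norm (f (t i) - f (s i))) < \<epsilon>"
proof -
  from assms(1)[unfolded abs_continuous_on_def, THEN spec, THEN mp, OF assms(2)] show thesis
    by (rule exE) (rule that; erule conjunct1 conjunct2)
qed

lemma abs_continuous_on_subset:
  assumes "abs_continuous_on a b f" "a \<le> a'" "b' \<le> b"
  shows "abs_continuous_on a' b' f"
  unfolding abs_continuous_on_def
proof (intro allI impI)
  fix \<epsilon> :: real assume "\<epsilon> > 0"
  from abs_continuous_onE[OF assms(1) this]
  obtain \<delta> where "\<delta> > 0" and "\<forall>n (s :: nat \<Rightarrow> real) t. (\<forall>i<n. a \<le> s i \<and> s i \<le> t i \<and> t i \<le> b) \<and>
        disjoint_family_on (\<lambda>i. {s i<..<t i}) {..<n} \<and> (\<Sum>i<n. t i - s i) < \<delta> \<longrightarrow>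
        (\<Sum>i<n. norm (f (t i) - f (s i))) < \<epsilon>" .
  moreover have "a \<le> s \<and> s \<le> t \<and> t \<le> b" if "a' \<le> s \<and> s \<le> t \<and> t \<le> b'" for s t
    using that assms(2,3) by linarith
  ultimately show "\<exists>\<delta>>0. \<forall>n (s :: nat \<Rightarrow> real) t. (\<forall>i<n. a' \<le> s i \<and> s i \<le> t i \<and> t i \<le> b') \<and>
        disjoint_family_on (\<lambda>i. {s i<..<t i}) {..<n} \<and> (\<Sum>i<n. t i - s i) < \<delta>
        \<longrightarrow> (\<Sum>i<n. norm (f (t i) - f (s i))) < \<epsilon>"
    by meson
qed

lemma lipschitz_imp_abs_continuous_on:
  assumes "L-lipschitz_on {a..b} f"
  shows "abs_continuous_on a b f"
  unfolding abs_continuous_on_def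
proof (intro allI impI)
  fix \<epsilon> :: real assume e: "\<epsilon> > 0"
  have L: "L \<ge> 0" using assms lipschitz_on_nonneg by auto
  show "\<exists>\<delta>>0. \<forall>n (s :: nat \<Rightarrow> real) t. (\<forall>i<n. a \<le> s i \<and> s i \<le> t i \<and> t i \<le> b) \<and>
        disjoint_family_on (\<lambda>i. {s i<..<t i}) {..<n} \<and> (\<Sum>i<n. t i - s i) < \<delta>
        \<longrightarrow> (\<Sum>i<n. norm (f (t i) - f (s i))) < \<epsilon>"
  proof (intro exI[of _ "\<epsilon> / (L + 1)"] conjI allI impI)
    show "\<epsilon> / (L + 1) > 0" using e L by auto
    fix n and s t :: "nat \<Rightarrow> real"
    assume st: "(\<forall>i<n. a \<le> s i \<and> s i \<le> t i \<and> t i \<le> b) \<and>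
        disjoint_family_on (\<lambda>i. {s i<..<t i}) {..<n} \<and> (\<Sum>i<n. t i - s i) < \<epsilon> / (L + 1)"
    have "(\<Sum>i<n. norm (f (t i) - f (s i))) \<le> (\<Sum>i<n. L * (t i - s i))"
    proof (rule sum_mono)
      fix i assume "i \<in> {..<n}"
      with st have i: "a \<le> s i" "s i \<le> t i" "t i \<le> b" by auto
      then show "norm (f (t i) - f (s i)) \<le> L * (t i - s i)"
        using lipschitz_onD[OF assms, of "t i" "s i"] by (auto simp: dist_norm)
    qed
    also have "\<dots> = L * (\<Sum>i<n. t i - s i)" by (simp add: sum_distrib_left)
    also have "\<dots> \<le> L * (\<epsilon> / (L + 1))" using st L by (intro mult_left_mono) auto
    also have "\<dots> < \<epsilon>" using L e by (simp add: field_simps)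
    finally show "(\<Sum>i<n. norm (f (t i) - f (s i))) < \<epsilon>" .
  qed
qed

lemma abs_continuous_on_diff:
  assumes "abs_continuous_on a b f" "abs_continuous_on a b g"
  shows "abs_continuous_on a b (\<lambda>t. f t - g t)"
  unfolding abs_continuous_on_def
proof (intro allI impI)
  fix \<epsilon> :: real assume e: "\<epsilon> > 0"
  then have e2: "\<epsilon> / 2 > 0" by simp
  from abs_continuous_onE[OF assms(1) e2] obtain d1
    where d1: "d1 > 0" "\<forall>n (s :: nat \<Rightarrow> real) t. (\<forall>i<n. a \<le> s i \<and> s i \<le> t i \<and> t i \<le> b) \<and>
        disjoint_family_on (\<lambda>i. {s i<..<t i}) {..<n} \<and> (\<Sum>i<n. t i - s i) < d1 \<longrightarrow>
        (\<Sum>i<n. norm (f (t i) - f (s i))) < \<epsilon> / 2" .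
  from abs_continuous_onE[OF assms(2) e2] obtain d2
    where d2: "d2 > 0" "\<forall>n (s :: nat \<Rightarrow> real) t. (\<forall>i<n. a \<le> s i \<and> s i \<le> t i \<and> t i \<le> b) \<and>
        disjoint_family_on (\<lambda>i. {s i<..<t i}) {..<n} \<and> (\<Sum>i<n. t i - s i) < d2 \<longrightarrow>
        (\<Sum>i<n. norm (g (t i) - g (s i))) < \<epsilon> / 2" .
  have *: "(\<Sum>i<n. norm ((f (t i) - g (t i)) - (f (s i) - g (s i)))) < \<epsilon>"
    if "\<forall>i<n. a \<le> s i \<and> s i \<le> t i \<and> t i \<le> b" "disjoint_family_on (\<lambda>i. {s i<..<t i}) {..<n}"
      "(\<Sum>i<n. t i - s i) < min d1 d2" for n :: nat and s t :: "nat \<Rightarrow> real"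
  proof -
    have "norm ((f u - g u) - (f v - g v)) \<le> norm (f u - f v) + norm (g u - g v)" for u v
      using norm_triangle_ineq4[of "f u - f v" "g u - g v"] by (simp add: algebra_simps)
    then have "(\<Sum>i<n. norm ((f (t i) - g (t i)) - (f (s i) - g (s i))))
        \<le> (\<Sum>i<n. norm (f (t i) - f (s i)) + norm (g (t i) - g (s i)))"
      by (intro sum_mono)
    also have "\<dots> < \<epsilon> / 2 + \<epsilon> / 2"
      unfolding sum.distrib
    proof (rule add_strict_mono)
      show "(\<Sum>i<n. norm (f (t i) - f (s i))) < \<epsilon> / 2"
        using that by (intro d1(2)[THEN spec[of _ n], THEN spec[of _ s], THEN spec[of _ t], THEN mp]) simp
      show "(\<Sum>i<n. norm (g (t i) - g (s i))) < \<epsilon> / 2"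
        using that by (intro d2(2)[THEN spec[of _ n], THEN spec[of _ s], THEN spec[of _ t], THEN mp]) simp
    qed
    finally show ?thesis by simp
  qed
  show "\<exists>\<delta>>0. \<forall>n (s :: nat \<Rightarrow> real) t. (\<forall>i<n. a \<le> s i \<and> s i \<le> t i \<and> t i \<le> b) \<and>
        disjoint_family_on (\<lambda>i. {s i<..<t i}) {..<n} \<and> (\<Sum>i<n. t i - s i) < \<delta>
        \<longrightarrow> (\<Sum>i<n. norm ((f (t i) - g (t i)) - (f (s i) - g (s i)))) < \<epsilon>"
    using d1(1) d2(1) * by (intro exI[of _ "min d1 d2"]) auto
qed

text \<open>
  Take a tagged division fine for a gauge that, at the points of the exceptional set \<open>E\<close>, is confined
  to a small open neighbourhood of \<open>E\<close>: the increments over the intervals tagged in \<open>E\<close> are small by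
  absolute continuity, the others by the vanishing of the derivative.
\<close>
lemma abs_continuous_zero_derivative:
  fixes f :: "real \<Rightarrow> 'e::euclidean_space"
  assumes ab: "a \<le> b" and ac: "abs_continuous_on a b f" and neg: "negligible E"
    and der: "\<And>t. t \<in> {a..b} \<Longrightarrow> t \<notin> E \<Longrightarrow> (f has_vector_derivative 0) (at t within {a..b})"
  shows "f b = f a"
proof -
  have "norm (f b - f a) \<le> \<epsilon>" if e: "\<epsilon> > 0" for \<epsilon>
  proof -
    \<comment> \<open>The half of \<epsilon> reserved for the tags outside E is spread over the
      length b - a; the \<open>+ 1\<close> covers a = b.\<close>
    define e2 where "e2 = \<epsilon> / (2 * (b - a + 1))"
    have e2: "e2 > 0" "e2 * (b - a) \<le> \<epsilon> / 2" using e ab by (auto simp: e2_def field_simps)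
    have "\<epsilon> / 2 > 0" using e by simp
    from abs_continuous_onE[OF ac this]
    obtain \<delta> where d: "\<delta> > 0" and acd: "\<forall>n (s :: nat \<Rightarrow> real) t. (\<forall>i<n. a \<le> s i \<and> s i \<le> t i \<and> t i \<le> b) \<and>
        disjoint_family_on (\<lambda>i. {s i<..<t i}) {..<n} \<and> (\<Sum>i<n. t i - s i) < \<delta> \<longrightarrow>
        (\<Sum>i<n. norm (f (t i) - f (s i))) < \<epsilon> / 2" .
    have Enull: "E \<in> null_sets lebesgue" using neg by (simp add: negligible_iff_null_sets)
    then have Eset: "E \<in> sets lebesgue" by auto
    \<comment> \<open>Since E is null, T has the same measure as T - E, hence less than
      \<delta>.\<close>
    obtain T where T: "open T" "E \<subseteq> T" "T - E \<in> lmeasurable" "emeasure lebesgue (T - E) < ennreal \<delta>"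
      using sets_lebesgue_outer_open[OF Eset d] by blast
    have Tm: "emeasure lebesgue T = emeasure lebesgue (T - E)"
      using emeasure_Diff_null_set[OF Enull] T(1) by (metis borel_open sets_completionI_sets sets_lborel)
    moreover have "T \<in> sets lebesgue" using T(1) by (intro sets_completionI_sets) simp
    ultimately have TL: "T \<in> lmeasurable"
      using T(4) by (intro fmeasurableI) (auto intro: less_trans ennreal_less_top)
    have TD: "measure lebesgue T < \<delta>"
      using T(4) TL d unfolding Tm[symmetric] by (simp add: emeasure_eq_measure2 ennreal_less_iff)
    have "\<exists>r>0. (x \<in> E \<longrightarrow> ball x r \<subseteq> T) \<and> (x \<notin> E \<longrightarrow> x \<in> {a..b} \<longrightarrow>
        (\<forall>y\<in>{a..b}. dist y x < r \<longrightarrow> norm (f y - f x) \<le> e2 * \<bar>y - x\<bar>))" for x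
    proof (cases "x \<in> E")
      case True
      then show ?thesis using T(1,2) openE by (metis subsetD)
    next
      case False
      show ?thesis
      proof (cases "x \<in> {a..b}")
        case True
        have "(f has_derivative (\<lambda>h. 0)) (at x within {a..b})"
          using der[OF True False] by (simp add: has_vector_derivative_def)
        then obtain r where "r > 0" "\<forall>y\<in>{a..b}. norm (y - x) < r \<longrightarrow> norm (f y - f x) \<le> e2 * norm (y - x)"
          unfolding has_derivative_within_alt using e2(1) by fastforce
        then show ?thesis using False by (auto simp: dist_norm)
      qed (use False zero_less_one in blast)
    qed
    then obtain r where r: "\<And>x. r x > 0" "\<And>x. x \<in> E \<Longrightarrow> ball x (r x) \<subseteq> T"
      "\<And>x y. x \<notin> E \<Longrightarrow> x \<in> {a..b} \<Longrightarrow> y \<in> {a..b} \<Longrightarrow> dist y x < r x \<Longrightarrow>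
         norm (f y - f x) \<le> e2 * \<bar>y - x\<bar>"
      by metis
    have "gauge (\<lambda>x. ball x (r x))" using r(1) by (auto simp: gauge_def)
    then obtain p where p: "p tagged_division_of {a..b}" "(\<lambda>x. ball x (r x)) fine p"
      using fine_division_exists_real by blast
    note pD = tagged_division_ofD[OF p(1)]
    have K: "\<exists>u v. K = {u..v} \<and> u \<le> x \<and> x \<le> v \<and> a \<le> u \<and> v \<le> b \<and> K \<subseteq> ball x (r x) \<and> x \<in> {a..b}"
      if xK: "(x, K) \<in> p" for x K
    proof -
      obtain u v where uv: "K = {u..v}" using pD(4)[OF xK] by (auto simp: cbox_interval)
      moreover have "K \<subseteq> {a..b}" "x \<in> K" using pD(2,3)[OF xK] by auto
      moreover have "K \<subseteq> ball x (r x)" using p(2) xK by (auto simp: fine_def)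
      ultimately show ?thesis by (intro exI[of _ u] exI[of _ v]) auto
    qed
    define p1 where "p1 = {xK \<in> p. fst xK \<in> E}"
    define p2 where "p2 = {xK \<in> p. fst xK \<notin> E}"
    have p12: "p = p1 \<union> p2" "p1 \<inter> p2 = {}" "finite p1" "finite p2"
      using pD(1) by (auto simp: p1_def p2_def)
    let ?g = "\<lambda>(x, K). f (Sup K) - f (Inf K)"
    have "f b - f a = sum ?g p" using additive_tagged_division_1[OF ab p(1), of f] by simp
    also have "\<dots> = sum ?g p1 + sum ?g p2" using p12 by (simp add: sum.union_disjoint)
    finally have "norm (f b - f a) \<le> norm (sum ?g p1) + norm (sum ?g p2)"
      by (simp add: norm_triangle_ineq)
    moreover have "norm (sum ?g p2) \<le> \<epsilon> / 2"
    proof -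
      have "norm (sum ?g p2) \<le> (\<Sum>(x, K)\<in>p2. e2 * measure lborel K)"
      proof (rule sum_norm_le, clarify)
        fix x K assume "(x, K) \<in> p2"
        then have xK: "(x, K) \<in> p" "x \<notin> E" by (auto simp: p2_def)
        obtain u v where uv: "K = {u..v}" "u \<le> x" "x \<le> v" "a \<le> u" "v \<le> b" "K \<subseteq> ball x (r x)" "x \<in> {a..b}"
          using K[OF xK(1)] by blast
        have m: "u \<in> ball x (r x)" "v \<in> ball x (r x)"
          by (rule subsetD[OF uv(6)], use uv(1-3) in simp)+
        have "norm (f v - f x) \<le> e2 * \<bar>v - x\<bar>" "norm (f u - f x) \<le> e2 * \<bar>u - x\<bar>"
          using uv m xK(2) by (intro r(3); auto simp: dist_commute)+
        moreover have "norm (f v - f u) \<le> norm (f v - f x) + norm (f u - f x)"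
          using norm_triangle_ineq4[of "f v - f x" "f u - f x"] by simp
        ultimately have "norm (f v - f u) \<le> e2 * (v - u)" using uv by (simp add: algebra_simps)
        then show "norm (f (Sup K) - f (Inf K)) \<le> e2 * measure lborel K" using uv by simp
      qed
      also have "\<dots> \<le> (\<Sum>(x, K)\<in>p. e2 * measure lborel K)"
        using pD(1) p12 e2(1) by (intro sum_mono2) auto
      also have "\<dots> = e2 * (b - a)"
        using additive_content_tagged_division[of p a b] p(1) ab
        by (simp add: cbox_interval case_prod_unfold flip: sum_distrib_left)
      finally show ?thesis using e2(2) by simp
    qed
    moreover have "norm (sum ?g p1) \<le> \<epsilon> / 2"
    proof -
      \<comment> \<open>Absolute continuity is stated for families indexed by \<open>{..<n}\<close>,
        so the intervals tagged in E are enumerated. Their interiors are disjoint and lie in T, so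
        their total length is below \<delta>.\<close>
      obtain h where h: "bij_betw h {..<card p1} p1"
        using ex_bij_betw_nat_finite[OF p12(3)] by (auto simp: atLeast0LessThan)
      define s where "s = (\<lambda>i. Inf (snd (h i)))"
      define t where "t = (\<lambda>i. Sup (snd (h i)))"
      have hi: "fst (h i) \<in> E" "snd (h i) = {s i..t i}" "s i \<le> t i" "a \<le> s i" "t i \<le> b"
        "{s i<..<t i} \<subseteq> T" "h i \<in> p" if "i < card p1" for i
      proof -
        have "h i \<in> p1" using h that by (auto simp: bij_betw_def)
        then have hp: "h i \<in> p" "fst (h i) \<in> E" by (auto simp: p1_def)
        then have "(fst (h i), snd (h i)) \<in> p" by simp
        from K[OF this] obtain u v where uv: "snd (h i) = {u..v}" "u \<le> fst (h i)" "fst (h i) \<le> v"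
          "a \<le> u" "v \<le> b" "snd (h i) \<subseteq> ball (fst (h i)) (r (fst (h i)))" by blast
        then have "s i = u" "t i = v" by (auto simp: s_def t_def)
        moreover have "{u..v} \<subseteq> T" using uv(1,6) r(2)[OF hp(2)] by auto
        then have "{u<..<v} \<subseteq> T" by (meson greaterThanLessThan_subseteq_atLeastAtMost_iff order_refl order_trans)
        ultimately show "fst (h i) \<in> E" "snd (h i) = {s i..t i}" "s i \<le> t i" "a \<le> s i" "t i \<le> b"
          "{s i<..<t i} \<subseteq> T" "h i \<in> p"
          using uv hp by simp_all
      qed
      have disj: "disjoint_family_on (\<lambda>i. {s i<..<t i}) {..<card p1}"
        unfolding disjoint_family_on_def
      proof (intro ballI impI)
        fix i j assume ij: "i \<in> {..<card p1}" "j \<in> {..<card p1}" "i \<noteq> j"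
        then have "h i \<noteq> h j" using h by (auto simp: bij_betw_def inj_on_def)
        then have "interior (snd (h i)) \<inter> interior (snd (h j)) = {}"
          using pD(5)[of "fst (h i)" "snd (h i)" "fst (h j)" "snd (h j)"] hi(7) ij by (auto simp: prod_eq_iff)
        then show "{s i<..<t i} \<inter> {s j<..<t j} = {}" using hi(2) ij by (simp add: interior_atLeastAtMost_real)
      qed
      have "(\<Sum>i<card p1. t i - s i) = (\<Sum>i<card p1. measure lebesgue {s i<..<t i})"
        using hi(3) by (intro sum.cong) auto
      also have "\<dots> = measure lebesgue (\<Union>i<card p1. {s i<..<t i})"
        using disj hi(3) by (intro measure_finite_Union[symmetric]) (auto simp: emeasure_lborel_Ioo)
      also have "\<dots> \<le> measure lebesgue T"
        using hi(6) TL by (intro measure_mono_fmeasurable) auto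
      finally have "(\<Sum>i<card p1. t i - s i) < \<delta>" using TD by simp
      then have "(\<Sum>i<card p1. norm (f (t i) - f (s i))) < \<epsilon> / 2"
        using disj hi by (intro acd[THEN spec[of _ "card p1"], THEN spec[of _ s], THEN spec[of _ t], THEN mp] conjI allI impI) auto
      moreover have "sum ?g p1 = (\<Sum>i<card p1. f (t i) - f (s i))"
        using sum.reindex_bij_betw[OF h, of ?g] by (simp add: s_def t_def case_prod_unfold)
      ultimately show ?thesis using sum_norm_le[of "{..<card p1}" "\<lambda>i. f (t i) - f (s i)"
            "\<lambda>i. norm (f (t i) - f (s i))"] by simp
    qed
    ultimately show ?thesis by simp
  qed
  then have "norm (f b - f a) \<le> 0" by (rule field_le_epsilon[of _ 0, simplified])
  then show ?thesis by simp
qed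

lemma bounded_vector_derivative_imp_lipschitz:
  fixes x :: "real \<Rightarrow> 'a::real_normed_vector"
  assumes "\<And>t. t \<in> {a..b} \<Longrightarrow> (x has_vector_derivative d t) (at t within {a..b})"
    and "\<And>t. t \<in> {a..b} \<Longrightarrow> norm (d t) \<le> K" "K \<ge> 0"
  shows "K-lipschitz_on {a..b} x"
proof (rule bounded_derivative_imp_lipschitz)
  show "(x has_derivative (\<lambda>h. h *\<^sub>R d t)) (at t within {a..b})" if "t \<in> {a..b}" for t
    using assms(1)[OF that] by (simp add: has_vector_derivative_def)
  show "onorm (\<lambda>h. h *\<^sub>R d t) \<le> K" if "t \<in> {a..b}" for t
    using assms(2)[OF that] by (intro onorm_le) (simp add: mult.commute[of K] mult_left_mono)
qed (use assms in auto)

lemma continuous_vector_derivative_imp_lipschitz: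
  fixes x :: "real \<Rightarrow> 'a::real_normed_vector"
  assumes "\<And>t. t \<in> {a..b} \<Longrightarrow> (x has_vector_derivative d t) (at t within {a..b})"
    and "continuous_on {a..b} d"
  obtains L where "L-lipschitz_on {a..b} x"
proof -
  have "bounded (d ` {a..b})" using assms(2) by (intro compact_imp_bounded compact_continuous_image) auto
  then obtain K where "\<forall>t\<in>{a..b}. norm (d t) \<le> K" unfolding bounded_iff by blast
  then have "(max K 0)-lipschitz_on {a..b} x"
    using assms(1) by (intro bounded_vector_derivative_imp_lipschitz[of a b x d]) (auto intro: max.coboundedI1)
  then show ?thesis by (rule that)
qed

text \<open>The difference of x and the integral of g is absolutely continuous with derivative 0 off
  E, hence constant; and as g is continuous, its integral has derivative g at every point.\<close>

lemma abs_continuous_AE_derivative: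
  fixes x :: "real \<Rightarrow> 'e::euclidean_space"
  assumes ac: "abs_continuous_on a b x" and g: "continuous_on {a..b} g" and neg: "negligible E"
    and der: "\<And>t. t \<in> {a..b} \<Longrightarrow> t \<notin> E \<Longrightarrow> (x has_vector_derivative g t) (at t within {a..b})"
    and t: "t \<in> {a..b}"
  shows "(x has_vector_derivative g t) (at t within {a..b})"
proof -
  define y where "y = (\<lambda>t. integral {a..t} g)"
  have y: "(y has_vector_derivative g t) (at t within {a..b})" if "t \<in> {a..b}" for t
    unfolding y_def using integral_has_vector_derivative[OF g that] .
  obtain L where "L-lipschitz_on {a..b} y" using continuous_vector_derivative_imp_lipschitz[OF y g] by blast
  then have ac2: "abs_continuous_on a b (\<lambda>t. x t - y t)"
    by (intro abs_continuous_on_diff[OF ac] lipschitz_imp_abs_continuous_on)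
  have eq: "x s = x a + y s" if s: "s \<in> {a..b}" for s
  proof -
    have "x s - y s = x a - y a"
    proof (rule abs_continuous_zero_derivative[where f="\<lambda>t. x t - y t", OF _ _ neg])
      show "abs_continuous_on a s (\<lambda>t. x t - y t)"
        using s by (intro abs_continuous_on_subset[OF ac2]) auto
      show "((\<lambda>t. x t - y t) has_vector_derivative 0) (at t within {a..s})"
        if "t \<in> {a..s}" "t \<notin> E" for t
      proof -
        have tab: "t \<in> {a..b}" using s that by auto
        have "((\<lambda>t. x t - y t) has_vector_derivative 0) (at t within {a..b})"
          using has_vector_derivative_diff[OF der[OF tab that(2)] y[OF tab]] by simp
        then show ?thesis using s by (elim has_vector_derivative_within_subset) auto
      qed
    qed (use s in auto)
    then show ?thesis by (simp add: y_def algebra_simps)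
  qed
  have "((\<lambda>t. x a + y t) has_vector_derivative g t) (at t within {a..b})"
    using has_vector_derivative_add[OF has_vector_derivative_const y[OF t]] by simp
  from has_vector_derivative_transform[OF t _ this, of x] show ?thesis using eq by blast
qed

text \<open>Meant for f the energy level along a curve, \<phi> the linear part of its variation and
  \<psi> a quadratic error.\<close>

lemma has_vector_derivative_0_squeeze:
  fixes f :: "real \<Rightarrow> real"
  assumes \<phi>: "(\<phi> has_vector_derivative 0) (at t within S)" and \<psi>: "(\<psi> has_vector_derivative 0) (at t within S)"
    and le: "\<And>s. s \<in> S \<Longrightarrow> \<bar>f s - f t\<bar> \<le> \<bar>\<phi> s - \<phi> t\<bar> + \<bar>\<psi> s - \<psi> t\<bar>"
  shows "(f has_vector_derivative 0) (at t within S)"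
  unfolding has_vector_derivative_def has_derivative_within_alt
proof (intro conjI allI impI)
  fix e :: real assume "e > 0"
  then have e: "e / 2 > 0" by simp
  obtain d1 where d1: "d1 > 0" "\<forall>s\<in>S. norm (s - t) < d1 \<longrightarrow> norm (\<phi> s - \<phi> t - (s - t) *\<^sub>R 0) \<le> e / 2 * norm (s - t)"
    using \<phi> e unfolding has_vector_derivative_def has_derivative_within_alt by blast
  obtain d2 where d2: "d2 > 0" "\<forall>s\<in>S. norm (s - t) < d2 \<longrightarrow> norm (\<psi> s - \<psi> t - (s - t) *\<^sub>R 0) \<le> e / 2 * norm (s - t)"
    using \<psi> e unfolding has_vector_derivative_def has_derivative_within_alt by blast
  show "\<exists>d>0. \<forall>s\<in>S. norm (s - t) < d \<longrightarrow> norm (f s - f t - (s - t) *\<^sub>R 0) \<le> e * norm (s - t)"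
  proof (intro exI[of _ "min d1 d2"] conjI ballI impI)
    fix s assume s: "s \<in> S" "norm (s - t) < min d1 d2"
    then have "\<bar>\<phi> s - \<phi> t\<bar> \<le> e / 2 * norm (s - t)" "\<bar>\<psi> s - \<psi> t\<bar> \<le> e / 2 * norm (s - t)"
      using d1(2) d2(2) by auto
    then show "norm (f s - f t - (s - t) *\<^sub>R 0) \<le> e * norm (s - t)"
      using le[OF s(1)] by (simp add: field_simps)
  qed (use d1 d2 in simp)
qed (simp add: bounded_linear_zero)

text \<open>A Gronwall argument on a short interval: at a maximum m of the norm of z, the mean value
  inequality between t0 and m gives norm (z m) \<le> norm (z m) / 2. As t0 may be any point of the
  interval, it works forward and backward in time.\<close>

lemma vector_derivative_le_imp_zero:
  fixes z :: "real \<Rightarrow> 'a::real_normed_vector"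
  assumes der: "\<And>t. t \<in> {a..b} \<Longrightarrow> (z has_vector_derivative z' t) (at t within {a..b})"
    and le: "\<And>t. t \<in> {a..b} \<Longrightarrow> norm (z' t) \<le> L * norm (z t)" and L: "L \<ge> 0" "L * (b - a) \<le> 1 / 2"
    and t0: "t0 \<in> {a..b}" "z t0 = 0" and s: "s \<in> {a..b}"
  shows "z s = 0"
proof -
  have "continuous_on {a..b} z"
    using der has_vector_derivative_continuous continuous_on_eq_continuous_within by blast
  then have "continuous_on {a..b} (\<lambda>t. norm (z t))" by (intro continuous_intros)
  then obtain m where m: "m \<in> {a..b}" "\<forall>t\<in>{a..b}. norm (z t) \<le> norm (z m)"
    using continuous_attains_sup[of "{a..b}" "\<lambda>t. norm (z t)"] s by auto
  have nonneg: "0 \<le> L * norm (z m)" using L(1) by (intro mult_nonneg_nonneg) auto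
  have "(L * norm (z m))-lipschitz_on {a..b} z"
  proof (rule bounded_vector_derivative_imp_lipschitz)
    fix t assume t: "t \<in> {a..b}"
    have "norm (z' t) \<le> L * norm (z t)" using le[OF t] .
    also have "\<dots> \<le> L * norm (z m)" using m(2) t L(1) by (intro mult_left_mono) auto
    finally show "norm (z' t) \<le> L * norm (z m)" .
  qed (use nonneg der in auto)
  from lipschitz_onD[OF this m(1) t0(1)] have "norm (z m) \<le> L * norm (z m) * \<bar>m - t0\<bar>"
    using t0(2) by (simp add: dist_norm)
  also have "\<dots> \<le> L * norm (z m) * (b - a)"
    using m(1) t0(1) L(1) by (intro mult_left_mono) auto
  also have "\<dots> = (L * (b - a)) * norm (z m)" by simp
  also have "\<dots> \<le> 1 / 2 * norm (z m)" using L(2) by (intro mult_right_mono) auto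
  finally have "norm (z m) \<le> 0" by simp
  then show ?thesis using m(2) s by (metis norm_le_zero_iff order_trans)
qed

subsection \<open>The Picard--Lindeloef theorem\<close>

text \<open>
  Weighting the curves by \<open>exp (- M t)\<close> makes the Picard operator a contraction on all of \<open>{0..T}\<close>
  at once.
\<close>
lemma picard_global:
  fixes G :: "'e::euclidean_space \<Rightarrow> 'e"
  assumes lip: "L-lipschitz_on UNIV G" and T: "T \<ge> 0"
  obtains x where "x 0 = x0" "\<And>t. t \<in> {0..T} \<Longrightarrow> (x has_vector_derivative G (x t)) (at t within {0..T})"
proof -
  have L: "L \<ge> 0" using lip lipschitz_on_nonneg by auto
  \<comment> \<open>The contraction factor will be L / M. This choice makes it at most 1 / 2 and
    keeps M positive when L = 0.\<close>
  define M where "M = 2 * L + 1"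
  have M: "M > 0" using L by (simp add: M_def)
  have Gc: "continuous_on S G" for S using lipschitz_on_continuous_on[OF lip] continuous_on_subset by blast
  \<comment> \<open>The unknown y is the weighted curve exp (- M s) x s, so the weight is undone
    before G is applied.\<close>
  define H where "H = (\<lambda>(y :: real \<Rightarrow>\<^sub>C 'e) s. G (exp (M * s) *\<^sub>R apply_bcontfun y s))"
  have Hc: "continuous_on S (H y)" for S y unfolding H_def
    by (rule continuous_on_compose2[OF Gc[of UNIV]]) (auto intro!: continuous_intros)
  define \<Phi> where "\<Phi> = (\<lambda>y t. exp (- M * t) *\<^sub>R (x0 + integral {0..t} (H y)))"
  have Ic: "continuous_on {0..T} (\<lambda>t. integral {0..t} (H y))" for y
    by (rule indefinite_integral_continuous_1) (intro integrable_continuous_real Hc)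
  have \<Phi>c: "continuous_on {0..T} (\<Phi> y)" for y unfolding \<Phi>_def
    by (intro continuous_intros Ic)
  \<comment> \<open>Elements of \<open>bcontfun\<close> live on the whole line; \<open>clamp\<close>
    extends the values on {0..T} constantly beyond the end points.\<close>
  have mem: "(\<lambda>t. \<Phi> y (clamp 0 T t)) \<in> bcontfun" for y
    unfolding bcontfun_def
    using clamp_continuous_on[of 0 T "\<Phi> y" UNIV] \<Phi>c[of y]
      clamp_bounded[of "\<Phi> y" 0 T] compact_imp_bounded[OF compact_continuous_image[OF \<Phi>c[of y]]]
    by (simp add: cbox_interval)
  define P where "P = (\<lambda>y. Bcontfun (\<lambda>t. \<Phi> y (clamp 0 T t)))"
  have Papp: "apply_bcontfun (P y) t = \<Phi> y (clamp 0 T t)" for y t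
    unfolding P_def by (simp add: Bcontfun_inverse[OF mem])
  have contr: "dist (P y) (P z) \<le> 1 / 2 * dist y z" for y z
  proof (rule dist_bound)
    fix t' define t where "t = clamp 0 T t'"
    have t: "t \<in> {0..T}" unfolding t_def using clamp_in_interval[of 0 T t'] T by (simp add: cbox_interval)
    define D where "D = dist y z"
    have D: "D \<ge> 0" by (simp add: D_def)
    \<comment> \<open>The integral of exp (M s) over {0..t} is at most exp (M t) / M, and the weight
      exp (- M t) in \<Phi> cancels the exponential.\<close>
    have exp_int: "((\<lambda>s. L * D * exp (M * s)) has_integral (L * D * exp (M * t) / M - L * D * exp (M * 0) / M)) {0..t}"
      using t M by (intro fundamental_theorem_of_calculus)
        (auto intro!: derivative_eq_intros simp flip: has_real_derivative_iff_has_vector_derivative)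
    have "norm (integral {0..t} (\<lambda>s. H y s - H z s)) \<le> integral {0..t} (\<lambda>s. L * D * exp (M * s))"
    proof (rule integral_norm_bound_integral)
      show "(\<lambda>s. H y s - H z s) integrable_on {0..t}"
        by (intro integrable_continuous_real continuous_intros Hc)
      show "(\<lambda>s. L * D * exp (M * s)) integrable_on {0..t}" using exp_int by blast
      fix s
      have "norm (H y s - H z s) \<le> L * dist (exp (M * s) *\<^sub>R apply_bcontfun y s) (exp (M * s) *\<^sub>R apply_bcontfun z s)"
        unfolding H_def using lipschitz_onD[OF lip] by (simp add: dist_norm)
      also have "\<dots> = L * (exp (M * s) * dist (apply_bcontfun y s) (apply_bcontfun z s))"
        by (simp add: dist_norm flip: scaleR_diff_right)
      also have "\<dots> \<le> L * (exp (M * s) * D)"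
        unfolding D_def using L by (intro mult_left_mono dist_bounded) auto
      finally show "norm (H y s - H z s) \<le> L * D * exp (M * s)" by (simp add: algebra_simps)
    qed
    also have "\<dots> \<le> L * D * exp (M * t) / M"
      using integral_unique[OF exp_int] L D M by simp
    finally have I: "norm (integral {0..t} (H y) - integral {0..t} (H z)) \<le> L * D * exp (M * t) / M"
      by (subst integral_diff[symmetric]) (auto intro: integrable_continuous_real Hc)
    have "dist (apply_bcontfun (P y) t') (apply_bcontfun (P z) t')
        = exp (- M * t) * norm (integral {0..t} (H y) - integral {0..t} (H z))"
      unfolding Papp t_def[symmetric] \<Phi>_def by (simp add: dist_norm flip: scaleR_diff_right)
    also have "\<dots> \<le> exp (- M * t) * (L * D * exp (M * t) / M)" using I by (intro mult_left_mono) auto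
    also have "\<dots> = L / M * D" by (simp add: exp_minus field_simps)
    also have "\<dots> \<le> 1 / 2 * D" using D M L by (intro mult_right_mono) (auto simp: M_def field_simps)
    finally show "dist (apply_bcontfun (P y) t') (apply_bcontfun (P z) t') \<le> 1 / 2 * dist y z"
      by (simp add: D_def)
  qed
  obtain y where y: "P y = y"
    using banach_fix_type[of "1/2" P] contr by auto
  define x where "x = (\<lambda>t. exp (M * t) *\<^sub>R apply_bcontfun y t)"
  have xe: "x t = x0 + integral {0..t} (\<lambda>s. G (x s))" if "t \<in> {0..T}" for t
  proof -
    have "clamp 0 T t = t" using that by (simp add: cbox_interval)
    then have "apply_bcontfun y t = \<Phi> y t" using Papp[of y t] y by simp
    then show ?thesis by (simp add: x_def \<Phi>_def H_def exp_minus)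
  qed
  have xc: "continuous_on {0..T} (\<lambda>s. G (x s))"
    using Hc[of "{0..T}" y] by (simp add: x_def H_def)
  show ?thesis
  proof (rule that)
    show "x 0 = x0" using xe[of 0] T by simp
    fix t assume t: "t \<in> {0..T}"
    have "((\<lambda>t. x0 + integral {0..t} (\<lambda>s. G (x s))) has_vector_derivative (0 + G (x t))) (at t within {0..T})"
      by (intro has_vector_derivative_add has_vector_derivative_const integral_has_vector_derivative[OF xc t])
    then show "(x has_vector_derivative G (x t)) (at t within {0..T})"
      using has_vector_derivative_transform[OF t xe] by simp
  qed
qed

text \<open>Composed with the projection onto the ball, F becomes globally Lipschitz. The solution
  starts at the centre with speed at most K, so up to time \<tau> it stays in the ball, where the
  projection is the identity. The admissible \<tau> does not involve L, which
  \<open>integral_curve_local\<close> relies on.\<close>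

lemma picard_ball:
  fixes F :: "'e::euclidean_space \<Rightarrow> 'e"
  assumes lip: "L-lipschitz_on (cball x0 r) F" and bd: "\<And>x. x \<in> cball x0 r \<Longrightarrow> norm (F x) \<le> K"
    and r: "r \<ge> 0" and K: "K \<ge> 0" and \<tau>: "\<tau> \<ge> 0" "K * \<tau> \<le> r"
  obtains x where "x 0 = x0" "\<And>t. t \<in> {0..\<tau>} \<Longrightarrow> x t \<in> cball x0 r"
    "\<And>t. t \<in> {0..\<tau>} \<Longrightarrow> (x has_vector_derivative F (x t)) (at t within {0..\<tau>})"
proof -
  let ?B = "cball x0 r" let ?p = "closest_point ?B"
  have B: "convex ?B" "closed ?B" "?B \<noteq> {}" using r by auto
  have pin: "?p x \<in> ?B" for x using closest_point_in_set[OF B(2,3)] .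
  have "1-lipschitz_on UNIV ?p"
    using closest_point_lipschitz[OF B] by (intro lipschitz_onI) auto
  then have "(L * 1)-lipschitz_on UNIV (\<lambda>x. F (?p x))"
    by (rule lipschitz_on_compose2) (rule lipschitz_on_subset[OF lip], use pin in blast)
  then have lip': "L-lipschitz_on UNIV (\<lambda>x. F (?p x))" by simp
  obtain x where x: "x 0 = x0"
    "\<And>t. t \<in> {0..\<tau>} \<Longrightarrow> (x has_vector_derivative F (?p (x t))) (at t within {0..\<tau>})"
    using picard_global[OF lip' \<tau>(1), of x0] by blast
  have "K-lipschitz_on {0..\<tau>} x"
    using x(2) bd[OF pin] K by (rule bounded_vector_derivative_imp_lipschitz)
  then have xin: "x t \<in> ?B" if "t \<in> {0..\<tau>}" for t
  proof -
    have "dist (x 0) (x t) \<le> K * dist 0 t"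
      using \<open>K-lipschitz_on {0..\<tau>} x\<close> that \<tau> by (intro lipschitz_onD[of K "{0..\<tau>}"]) auto
    also have "\<dots> \<le> K * \<tau>" using that K by (intro mult_left_mono) auto
    finally show ?thesis using \<tau>(2) x(1) by simp
  qed
  show ?thesis
    by (rule that[of x]) (use x xin closest_point_self[OF xin] in auto)
qed

subsection \<open>Strongly convex energies\<close>

lemma subspace_basis_expansion:
  fixes V :: "'e::euclidean_space set"
  assumes "subspace V"
  obtains b where "finite b" "b \<subseteq> V" "\<And>v. v \<in> V \<Longrightarrow> (\<Sum>i\<in>b. (v \<bullet> i) *\<^sub>R i) = v"
proof -
  obtain b where b: "b \<subseteq> V" "pairwise orthogonal b" "\<And>x. x \<in> b \<Longrightarrow> norm x = 1"
      "independent b" "span b = V"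
    using orthonormal_basis_subspace[OF assms] by metis
  have "finite b" using b(4) independent_imp_finite by blast
  with b orthonormal_basis_expand[of b] show ?thesis by (intro that[of b]) auto
qed

text \<open>B is given by its algebraic laws on V only. In an orthonormal basis B v v is a
  polynomial in the coordinates of v, hence continuous, and its minimum over the unit sphere of V is
  a positive constant c; homogeneity does the rest.\<close>

lemma inner_product_on_coercive:
  fixes V :: "'e::euclidean_space set"
  assumes V: "subspace V" and B: "inner_product_on V B"
  obtains c where "c > 0" "\<And>v. v \<in> V \<Longrightarrow> c * (norm v)\<^sup>2 \<le> B v v"
proof -
  obtain b where b: "finite b" "b \<subseteq> V" "\<And>v. v \<in> V \<Longrightarrow> (\<Sum>i\<in>b. (v \<bullet> i) *\<^sub>R i) = v"
    using subspace_basis_expansion[OF V] by blast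
  have add: "B (u + v) w = B u w + B v w" and scale: "B (a *\<^sub>R u) w = a * B u w" and sym: "B u w = B w u"
    and pos: "u \<noteq> 0 \<Longrightarrow> 0 < B u u" if "u \<in> V" "v \<in> V" "w \<in> V" for u v w a
    using B that unfolding inner_product_on_def by blast+
  have zero: "B 0 w = 0" if "w \<in> V" for w using scale[OF that that that, of 0] scale[of 0 0 w 0] subspace_0[OF V] that by simp
  have sum: "B (\<Sum>i\<in>s. a i *\<^sub>R i) w = (\<Sum>i\<in>s. a i * B i w)" if "finite s" "s \<subseteq> V" "w \<in> V" for a s w
    using that
  proof (induction s rule: finite_induct)
    case (insert x s)
    then have "(\<Sum>i\<in>s. a i *\<^sub>R i) \<in> V" by (intro subspace_sum[OF V] subspace_scale[OF V]) auto
    then show ?case using insert by (simp add: add scale subspace_scale[OF V])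
  qed (simp add: zero)
  have Q: "B v v = (\<Sum>i\<in>b. \<Sum>j\<in>b. (v \<bullet> i) * ((v \<bullet> j) * B j i))" if v: "v \<in> V" for v
  proof -
    have "B v v = B (\<Sum>i\<in>b. (v \<bullet> i) *\<^sub>R i) v" using b(3)[OF v] by simp
    also have "\<dots> = (\<Sum>i\<in>b. (v \<bullet> i) * B i v)" using sum[OF b(1,2) v] .
    also have "\<dots> = (\<Sum>i\<in>b. (v \<bullet> i) * (\<Sum>j\<in>b. (v \<bullet> j) * B j i))"
    proof (rule sum.cong[OF refl])
      fix i assume i: "i \<in> b"
      then have iV: "i \<in> V" using b(2) by auto
      have "B i v = B (\<Sum>j\<in>b. (v \<bullet> j) *\<^sub>R j) i" using b(3)[OF v] sym[OF iV v v] by simp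
      then show "(v \<bullet> i) * B i v = (v \<bullet> i) * (\<Sum>j\<in>b. (v \<bullet> j) * B j i)"
        using sum[OF b(1,2) iV] by simp
    qed
    finally show ?thesis by (simp add: sum_distrib_left)
  qed
  have comp: "compact (V \<inter> sphere 0 1)"
    using closed_subspace[OF V] by (intro closed_Int_compact) auto
  have cont: "continuous_on (V \<inter> sphere 0 1) (\<lambda>v. B v v)"
  proof -
    have "continuous_on (V \<inter> sphere 0 1) (\<lambda>v. \<Sum>i\<in>b. \<Sum>j\<in>b. (v \<bullet> i) * ((v \<bullet> j) * B j i))"
      by (intro continuous_intros)
    then show ?thesis using Q by (subst continuous_on_cong[OF refl]) auto
  qed
  note thesisI = that
  have key: thesis if c: "c > 0" "\<And>v. v \<in> V \<Longrightarrow> norm v = 1 \<Longrightarrow> c \<le> B v v" for c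
  proof (rule thesisI[OF c(1)])
    fix v assume v: "v \<in> V"
    show "c * (norm v)\<^sup>2 \<le> B v v"
    proof (cases "v = 0")
      case True
      then show ?thesis using zero[OF v] by simp
    next
      case False
      define w where "w = (1 / norm v) *\<^sub>R v"
      have w: "w \<in> V" "norm w = 1" "v = norm v *\<^sub>R w"
        using False v subspace_scale[OF V] by (auto simp: w_def)
      have "B v v = norm v * (norm v * B w w)"
        using scale[of w w v "norm v"] scale[of w w w "norm v"] sym[of w v] w(1,3) v by metis
      also have "\<dots> = (norm v)\<^sup>2 * B w w" by (simp add: power2_eq_square)
      finally show ?thesis using c(2)[OF w(1,2)] by (simp add: mult.commute[of c] mult_left_mono)
    qed
  qed
  show thesis
  \<comment> \<open>The sphere is empty when V is the zero space; then any positive constant will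
    do.\<close>
  proof (cases "V \<inter> sphere 0 1 = {}")
    case True
    then show thesis by (intro key[of 1]) auto
  next
    case False
    from continuous_attains_inf[OF comp this cont]
    obtain v0 where v0: "v0 \<in> V \<inter> sphere 0 1" "\<forall>v\<in>V \<inter> sphere 0 1. B v0 v0 \<le> B v v"
      by blast
    then have "v0 \<in> V" "v0 \<noteq> 0" by auto
    then have "B v0 v0 > 0" using pos by blast
    then show thesis using v0(2) by (intro key[of "B v0 v0"]) auto
  qed
qed

text \<open>Expanding in a basis bounds N by C times the Euclidean norm, and the triangle inequality
  turns this bound into Lipschitz continuity.\<close>

lemma norm_on_continuous:
  fixes V :: "'e::euclidean_space set"
  assumes V: "subspace V" and N: "norm_on V N"
  shows "continuous_on V N"
proof -
  obtain b where b: "finite b" "b \<subseteq> V" "\<And>v. v \<in> V \<Longrightarrow> (\<Sum>i\<in>b. (v \<bullet> i) *\<^sub>R i) = v"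
    using subspace_basis_expansion[OF V] by blast
  have nonneg: "0 \<le> N v" and zero: "N 0 = 0" and scale: "N (a *\<^sub>R v) = \<bar>a\<bar> * N v"
    and tri: "N (v + w) \<le> N v + N w" if "v \<in> V" "w \<in> V" for v w a
    using N that subspace_0[OF V] unfolding norm_on_def by blast+
  have sum: "N (\<Sum>i\<in>s. a i *\<^sub>R i) \<le> (\<Sum>i\<in>s. \<bar>a i\<bar> * N i)" if "finite s" "s \<subseteq> V" for a s
    using that
  proof (induction s rule: finite_induct)
    case (insert x s)
    then have *: "(\<Sum>i\<in>s. a i *\<^sub>R i) \<in> V" "x \<in> V"
      by (auto intro!: subspace_sum[OF V] subspace_scale[OF V])
    have "N (a x *\<^sub>R x + (\<Sum>i\<in>s. a i *\<^sub>R i)) \<le> N (a x *\<^sub>R x) + N (\<Sum>i\<in>s. a i *\<^sub>R i)"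
      using * by (intro tri subspace_scale[OF V])
    then show ?case using insert * by (simp add: scale)
  qed (use zero subspace_0[OF V] in simp)
  define C where "C = (\<Sum>i\<in>b. norm i * N i)"
  have C: "C \<ge> 0" unfolding C_def using b nonneg by (intro sum_nonneg mult_nonneg_nonneg) auto
  have bd: "N v \<le> C * norm v" if v: "v \<in> V" for v
  proof -
    have "N v \<le> (\<Sum>i\<in>b. \<bar>v \<bullet> i\<bar> * N i)" using sum[OF b(1,2), of "\<lambda>i. v \<bullet> i"] b(3)[OF v] by simp
    also have "\<dots> \<le> (\<Sum>i\<in>b. (norm v * norm i) * N i)"
      using b nonneg by (intro sum_mono mult_right_mono Cauchy_Schwarz_ineq2) auto
    also have "\<dots> = C * norm v" by (simp add: C_def sum_distrib_left mult_ac)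
    finally show ?thesis .
  qed
  have le: "N v - N w \<le> C * norm (v - w)" if "v \<in> V" "w \<in> V" for v w
  proof -
    have d: "v - w \<in> V" using that subspace_diff[OF V] by blast
    have "N v \<le> N (v - w) + N w" using tri[OF d that(2)] by simp
    then show ?thesis using bd[OF d] by simp
  qed
  have "C-lipschitz_on V N"
  proof (rule lipschitz_onI)
    fix v w assume "v \<in> V" "w \<in> V"
    then show "dist (N v) (N w) \<le> C * dist v w"
      using le[of v w] le[of w v] by (simp add: dist_real_def dist_norm norm_minus_commute abs_le_iff)
  qed (rule C)
  then show ?thesis by (rule lipschitz_on_continuous_on)
qed

text \<open>
  Covectors are represented by vectors of \<open>'e\<close> through the inner product. The point \<open>dual_vector V N m\<close> is
  the gradient at \<open>m\<close> of \<open>hamiltonian V N\<close>, the convex conjugate of the energy.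
\<close>
definition dual_vector :: "'e::euclidean_space set \<Rightarrow> ('e \<Rightarrow> real) \<Rightarrow> 'e \<Rightarrow> 'e" where
  "dual_vector V N m = (SOME w. w \<in> V \<and> (\<forall>v\<in>V. m \<bullet> (v - w) \<le> energy N v - energy N w))"

definition hamiltonian :: "'e::euclidean_space set \<Rightarrow> ('e \<Rightarrow> real) \<Rightarrow> 'e \<Rightarrow> real" where
  "hamiltonian V N m = m \<bullet> dual_vector V N m - energy N (dual_vector V N m)"

locale strongly_convex_energy =
  fixes V :: "'e::euclidean_space set" and N :: "'e \<Rightarrow> real"
  assumes subspace: "subspace V" and strongly_convex: "strongly_convex_norm_on V N"
begin

abbreviation "dual \<equiv> dual_vector V N"

text \<open>Convexity gains c / 4 times the squared distance at the midpoint of v and w. Testing the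
  subgradient inequality at the midpoint and doubling turns this into a gain of c / 2 in the
  inequality for v itself. Quadratic growth is the case w = 0, with nonnegative energy at v /
  2.\<close>

lemma subgradient_coercive:
  obtains c where "c > 0" "\<And>v. v \<in> V \<Longrightarrow> c * (norm v)\<^sup>2 \<le> energy N v"
    "\<And>m v w. v \<in> V \<Longrightarrow> w \<in> V \<Longrightarrow> (\<forall>v\<in>V. m \<bullet> (v - w) \<le> energy N v - energy N w) \<Longrightarrow>
       m \<bullet> (v - w) + c * (norm (v - w))\<^sup>2 \<le> energy N v - energy N w"
proof -
  let ?E = "energy N"
  obtain M where M: "euclidean_norm_on V M" and
    conv: "\<And>v w t. v \<in> V \<Longrightarrow> w \<in> V \<Longrightarrow> t \<in> {0..1} \<Longrightarrow>
        ?E (t *\<^sub>R v + (1 - t) *\<^sub>R w) \<le> t * ?E v + (1 - t) * ?E w - t * (1 - t) * (M (w - v))\<^sup>2"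
    using strongly_convex unfolding strongly_convex_norm_on_def by blast
  obtain B where B: "inner_product_on V B" "\<And>v. v \<in> V \<Longrightarrow> M v = sqrt (B v v)"
    using M unfolding euclidean_norm_on_def by blast
  obtain c where c: "c > 0" "\<And>v. v \<in> V \<Longrightarrow> c * (norm v)\<^sup>2 \<le> B v v"
    using inner_product_on_coercive[OF subspace B(1)] by blast
  have M2: "c * (norm v)\<^sup>2 \<le> (M v)\<^sup>2" if "v \<in> V" for v
  proof -
    have "0 \<le> c * (norm v)\<^sup>2" using c(1) by simp
    then have "0 \<le> B v v" using c(2)[OF that] by linarith
    then show ?thesis using B(2)[OF that] c(2)[OF that] by simp
  qed
  have E0: "?E 0 = 0" and Enn: "?E v \<ge> 0" for v
    using strongly_convex subspace_0[OF subspace]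
    unfolding strongly_convex_norm_on_def norm_on_def energy_def by auto
  have mid: "?E ((1/2) *\<^sub>R v + (1/2) *\<^sub>R w) \<le> ?E v / 2 + ?E w / 2 - c / 4 * (norm (v - w))\<^sup>2"
    if vw: "v \<in> V" "w \<in> V" for v w
    using conv[OF vw, of "1/2"] M2[OF subspace_diff[OF subspace vw(2,1)]]
    by (simp add: norm_minus_commute)
  show thesis
  proof (rule that[of "c / 2"])
    fix v assume v: "v \<in> V"
    have "0 \<le> ?E v / 2 - c / 4 * (norm v)\<^sup>2"
      using mid[OF v subspace_0[OF subspace]] Enn[of "(1/2) *\<^sub>R v"] E0 by simp
    then show "c / 2 * (norm v)\<^sup>2 \<le> ?E v" by simp
  next
    fix m v w assume vw: "v \<in> V" "w \<in> V" and sub: "\<forall>v\<in>V. m \<bullet> (v - w) \<le> ?E v - ?E w"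
    have "(1/2) *\<^sub>R v + (1/2) *\<^sub>R w \<in> V"
      using vw by (intro subspace_add[OF subspace] subspace_scale[OF subspace])
    moreover have "(1/2) *\<^sub>R v + (1/2) *\<^sub>R w - w = (1/2) *\<^sub>R (v - w)"
      by (simp add: algebra_simps flip: scaleR_add_left)
    ultimately have "m \<bullet> (v - w) / 2 \<le> ?E ((1/2) *\<^sub>R v + (1/2) *\<^sub>R w) - ?E w"
      using sub by fastforce
    then show "m \<bullet> (v - w) + c / 2 * (norm (v - w))\<^sup>2 \<le> ?E v - ?E w"
      using mid[OF vw] by simp
  qed (use c in simp)
qed

lemma subgradient_exists: "\<exists>w\<in>V. \<forall>v\<in>V. m \<bullet> (v - w) \<le> energy N v - energy N w"
proof -
  obtain c where c: "c > 0" "\<And>v. v \<in> V \<Longrightarrow> c * (norm v)\<^sup>2 \<le> energy N v"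
    using subgradient_coercive by metis
  \<comment> \<open>Beyond the radius norm m / c, quadratic growth makes \<open>?f\<close>
    nonnegative, hence no smaller than its value at 0. A minimum over the compact ball is therefore
    one over V, and a minimiser has m as subgradient.\<close>
  let ?K = "V \<inter> cball 0 (norm m / c)" and ?f = "\<lambda>v. energy N v - m \<bullet> v"
  have norm: "norm_on V N" using strongly_convex by (simp add: strongly_convex_norm_on_def)
  have "continuous_on V ?f" unfolding energy_def
    by (intro continuous_intros norm_on_continuous[OF subspace norm]) auto
  then have "continuous_on ?K ?f" by (rule continuous_on_subset) auto
  moreover have "compact ?K" using closed_subspace[OF subspace] by (intro closed_Int_compact) auto
  moreover have 0: "0 \<in> ?K" using subspace_0[OF subspace] c by simp
  ultimately obtain w where w: "w \<in> ?K" "\<And>v. v \<in> ?K \<Longrightarrow> ?f w \<le> ?f v"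
    using continuous_attains_inf[of ?K ?f] by blast
  have f0: "?f 0 = 0" using norm subspace_0[OF subspace] by (auto simp: norm_on_def energy_def)
  have le: "?f w \<le> ?f v" if v: "v \<in> V" for v
  proof (cases "v \<in> ?K")
    case False
    then have "norm m / c < norm v" using v by auto
    then have "norm m < c * norm v" using c(1) by (simp add: field_simps)
    then have "norm m * norm v \<le> c * norm v * norm v" by (intro mult_right_mono) auto
    then have "m \<bullet> v \<le> energy N v"
      using c(2)[OF v] norm_cauchy_schwarz[of m v] by (simp add: power2_eq_square mult.assoc)
    then show ?thesis using w(2)[OF 0] f0 by simp
  qed (use w in auto)
  have "m \<bullet> (v - w) \<le> energy N v - energy N w" if "v \<in> V" for v
    using le[OF that] by (simp add: inner_diff_right)
  then show ?thesis using w(1) by blast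
qed

lemma dual_in: "dual m \<in> V"
  and dual_subgradient: "v \<in> V \<Longrightarrow> m \<bullet> (v - dual m) \<le> energy N v - energy N (dual m)"
proof -
  have "dual m \<in> V \<and> (\<forall>v\<in>V. m \<bullet> (v - dual m) \<le> energy N v - energy N (dual m))"
    unfolding dual_vector_def by (rule someI_ex) (use subgradient_exists[of m] in blast)
  then show "dual m \<in> V" "v \<in> V \<Longrightarrow> m \<bullet> (v - dual m) \<le> energy N v - energy N (dual m)" by auto
qed

text \<open>Adding the strengthened inequalities for (m, v) and (n, w) cancels the energies, and
  Cauchy-Schwarz finishes. The case m = n yields uniqueness of \<open>dual\<close>, the general case
  its Lipschitz continuity.\<close>

lemma subgradient_monotone:
  obtains c where "c > 0" "\<And>m n v w. v \<in> V \<Longrightarrow> w \<in> V \<Longrightarrow>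
      (\<forall>x\<in>V. m \<bullet> (x - v) \<le> energy N x - energy N v) \<Longrightarrow>
      (\<forall>x\<in>V. n \<bullet> (x - w) \<le> energy N x - energy N w) \<Longrightarrow> c * norm (v - w) \<le> norm (m - n)"
proof -
  obtain c where c: "c > 0" "\<And>m v w. v \<in> V \<Longrightarrow> w \<in> V \<Longrightarrow>
      (\<forall>v\<in>V. m \<bullet> (v - w) \<le> energy N v - energy N w) \<Longrightarrow>
       m \<bullet> (v - w) + c * (norm (v - w))\<^sup>2 \<le> energy N v - energy N w"
    using subgradient_coercive by metis
  show thesis
  proof (rule that[OF c(1)])
    fix m n v w assume vw: "v \<in> V" "w \<in> V" and m: "\<forall>x\<in>V. m \<bullet> (x - v) \<le> energy N x - energy N v"
      and n: "\<forall>x\<in>V. n \<bullet> (x - w) \<le> energy N x - energy N w"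
    have "c * (norm (v - w))\<^sup>2 + c * (norm (v - w))\<^sup>2 \<le> (m - n) \<bullet> (v - w)"
      using c(2)[OF vw n] c(2)[OF vw(2,1) m] by (simp add: norm_minus_commute algebra_simps)
    also have "\<dots> \<le> norm (m - n) * norm (v - w)" by (rule norm_cauchy_schwarz)
    finally have "c * (norm (v - w))\<^sup>2 \<le> norm (m - n) * norm (v - w)"
      using c(1) by (smt (verit) mult_nonneg_nonneg zero_le_power2)
    then show "c * norm (v - w) \<le> norm (m - n)"
      by (cases "v = w") (auto simp: power2_eq_square mult.assoc[symmetric])
  qed
qed

lemma dual_unique:
  assumes "w \<in> V" "\<forall>v\<in>V. m \<bullet> (v - w) \<le> energy N v - energy N w"
  shows "w = dual m"
proof -
  obtain c where "c > 0" "c * norm (w - dual m) \<le> norm (m - m)"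
    using subgradient_monotone dual_in dual_subgradient assms by metis
  then show ?thesis by (simp add: mult_le_0_iff)
qed

lemma dual_lipschitz: obtains L where "L-lipschitz_on UNIV dual"
proof -
  obtain c where c: "c > 0" "\<And>m n. c * norm (dual m - dual n) \<le> norm (m - n)"
    using subgradient_monotone dual_in dual_subgradient by metis
  have "(1/c)-lipschitz_on UNIV dual"
    using c by (intro lipschitz_onI) (simp_all add: dist_norm field_simps)
  then show thesis by (rule that)
qed

text \<open>The strengthened inequality compared with the vector 0. It turns conservation of the
  Hamiltonian into a bound on the control.\<close>

lemma norm_dual_le_hamiltonian:
  obtains C where "C > 0" "\<And>m. (norm (dual m))\<^sup>2 \<le> C * hamiltonian V N m"
proof -
  obtain c where c: "c > 0" "\<And>m v w. v \<in> V \<Longrightarrow> w \<in> V \<Longrightarrow>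
      (\<forall>v\<in>V. m \<bullet> (v - w) \<le> energy N v - energy N w) \<Longrightarrow>
       m \<bullet> (v - w) + c * (norm (v - w))\<^sup>2 \<le> energy N v - energy N w"
    using subgradient_coercive by metis
  have "energy N 0 = 0"
    using strongly_convex subspace_0[OF subspace]
    unfolding strongly_convex_norm_on_def norm_on_def energy_def by auto
  then have "c * (norm (dual m))\<^sup>2 \<le> hamiltonian V N m" for m
    using c(2)[of 0 "dual m" m] subspace_0[OF subspace] dual_in dual_subgradient[of _ m]
    by (simp add: hamiltonian_def)
  then show thesis using c(1) by (intro that[of "1 / c"]) (auto simp: field_simps)
qed

text \<open>\<open>dual n\<close> maximises n \<bullet> v - energy N v over V, and
  \<open>dual m\<close> is one competitor. Exchanging m and n gives the matching upper
  bound.\<close>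

lemma hamiltonian_diff_ge: "(n - m) \<bullet> dual m \<le> hamiltonian V N n - hamiltonian V N m"
  using dual_subgradient[OF dual_in, of n m] by (simp add: hamiltonian_def algebra_simps)

end

subsection \<open>Partial derivatives\<close>

lemma has_derivative_partial2:
  assumes "open S" "Ck_on (Suc k) S f" "(x, y) \<in> S"
  shows "((\<lambda>y. f (x, y)) has_derivative (\<lambda>X. frechet_derivative f (at (x, y)) (0, X))) (at y)"
proof -
  have "(f has_derivative frechet_derivative f (at (x, y))) (at (x, y))"
    using Ck_on_differentiable[OF assms(2,1,3)] by (rule frechet_derivative_has_derivative)
  moreover have "((\<lambda>y. (x, y)) has_derivative (\<lambda>X. (0, X))) (at y)"
    by (intro has_derivative_Pair has_derivative_const has_derivative_ident)
  ultimately show ?thesis using has_derivative_compose[of "\<lambda>y. (x, y)" _ y UNIV f] by fastforce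
qed

text \<open>\<open>dL\<close> and \<open>Ad\<close> are derivatives of multiplication and
  conjugation in the second variable at the identity. This makes them smooth in the base point, at
  the cost of one order.\<close>

lemma Ck_on_partial2:
  assumes "open S" "Ck_on (Suc k) S f"
  shows "Ck_on k {x. (x, y0) \<in> S} (\<lambda>x. frechet_derivative (\<lambda>y. f (x, y)) (at y0) X)"
proof -
  let ?T = "{x. (x, y0) \<in> S}"
  have T: "open ?T"
    using open_vimage[OF assms(1), of "\<lambda>x. (x, y0)"] by (simp add: vimage_def continuous_intros)
  have "Ck_on k ?T (\<lambda>x. (x, y0))"
    by (intro Ck_on_Pair T Ck_on_const Ck_on_linear bounded_linear_ident)
  then have "Ck_on k ?T (\<lambda>x. frechet_derivative f (at (x, y0)) (0, X))"
    using assms by (intro Ck_on_compose[where g = "\<lambda>p. frechet_derivative f (at p) (0, X)" and T = S, OF T assms(1)]) auto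
  then show ?thesis
    by (rule Ck_on_cong_imp[OF T, rotated])
      (use frechet_derivative_eqI[OF has_derivative_partial2[OF assms]] in simp)
qed

text \<open>
  By the mean value theorem, applied in both variables, the second difference of \<open>\<psi>\<close> over a square
  is a value of the mixed derivative \<open>Q\<close> times the area of the square.
\<close>
lemma mixed_derivative_zero:
  fixes \<psi> P Q :: "real \<Rightarrow> real \<Rightarrow> real"
  assumes d: "\<delta> > 0"
    and P: "\<And>s r. \<bar>s\<bar> < \<delta> \<Longrightarrow> \<bar>r\<bar> < \<delta> \<Longrightarrow> ((\<lambda>r. \<psi> s r) has_real_derivative P s r) (at r)"
    and Q: "\<And>s r. \<bar>s\<bar> < \<delta> \<Longrightarrow> \<bar>r\<bar> < \<delta> \<Longrightarrow> ((\<lambda>s. P s r) has_real_derivative Q s r) (at s)"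
    and cont: "continuous (at (0, 0)) (\<lambda>(s, r). Q s r)"
    and zero: "\<And>s. 0 < s \<Longrightarrow> s < \<delta> \<Longrightarrow> \<psi> s s - \<psi> s 0 - \<psi> 0 s + \<psi> 0 0 = 0"
  shows "Q 0 0 = 0"
proof (rule ccontr)
  assume "Q 0 0 \<noteq> 0"
  then have "\<bar>Q 0 0\<bar> > 0" by simp
  from cont[unfolded continuous_at_eps_delta, rule_format, OF this]
  have "\<exists>e>0. \<forall>p. dist p (0, 0) < e \<longrightarrow> dist (Q (fst p) (snd p)) (Q 0 0) < \<bar>Q 0 0\<bar>"
    by (simp add: case_prod_unfold)
  then obtain e where e: "e > 0" "\<forall>p. dist p (0, 0) < e \<longrightarrow> dist (Q (fst p) (snd p)) (Q 0 0) < \<bar>Q 0 0\<bar>"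
    by auto
  \<comment> \<open>The intermediate points \<sigma> and \<theta> below lie between 0 and s, so
    their sum is less than 2 s < e.\<close>
  define s where "s = min (\<delta> / 2) (e / 4)"
  have s: "0 < s" "s < \<delta>" "2 * s < e" using d e by (auto simp: s_def)
  have "\<exists>\<theta>>0. \<theta> < s \<and> (\<psi> s s - \<psi> 0 s) - (\<psi> s 0 - \<psi> 0 0) = (s - 0) * (P s \<theta> - P 0 \<theta>)"
    using s by (intro MVT2[of 0 s "\<lambda>r. \<psi> s r - \<psi> 0 r"] DERIV_diff P) auto
  then obtain \<theta> where t: "0 < \<theta>" "\<theta> < s"
      "(\<psi> s s - \<psi> 0 s) - (\<psi> s 0 - \<psi> 0 0) = (s - 0) * (P s \<theta> - P 0 \<theta>)"
    by (elim exE conjE)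
  have "(s - 0) * (P s \<theta> - P 0 \<theta>) = 0" using zero[OF s(1,2)] t(3) by linarith
  then have t3: "s * (P s \<theta> - P 0 \<theta>) = 0" by simp
  have "\<exists>\<sigma>>0. \<sigma> < s \<and> P s \<theta> - P 0 \<theta> = (s - 0) * Q \<sigma> \<theta>"
    using s t by (intro MVT2[of 0 s "\<lambda>s. P s \<theta>"] Q) auto
  then obtain \<sigma> where g: "0 < \<sigma>" "\<sigma> < s" "Q \<sigma> \<theta> = 0" using t3 s by auto
  have "dist (\<sigma>, \<theta>) (0, 0) \<le> \<bar>\<sigma>\<bar> + \<bar>\<theta>\<bar>"
    using norm_Pair_le[of \<sigma> \<theta>] by (simp add: dist_norm)
  also have "\<dots> < e" using g t s by simp
  finally have "dist (Q \<sigma> \<theta>) (Q 0 0) < \<bar>Q 0 0\<bar>" using e(2) by (metis fst_conv snd_conv)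
  then show False using g by (simp add: dist_real_def)
qed

subsection \<open>Charts of a Lie group\<close>

context lie_group
begin

lemma chart_open: "c \<in> A \<Longrightarrow> open (chart_dom c)" "c \<in> A \<Longrightarrow> open (chart_img c)"
  using charts by (auto simp: is_chart_def)

lemma chart_homeomorphism:
  "c \<in> A \<Longrightarrow> homeomorphism (chart_dom c) (chart_img c) (coord c) (coord_inv c)"
  using charts by (auto simp: is_chart_def)

lemma coord_inv_coord [simp]: "c \<in> A \<Longrightarrow> g \<in> chart_dom c \<Longrightarrow> coord_inv c (coord c g) = g"
  using homeomorphism_apply1[OF chart_homeomorphism] .

lemma coord_coord_inv [simp]: "c \<in> A \<Longrightarrow> x \<in> chart_img c \<Longrightarrow> coord c (coord_inv c x) = x"
  using homeomorphism_apply2[OF chart_homeomorphism] .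

lemma coord_inv_in [simp]: "c \<in> A \<Longrightarrow> x \<in> chart_img c \<Longrightarrow> coord_inv c x \<in> chart_dom c"
  using homeomorphism_image2[OF chart_homeomorphism] by blast

lemma coord_in [simp]: "g \<in> chart_dom c \<Longrightarrow> coord c g \<in> chart_img c"
  by (simp add: chart_img_def)

lemma continuous_on_coord: "c \<in> A \<Longrightarrow> continuous_on (chart_dom c) (coord c)"
  using homeomorphism_cont1[OF chart_homeomorphism] .

lemma continuous_on_coord_inv: "c \<in> A \<Longrightarrow> continuous_on (chart_img c) (coord_inv c)"
  using homeomorphism_cont2[OF chart_homeomorphism] .

lemma chart_at: obtains c where "c \<in> A" "g \<in> chart_dom c"
proof -
  have "g \<in> (\<Union>c\<in>A. chart_dom c)" using atlas_covers by simp
  then show thesis using that by blast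
qed

lemma open_chart_preimage:
  assumes "c \<in> A" "open S" "continuous_on S f"
  shows "open {x \<in> S. f x \<in> chart_dom c}"
proof -
  have "{x \<in> S. f x \<in> chart_dom c} = S \<inter> f -` chart_dom c" by auto
  then show ?thesis using continuous_open_preimage[OF assms(3,2) chart_open(1)[OF assms(1)]] by simp
qed

definition mul_dom where
  "mul_dom b c d = {p \<in> chart_img b \<times> chart_img c. coord_inv b (fst p) + coord_inv c (snd p) \<in> chart_dom d}"

definition mul where
  "mul b c d = (\<lambda>p. coord d (coord_inv b (fst p) + coord_inv c (snd p)))"

lemma continuous_on_coord_inv_pair:
  assumes "b \<in> A" "c \<in> A"
  shows "continuous_on (chart_img b \<times> chart_img c) (\<lambda>p. coord_inv b (fst p))"
    "continuous_on (chart_img b \<times> chart_img c) (\<lambda>p. coord_inv c (snd p))"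
  by (rule continuous_on_compose2[OF continuous_on_coord_inv[OF assms(1)] continuous_on_fst[OF continuous_on_id]], force)
    (rule continuous_on_compose2[OF continuous_on_coord_inv[OF assms(2)] continuous_on_snd[OF continuous_on_id]], force)

lemma open_mul_dom:
  assumes "b \<in> A" "c \<in> A" "d \<in> A" shows "open (mul_dom b c d)"
  unfolding mul_dom_def using assms
  by (intro open_chart_preimage open_Times chart_open continuous_on_add continuous_on_coord_inv_pair)

lemma Ck_mul:
  assumes "b \<in> A" "c \<in> A" "d \<in> A" shows "Ck_on k (mul_dom b c d) (mul b c d)"
proof -
  have "mul_dom b c d = {(x, y). x \<in> chart_img b \<and> y \<in> chart_img c \<and> coord_inv b x + coord_inv c y \<in> chart_dom d}"
    "mul b c d = (\<lambda>(x, y). coord d (coord_inv b x + coord_inv c y))"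
    by (auto simp: mul_dom_def mul_def)
  then show ?thesis using smooth_mult[OF assms] by (simp add: smooth_on_def)
qed

text \<open>Translation is \<open>mul a b c\<close> with its first variable frozen at
  \<open>coord a g\<close>, for any chart a around g.\<close>

lemma Ck_translation:
  assumes "b \<in> A" "c \<in> A"
  shows "open {y \<in> chart_img b. g + coord_inv b y \<in> chart_dom c}"
    "Ck_on k {y \<in> chart_img b. g + coord_inv b y \<in> chart_dom c} (\<lambda>y. coord c (g + coord_inv b y))"
proof -
  let ?S = "{y \<in> chart_img b. g + coord_inv b y \<in> chart_dom c}"
  show S: "open ?S"
    using assms by (intro open_chart_preimage chart_open continuous_intros continuous_on_coord_inv)
  obtain a where a: "a \<in> A" "g \<in> chart_dom a" using chart_at .
  have "Ck_on k ?S (\<lambda>y. mul a b c (coord a g, y))"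
  proof (rule Ck_on_compose[OF S open_mul_dom[OF a(1) assms]])
    show "(\<lambda>y. (coord a g, y)) ` ?S \<subseteq> mul_dom a b c" using a by (auto simp: mul_dom_def)
    show "Ck_on k ?S (\<lambda>y. (coord a g, y))"
      by (intro Ck_on_Pair S Ck_on_const Ck_on_linear bounded_linear_ident)
  qed (intro Ck_mul a assms)
  then show "Ck_on k ?S (\<lambda>y. coord c (g + coord_inv b y))"
    using a by (simp add: mul_def)
qed

text \<open>The intermediate product of g and x is required to stay in the chart c of g. Conjugation
  is then a composition of two multiplications and an inversion in fixed charts, and all points near
  (g, 0) still qualify.\<close>

definition conj_dom where
  "conj_dom c k = {p \<in> mul_dom c k c. coord_inv c (fst p) + coord_inv k (snd p) - coord_inv c (fst p) \<in> chart_dom k}"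

definition conj_map where
  "conj_map c k = (\<lambda>p. coord k (coord_inv c (fst p) + coord_inv k (snd p) - coord_inv c (fst p)))"

lemma mul_dom_subset: "mul_dom b c d \<subseteq> chart_img b \<times> chart_img c"
  by (auto simp: mul_dom_def)

lemma open_conj_dom:
  assumes "c \<in> A" "k \<in> A" shows "open (conj_dom c k)"
  unfolding conj_dom_def diff_conv_add_uminus using assms
  by (intro open_chart_preimage open_mul_dom continuous_on_add continuous_on_minus
      continuous_on_subset[OF continuous_on_coord_inv_pair(1) mul_dom_subset]
      continuous_on_subset[OF continuous_on_coord_inv_pair(2) mul_dom_subset])

text \<open>No single chart need contain the inverses of all points of c, so the domain is cut into
  the open sets where the inverse lies in a given chart d. Smoothness is proved on each and glued by
  \<open>Ck_on_Union\<close>.\<close>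

lemma Ck_conj_map:
  assumes "c \<in> A" "k \<in> A" shows "Ck_on n (conj_dom c k) (conj_map c k)"
proof -
  define S where "S = (\<lambda>d::('g, 'e) chart. {p \<in> conj_dom c k. - coord_inv c (fst p) \<in> chart_dom d})"
  have sub: "conj_dom c k \<subseteq> chart_img c \<times> chart_img k" by (auto simp: conj_dom_def mul_dom_def)
  have S: "open (S d)" if "d \<in> A" for d
    unfolding S_def using assms that
    by (intro open_chart_preimage open_conj_dom continuous_on_minus
        continuous_on_subset[OF continuous_on_coord_inv_pair(1) sub])
  have "Ck_on n (S d) (conj_map c k)" if d: "d \<in> A" for d
  proof -
    let ?I = "{x. x \<in> chart_img c \<and> - coord_inv c x \<in> chart_dom d}"
    have I: "open ?I"
      using open_chart_preimage[OF d chart_open(2)[OF assms(1)] continuous_on_minus[OF continuous_on_coord_inv[OF assms(1)]]]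
      by simp
    have 1: "Ck_on n (S d) (mul c k c)"
      using Ck_mul[OF assms(1,2,1)] by (rule Ck_on_subset) (auto simp: S_def conj_dom_def)
    have 2: "Ck_on n (S d) (\<lambda>p. coord d (- coord_inv c (fst p)))"
    proof (rule Ck_on_compose[OF S[OF d] I, where f = fst and g = "\<lambda>x. coord d (- coord_inv c x)"])
      show "fst ` S d \<subseteq> ?I" using sub by (auto simp: S_def)
      show "Ck_on n (S d) fst" by (intro Ck_on_linear S d bounded_linear_fst)
      show "Ck_on n ?I (\<lambda>x. coord d (- coord_inv c x))"
        using smooth_inverse[OF assms(1) d] by (simp add: smooth_on_def)
    qed
    have 3: "Ck_on n (S d) (\<lambda>p. mul c d k (mul c k c p, coord d (- coord_inv c (fst p))))"
    proof (rule Ck_on_compose[OF S[OF d] open_mul_dom[OF assms(1) d assms(2)]])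
      show "Ck_on n (S d) (\<lambda>p. (mul c k c p, coord d (- coord_inv c (fst p))))"
        by (intro Ck_on_Pair S d 1 2)
      show "(\<lambda>p. (mul c k c p, coord d (- coord_inv c (fst p)))) ` S d \<subseteq> mul_dom c d k"
        using assms d by (auto simp: S_def conj_dom_def mul_dom_def mul_def)
    qed (intro Ck_mul assms d)
    show ?thesis
      by (rule Ck_on_cong_imp[OF S[OF d] _ 3])
        (use assms d in \<open>auto simp: S_def conj_dom_def mul_dom_def mul_def conj_map_def\<close>)
  qed
  then have "Ck_on n (\<Union>d\<in>A. S d) (conj_map c k)" by (intro Ck_on_Union S)
  moreover have "(\<Union>d\<in>A. S d) = conj_dom c k"
    using atlas_covers by (auto simp: S_def)
  ultimately show ?thesis by simp
qed

end

subsection \<open>The differentials of the translations and of the conjugations\<close>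

locale lie_group_chart = lie_group A
  for A :: "('g::{topological_group_add, t2_space, second_countable_topology},
             'e::euclidean_space) chart set" +
  fixes \<kappa> :: "('g, 'e) chart"
  assumes kappa: "\<kappa> \<in> A" "0 \<in> chart_dom \<kappa>"
begin

lemma coord_inv_coord_0 [simp]: "coord_inv \<kappa> (coord \<kappa> 0) = 0"
  using kappa by simp

lemma mul_dom_e: "c \<in> A \<Longrightarrow> {x. (x, coord \<kappa> 0) \<in> mul_dom c \<kappa> c} = chart_img c"
  using kappa by (auto simp: mul_dom_def)

lemma conj_dom_e: "c \<in> A \<Longrightarrow> {x. (x, coord \<kappa> 0) \<in> conj_dom c \<kappa>} = chart_img c"
  using kappa by (auto simp: conj_dom_def mul_dom_def)

lemma Ck_dL:
  assumes "c \<in> A" shows "Ck_on k (chart_img c) (\<lambda>x. dL \<kappa> c (coord_inv c x) X)"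
  using Ck_on_partial2[OF open_mul_dom[OF assms kappa(1) assms] Ck_mul[OF assms kappa(1) assms], of k "coord \<kappa> 0" X]
  unfolding mul_dom_e[OF assms] by (simp add: mul_def dL_def)

lemma Ck_Ad:
  assumes "c \<in> A" shows "Ck_on k (chart_img c) (\<lambda>x. Ad \<kappa> (coord_inv c x) X)"
  using Ck_on_partial2[OF open_conj_dom[OF assms kappa(1)] Ck_conj_map[OF assms kappa(1)], of k "coord \<kappa> 0" X]
  unfolding conj_dom_e[OF assms] by (simp add: conj_map_def Ad_def)

section \<open>Chain rules for translations and conjugations\<close>

lemma translation_has_derivative:
  assumes "b \<in> A" "c \<in> A" "h \<in> chart_dom b" "g + h \<in> chart_dom c"
  shows "((\<lambda>y. coord c (g + coord_inv b y)) has_derivative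
    frechet_derivative (\<lambda>y. coord c (g + coord_inv b y)) (at (coord b h))) (at (coord b h))"
proof -
  have "coord b h \<in> {y \<in> chart_img b. g + coord_inv b y \<in> chart_dom c}" using assms by simp
  from Ck_on_differentiable[OF Ck_translation(2)[OF assms(1,2), where k = "Suc 0"] Ck_translation(1)[OF assms(1,2)] this]
  show ?thesis by (rule frechet_derivative_has_derivative)
qed

lemma dL_has_derivative:
  assumes "c \<in> A" "g \<in> chart_dom c"
  shows "((\<lambda>y. coord c (g + coord_inv \<kappa> y)) has_derivative dL \<kappa> c g) (at (coord \<kappa> 0))"
  using translation_has_derivative[OF kappa(1) assms(1) kappa(2), of g] assms(2)
  unfolding dL_def[abs_def] by simp

lemma linear_dL: "c \<in> A \<Longrightarrow> g \<in> chart_dom c \<Longrightarrow> linear (dL \<kappa> c g)"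
  using has_derivative_linear[OF dL_has_derivative] .

lemma Ad_has_derivative: "((\<lambda>y. coord \<kappa> (g + coord_inv \<kappa> y - g)) has_derivative Ad \<kappa> g) (at (coord \<kappa> 0))"
proof -
  obtain c where c: "c \<in> A" "g \<in> chart_dom c" using chart_at .
  have "(coord c g, coord \<kappa> 0) \<in> conj_dom c \<kappa>" using conj_dom_e[OF c(1)] c by auto
  from has_derivative_partial2[OF open_conj_dom[OF c(1) kappa(1)] Ck_conj_map[OF c(1) kappa(1), of "Suc 0"] this]
  have "(\<lambda>y. conj_map c \<kappa> (coord c g, y)) differentiable (at (coord \<kappa> 0))"
    by (rule differentiableI)
  from frechet_derivative_has_derivative[OF this] show ?thesis
    using c by (simp add: conj_map_def Ad_def[abs_def])
qed

lemma linear_Ad: "linear (Ad \<kappa> g)"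
  using has_derivative_linear[OF Ad_has_derivative] .

lemma open_conj_preimage: "open {y \<in> chart_img \<kappa>. g + coord_inv \<kappa> y - g \<in> chart_dom \<kappa>}"
  unfolding diff_conv_add_uminus using kappa
  by (intro open_chart_preimage chart_open continuous_intros continuous_on_coord_inv)

text \<open>Conjugation by g + h is a composition of conjugations; in coordinates this holds only
  where the inner conjugate stays in \<kappa>, a neighbourhood of the identity.\<close>

lemma Ad_add: "Ad \<kappa> (g + h) X = Ad \<kappa> g (Ad \<kappa> h X)"
proof -
  let ?\<phi> = "\<lambda>g y. coord \<kappa> (g + coord_inv \<kappa> y - g)"
  have "((\<lambda>y. ?\<phi> g (?\<phi> h y)) has_derivative (\<lambda>X. Ad \<kappa> g (Ad \<kappa> h X))) (at (coord \<kappa> 0))"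
    by (rule has_derivative_compose[OF Ad_has_derivative[of h]]) (simp add: Ad_has_derivative)
  moreover have "?\<phi> g (?\<phi> h y) = ?\<phi> (g + h) y" if "y \<in> {y \<in> chart_img \<kappa>. h + coord_inv \<kappa> y - h \<in> chart_dom \<kappa>}" for y
    using that kappa by (simp add: add.assoc minus_add diff_conv_add_uminus del: add_uminus_conv_diff)
  ultimately have "(?\<phi> (g + h) has_derivative (\<lambda>X. Ad \<kappa> g (Ad \<kappa> h X))) (at (coord \<kappa> 0))"
    using has_derivative_cong_open[OF open_conj_preimage[of h], of "coord \<kappa> 0" "\<lambda>y. ?\<phi> g (?\<phi> h y)" "?\<phi> (g + h)"]
      kappa by simp
  from has_derivative_unique[OF this Ad_has_derivative] show ?thesis by metis
qed

lemma dL_0: "dL \<kappa> \<kappa> 0 X = X"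
proof -
  have "((\<lambda>y. coord \<kappa> (0 + coord_inv \<kappa> y)) has_derivative (\<lambda>X. X)) (at (coord \<kappa> 0))"
    using has_derivative_cong_open[OF chart_open(2)[OF kappa(1)], of "coord \<kappa> 0" "\<lambda>y. coord \<kappa> (0 + coord_inv \<kappa> y)" "\<lambda>y. y"]
      kappa by (simp add: has_derivative_ident)
  from has_derivative_unique[OF this dL_has_derivative[OF kappa]] show ?thesis by metis
qed

text \<open>Left invariance of the fields given by \<open>dL\<close>, by the chain rule. It carries
  equations between the identity and an arbitrary point.\<close>

lemma dL_translation:
  assumes "b \<in> A" "c \<in> A" "h \<in> chart_dom b" "g + h \<in> chart_dom c"
  shows "dL \<kappa> c (g + h) X =
    frechet_derivative (\<lambda>y. coord c (g + coord_inv b y)) (at (coord b h)) (dL \<kappa> b h X)"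
proof -
  let ?T = "\<lambda>y. coord c (g + coord_inv b y)" and ?S = "{y \<in> chart_img \<kappa>. h + coord_inv \<kappa> y \<in> chart_dom b}"
  have "((\<lambda>y. ?T (coord b (h + coord_inv \<kappa> y))) has_derivative
      (\<lambda>X. frechet_derivative ?T (at (coord b h)) (dL \<kappa> b h X))) (at (coord \<kappa> 0))"
    by (rule has_derivative_compose[OF dL_has_derivative[OF assms(1,3)]])
      (use translation_has_derivative[OF assms] in simp)
  moreover have "?T (coord b (h + coord_inv \<kappa> y)) = coord c (g + h + coord_inv \<kappa> y)" if "y \<in> ?S" for y
    using that assms by (simp add: add.assoc)
  ultimately have "((\<lambda>y. coord c (g + h + coord_inv \<kappa> y)) has_derivative
      (\<lambda>X. frechet_derivative ?T (at (coord b h)) (dL \<kappa> b h X))) (at (coord \<kappa> 0))"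
    using has_derivative_cong_open[OF Ck_translation(1)[OF kappa(1) assms(1), of h], of "coord \<kappa> 0"
        "\<lambda>y. ?T (coord b (h + coord_inv \<kappa> y))" "\<lambda>y. coord c (g + h + coord_inv \<kappa> y)"]
      kappa assms(3) by simp
  from has_derivative_unique[OF this dL_has_derivative[OF assms(2,4)]] show ?thesis by metis
qed

text \<open>
  The infinitesimal form of \<open>[X, X] = 0\<close>: in coordinates, conjugation \<open>a (x, y)\<close> satisfies
  \<open>a (x, x) = x\<close>, \<open>a (x, 0) = 0\<close> and \<open>a (0, y) = y\<close>, so its mixed second derivative vanishes on \<open>(X, X)\<close>.
\<close>
lemma Ad_derivative_self:
  assumes B: "((\<lambda>x. Ad \<kappa> (coord_inv \<kappa> x) X) has_derivative B) (at (coord \<kappa> 0))"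
  shows "B X = 0"
proof -
  let ?e = "coord \<kappa> 0" and ?S = "conj_dom \<kappa> \<kappa>" and ?a = "conj_map \<kappa> \<kappa>"
  have S: "open ?S" and a: "Ck_on n ?S ?a" for n
    using open_conj_dom Ck_conj_map kappa by auto
  \<comment> \<open>At (x, \<open>?e\<close>) this is \<open>Ad\<close> of the point x applied to X,
    so B X is the derivative of D in the direction (X, 0).\<close>
  define D where "D = (\<lambda>p. frechet_derivative ?a (at p) (0, X))"
  have D: "Ck_on n ?S D" for n using a[of "Suc n"] by (simp add: D_def)
  define l where "l = (\<lambda>(s::real, r::real). (?e + s *\<^sub>R X, ?e + r *\<^sub>R X))"
  have lc: "continuous_on UNIV l" unfolding l_def case_prod_unfold by (intro continuous_intros)
  have "l (0, 0) \<in> ?S" using conj_dom_e[OF kappa(1)] kappa by (auto simp: l_def)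
  moreover have "open (l -` ?S)" using open_vimage[OF S lc] .
  ultimately obtain \<delta>' where d': "\<delta>' > 0" "ball (0, 0) \<delta>' \<subseteq> l -` ?S"
    by (meson openE vimageI2)
  define \<delta> where "\<delta> = \<delta>' / 2"
  have d: "\<delta> > 0" using d' by (simp add: \<delta>_def)
  have lS: "l (s, r) \<in> ?S" if "\<bar>s\<bar> < \<delta>" "\<bar>r\<bar> < \<delta>" for s r
  proof -
    have "dist (0, 0) (s, r) \<le> \<bar>s\<bar> + \<bar>r\<bar>"
      using norm_Pair_le[of s r] by (subst dist_commute) (simp add: dist_norm)
    also have "\<dots> < \<delta>'" using that by (simp add: \<delta>_def)
    finally have "(s, r) \<in> ball (0, 0) \<delta>'" by simp
    then show ?thesis using d'(2) by blast
  qed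
  \<comment> \<open>The mean value theorem needs real values, so everything is tested against an
    arbitrary w.\<close>
  have "B X \<bullet> w = 0" for w
  proof -
    define \<psi> where "\<psi> = (\<lambda>s r. ?a (l (s, r)) \<bullet> w)"
    define P where "P = (\<lambda>s r. D (l (s, r)) \<bullet> w)"
    define Q where "Q = (\<lambda>s r. frechet_derivative D (at (l (s, r))) (X, 0) \<bullet> w)"
    have lr: "((\<lambda>r. l (s, r)) has_derivative (\<lambda>h. (0, h *\<^sub>R X))) (at r)" for s r
      unfolding l_def by (auto intro!: derivative_eq_intros)
    have ls: "((\<lambda>s. l (s, r)) has_derivative (\<lambda>h. (h *\<^sub>R X, 0))) (at s)" for s r
      unfolding l_def by (auto intro!: derivative_eq_intros)
    have "Q 0 0 = 0"
    proof (rule mixed_derivative_zero[OF d, of \<psi> P Q])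
      fix s r :: real assume sr: "\<bar>s\<bar> < \<delta>" "\<bar>r\<bar> < \<delta>"
      have da: "(?a has_derivative frechet_derivative ?a (at (l (s, r)))) (at (l (s, r)))"
        using Ck_on_differentiable[OF a[of "Suc 0"] S lS[OF sr]] by (rule frechet_derivative_has_derivative)
      have "((\<lambda>r. ?a (l (s, r)) \<bullet> w) has_derivative (\<lambda>h. frechet_derivative ?a (at (l (s, r))) (0, h *\<^sub>R X) \<bullet> w)) (at r)"
        by (intro has_derivative_inner_left has_derivative_compose[OF lr da])
      moreover have "frechet_derivative ?a (at (l (s, r))) (0, h *\<^sub>R X) = h *\<^sub>R D (l (s, r))" for h
        using linear_scale[OF has_derivative_linear[OF da], of h "(0, X)"] by (simp add: D_def)
      ultimately show "((\<lambda>r. \<psi> s r) has_real_derivative P s r) (at r)"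
        unfolding \<psi>_def P_def has_field_derivative_def by (simp add: mult.commute[of _ "_ \<bullet> _"])
      have dD: "(D has_derivative frechet_derivative D (at (l (s, r)))) (at (l (s, r)))"
        using Ck_on_differentiable[OF D[of "Suc 0"] S lS[OF sr]] by (rule frechet_derivative_has_derivative)
      have "((\<lambda>s. D (l (s, r)) \<bullet> w) has_derivative (\<lambda>h. frechet_derivative D (at (l (s, r))) (h *\<^sub>R X, 0) \<bullet> w)) (at s)"
        by (intro has_derivative_inner_left has_derivative_compose[OF ls dD])
      moreover have "frechet_derivative D (at (l (s, r))) (h *\<^sub>R X, 0) = h *\<^sub>R frechet_derivative D (at (l (s, r))) (X, 0)" for h
        using linear_scale[OF has_derivative_linear[OF dD], of h "(X, 0)"] by simp
      ultimately show "((\<lambda>s. P s r) has_real_derivative Q s r) (at s)"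
        unfolding P_def Q_def has_field_derivative_def by (simp add: mult.commute[of _ "_ \<bullet> _"])
    next
      have "continuous_on ?S (\<lambda>p. frechet_derivative D (at p) (X, 0))" 
        using D[of "Suc 0"] unfolding Ck_on.simps by blast
      then have "continuous_on (l -` ?S) (\<lambda>q. frechet_derivative D (at (l q)) (X, 0))"
        by (rule continuous_on_compose2[OF _ continuous_on_subset[OF lc]]) auto
      then have "continuous_on (l -` ?S) (\<lambda>q. frechet_derivative D (at (l q)) (X, 0) \<bullet> w)"
        by (intro continuous_on_inner continuous_on_const)
      then show "continuous (at (0, 0)) (\<lambda>(s, r). Q s r)"
        using \<open>open (l -` ?S)\<close> \<open>l (0, 0) \<in> ?S\<close>
        by (simp add: Q_def case_prod_unfold continuous_on_eq_continuous_at)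
    next
      fix s :: real assume s: "0 < s" "s < \<delta>"
      have "?a (l (s, s)) = ?e + s *\<^sub>R X" "?a (l (s, 0)) = ?e" "?a (l (0, s)) = ?e + s *\<^sub>R X" "?a (l (0, 0)) = ?e"
        using lS[of s s] lS[of s 0] s d kappa by (auto simp: l_def conj_map_def conj_dom_def mul_dom_def)
      then show "\<psi> s s - \<psi> s 0 - \<psi> 0 s + \<psi> 0 0 = 0" by (simp add: \<psi>_def)
    qed
    moreover have "B X = frechet_derivative D (at (?e, ?e)) (X, 0)"
    proof -
      have l0: "l (0, 0) = (?e, ?e)" by (simp add: l_def)
      have dD: "(D has_derivative frechet_derivative D (at (?e, ?e))) (at (?e, ?e))"
        using Ck_on_differentiable[OF D[of "Suc 0"] S lS[of 0 0]] d l0 frechet_derivative_has_derivative by simp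
      have "((\<lambda>x. (x, ?e)) has_derivative (\<lambda>h. (h, 0))) (at ?e)"
        by (intro has_derivative_Pair has_derivative_const has_derivative_ident)
      from has_derivative_compose[OF this dD]
      have "((\<lambda>x. D (x, ?e)) has_derivative (\<lambda>h. frechet_derivative D (at (?e, ?e)) (h, 0))) (at ?e)" .
      moreover have "D (x, ?e) = Ad \<kappa> (coord_inv \<kappa> x) X" if "x \<in> chart_img \<kappa>" for x
      proof -
        have "(x, ?e) \<in> ?S" using conj_dom_e[OF kappa(1)] that by auto
        from frechet_derivative_eqI[OF has_derivative_partial2[OF S a[of "Suc 0"] this]]
        show ?thesis by (simp add: D_def Ad_def conj_map_def fun_eq_iff)
      qed
      ultimately have "((\<lambda>x. Ad \<kappa> (coord_inv \<kappa> x) X) has_derivative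
          (\<lambda>h. frechet_derivative D (at (?e, ?e)) (h, 0))) (at ?e)"
        using has_derivative_cong_open[OF chart_open(2)[OF kappa(1)], of ?e "\<lambda>x. D (x, ?e)" "\<lambda>x. Ad \<kappa> (coord_inv \<kappa> x) X"]
          kappa by simp
      from has_derivative_unique[OF B this] show ?thesis by metis
    qed
    ultimately show ?thesis by (simp add: Q_def l_def)
  qed
  then show ?thesis by (metis inner_eq_zero_iff)
qed

end

subsection \<open>The normal equation\<close>

locale normal_equation = sub_finsler_lie_group A \<kappa> V N
  for A :: "('g::{topological_group_add, t2_space, second_countable_topology},
             'e::euclidean_space) chart set" and \<kappa> V N +
  fixes \<eta> :: "'e \<Rightarrow> real"
  assumes strongly_convex_N: "strongly_convex_norm_on V N" and linear_\<eta>: "linear \<eta>"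
begin

sublocale lie_group_chart A \<kappa>
  using identity_chart by unfold_locales

sublocale strongly_convex_energy V N
  using polarization strongly_convex_N by unfold_locales

text \<open>The Riesz representative of \<eta> \<circ> Ad g for the inner product of
  \<open>'e\<close>.\<close>

definition covector :: "'g \<Rightarrow> 'e" where
  "covector g = (\<Sum>i\<in>Basis. \<eta> (Ad \<kappa> g i) *\<^sub>R i)"

definition optimal_control :: "'g \<Rightarrow> 'e" where
  "optimal_control g = dual (covector g)"

definition energy_level :: "'g \<Rightarrow> real" where
  "energy_level g = hamiltonian V N (covector g)"

lemma covector_inner: "covector g \<bullet> X = \<eta> (Ad \<kappa> g X)"
proof -
  have "\<eta> (Ad \<kappa> g X) = (\<Sum>i\<in>Basis. (X \<bullet> i) *\<^sub>R \<eta> (Ad \<kappa> g i))"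
    using linear_sum_Basis[OF linear_compose[OF linear_Ad linear_\<eta>], of g X] by simp
  then show ?thesis unfolding covector_def inner_sum_left
    by (simp add: inner_commute[of X] mult.commute)
qed

lemma subdifferential_iff:
  assumes "u \<in> V"
  shows "(\<lambda>X. \<eta> (Ad \<kappa> g X)) \<in> subdifferential_on V (energy N) u \<longleftrightarrow> u = optimal_control g"
proof -
  have "linear_functional_on V (\<lambda>X. \<eta> (Ad \<kappa> g X))"
    unfolding covector_inner[symmetric] linear_functional_on_def by (simp add: inner_add_right)
  then have "(\<lambda>X. \<eta> (Ad \<kappa> g X)) \<in> subdifferential_on V (energy N) u \<longleftrightarrow>
      (\<forall>v\<in>V. covector g \<bullet> (v - u) \<le> energy N v - energy N u)"
    by (simp add: subdifferential_on_def covector_inner)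
  then show ?thesis
    using dual_unique[OF assms] dual_subgradient unfolding optimal_control_def by auto
qed

text \<open>The translate by g is there for the existence proof, which works with p + x for x near
  the identity. By \<open>Ad_add\<close> it contributes only a fixed linear factor.\<close>

lemma Ck_covector:
  assumes "c \<in> A" shows "Ck_on k (chart_img c) (\<lambda>x. covector (g + coord_inv c x))"
proof -
  have b: "bounded_linear (\<lambda>X. \<eta> (Ad \<kappa> g X))"
    using linear_compose[OF linear_Ad linear_\<eta>, of g] linear_conv_bounded_linear by (auto simp: o_def)
  show ?thesis unfolding covector_def Ad_add
    by (intro Ck_on_sum Ck_on_scaleR Ck_on_const chart_open(2)[OF assms]
        Ck_on_linear_compose[OF chart_open(2)[OF assms] b] Ck_Ad[OF assms])
qed

lemma loc_lip_optimal_control: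
  assumes "c \<in> A" shows "loc_lip (chart_img c) (\<lambda>x. optimal_control (g + coord_inv c x))"
proof -
  obtain L where "L-lipschitz_on UNIV dual" using dual_lipschitz .
  then show ?thesis unfolding optimal_control_def
    by (intro loc_lip_compose[OF C1_loc_lip[OF chart_open(2)[OF assms] Ck_covector[OF assms]], of UNIV dual]
        loc_lip_lipschitz[of L]) auto
qed

lemma loc_lip_dL:
  assumes c: "c \<in> A" and u: "loc_lip (chart_img c) u"
  shows "loc_lip (chart_img c) (\<lambda>x. dL \<kappa> c (coord_inv c x) (u x))"
proof (rule loc_lip_cong)
  have "loc_lip (chart_img c) (\<lambda>x. u x \<bullet> i)" if "i \<in> Basis" for i
    by (rule loc_lip_compose[OF u, of UNIV "\<lambda>y. y \<bullet> i"])
      (use that in \<open>auto intro!: loc_lip_lipschitz[of 1] lipschitz_onI simp: dist_norm dist_real_def Basis_le_norm simp flip: inner_diff_left\<close>)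
  then show "loc_lip (chart_img c) (\<lambda>x. \<Sum>i\<in>Basis. (u x \<bullet> i) *\<^sub>R dL \<kappa> c (coord_inv c x) i)"
    by (intro loc_lip_sum loc_lip_scaleR C1_loc_lip[OF chart_open(2)[OF c] Ck_dL[OF c]])
  show "(\<Sum>i\<in>Basis. (u x \<bullet> i) *\<^sub>R dL \<kappa> c (coord_inv c x) i) = dL \<kappa> c (coord_inv c x) (u x)"
    if "x \<in> chart_img c" for x
    using linear_sum_Basis[OF linear_dL[OF c coord_inv_in[OF c that]]] by metis
qed

definition chart_field :: "('g, 'e) chart \<Rightarrow> 'e \<Rightarrow> 'e" where
  "chart_field c x = dL \<kappa> c (coord_inv c x) (optimal_control (coord_inv c x))"

lemma loc_lip_chart_field:
  assumes "c \<in> A" shows "loc_lip (chart_img c) (chart_field c)"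
  using loc_lip_dL[OF assms loc_lip_optimal_control[OF assms, of 0]] by (simp add: chart_field_def[abs_def])

lemma chart_field_coord:
  "c \<in> A \<Longrightarrow> g \<in> chart_dom c \<Longrightarrow> chart_field c (coord c g) = dL \<kappa> c g (optimal_control g)"
  by (simp add: chart_field_def)

text \<open>Makes the control of an integral curve continuous, hence square integrable.\<close>

lemma continuous_on_optimal_control: "continuous_on UNIV optimal_control"
proof -
  have "continuous_on (chart_dom c) optimal_control" if c: "c \<in> A" for c
  proof -
    have "continuous_on (chart_dom c) (\<lambda>g. optimal_control (0 + coord_inv c (coord c g)))"
      by (rule continuous_on_compose2[OF loc_lip_imp_continuous_on[OF loc_lip_optimal_control[OF c]] continuous_on_coord[OF c]]) auto
    then show ?thesis using c by (subst continuous_on_cong[OF refl]) auto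
  qed
  then have "continuous_on (\<Union> (chart_dom ` A)) optimal_control"
    using chart_open(1) by (intro continuous_on_open_Union) auto
  then show ?thesis using atlas_covers by simp
qed

text \<open>
  Along a curve with control a multiple \<open>\<rho> w\<close> of the optimal one, the covector \<open>\<eta> \<circ> Ad (\<gamma> s)\<close> is
  stationary on \<open>w\<close>, because \<open>[w, w] = 0\<close>; and \<open>w\<close> is the differential of the Hamiltonian there.
\<close>
lemma energy_level_stationary:
  assumes cont: "continuous (at t within S) \<gamma>" and t: "t \<in> S" and c: "c \<in> A" "\<gamma> t \<in> chart_dom c"
    and der: "((\<lambda>s. coord c (\<gamma> s)) has_vector_derivative dL \<kappa> c (\<gamma> t) (\<rho> *\<^sub>R optimal_control (\<gamma> t))) (at t within S)"
  shows "((\<lambda>s. energy_level (\<gamma> s)) has_vector_derivative 0) (at t within S)"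
proof -
  define g w where "g = \<gamma> t" and "w = optimal_control g"
  have lim: "(\<gamma> \<longlongrightarrow> g) (at t within S)" using cont by (simp add: continuous_within g_def)
  have lim': "((\<lambda>s. - g + \<gamma> s) \<longlongrightarrow> - g + g) (at t within S)"
    by (intro tendsto_add tendsto_const lim)
  have ev: "\<forall>\<^sub>F s in at t within S. \<gamma> s \<in> chart_dom c \<and> - g + \<gamma> s \<in> chart_dom \<kappa>"
    using topological_tendstoD[OF lim chart_open(1)[OF c(1)]] topological_tendstoD[OF lim' chart_open(1)[OF kappa(1)]]
      c(2) kappa(2) by (intro eventually_conj) (auto simp: g_def)
  \<comment> \<open>Translating by - g puts the curve at the identity at time t, where by left
    invariance its velocity is \<rho> w.\<close>
  let ?T = "\<lambda>y. coord \<kappa> (- g + coord_inv c y)"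
  define z where "z = (\<lambda>s. coord \<kappa> (- g + \<gamma> s))"
  have z0: "z t = coord \<kappa> 0" by (simp add: z_def g_def)
  have gd: "g \<in> chart_dom c" "- g + g \<in> chart_dom \<kappa>" using c kappa by (auto simp: g_def)
  have "((\<lambda>s. ?T (coord c (\<gamma> s))) has_vector_derivative
      frechet_derivative ?T (at (coord c g)) (dL \<kappa> c g (\<rho> *\<^sub>R w))) (at t within S)"
    using vector_derivative_diff_chain_within[OF der, of ?T "frechet_derivative ?T (at (coord c g))"]
      has_derivative_at_withinI[OF translation_has_derivative[OF c(1) kappa(1) gd]]
    by (simp add: o_def g_def w_def)
  moreover have "frechet_derivative ?T (at (coord c g)) (dL \<kappa> c g (\<rho> *\<^sub>R w)) = \<rho> *\<^sub>R w"
    using dL_translation[OF c(1) kappa(1) gd, of "\<rho> *\<^sub>R w"] dL_0 by simp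
  ultimately have "((\<lambda>s. ?T (coord c (\<gamma> s))) has_vector_derivative \<rho> *\<^sub>R w) (at t within S)" by simp
  then have z': "(z has_vector_derivative \<rho> *\<^sub>R w) (at t within S)"
    unfolding has_vector_derivative_def
    by (rule has_derivative_transform_eventually[OF _ _ _ t])
      (use c ev in \<open>auto simp: z_def elim: eventually_mono\<close>)
  \<comment> \<open>All X are needed for the covector to be differentiable, on which the quadratic
    error rests. Only for X = w must the derivative vanish: there it is \<rho> times the derivative
    of \<open>Ad\<close> w in the direction w.\<close>
  have Ad': "\<exists>D. ((\<lambda>s. Ad \<kappa> (- g + \<gamma> s) X) has_vector_derivative D) (at t within S) \<and> (X = w \<longrightarrow> D = 0)" for X
  proof -
    let ?Y = "\<lambda>x. Ad \<kappa> (coord_inv \<kappa> x) X"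
    define B where "B = frechet_derivative ?Y (at (coord \<kappa> 0))"
    have B: "(?Y has_derivative B) (at (coord \<kappa> 0))"
      unfolding B_def using kappa
      by (intro frechet_derivative_has_derivative Ck_on_differentiable[OF Ck_Ad[OF kappa(1), of "Suc 0"] chart_open(2)[OF kappa(1)]]) simp
    have "((\<lambda>s. ?Y (z s)) has_vector_derivative B (\<rho> *\<^sub>R w)) (at t within S)"
      using vector_derivative_diff_chain_within[OF z', of ?Y B] has_derivative_at_withinI[OF B]
      by (simp add: o_def z0)
    then have "((\<lambda>s. Ad \<kappa> (- g + \<gamma> s) X) has_vector_derivative B (\<rho> *\<^sub>R w)) (at t within S)"
      unfolding has_vector_derivative_def
      by (rule has_derivative_transform_eventually[OF _ _ _ t])
        (use kappa ev in \<open>auto simp: z_def g_def elim: eventually_mono\<close>)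
    moreover have "B (\<rho> *\<^sub>R w) = 0" if "X = w"
      using Ad_derivative_self[of w B] B that linear_scale[OF has_derivative_linear[OF B]] by simp
    ultimately show ?thesis by blast
  qed
  then obtain D where D: "\<And>X. ((\<lambda>s. Ad \<kappa> (- g + \<gamma> s) X) has_vector_derivative D X) (at t within S)" "D w = 0"
    by metis
  define m where "m = (\<lambda>s. covector (\<gamma> s))"
  have b: "bounded_linear (\<lambda>X. \<eta> (Ad \<kappa> g X))"
    using linear_compose[OF linear_Ad linear_\<eta>, of g] linear_conv_bounded_linear by (auto simp: o_def)
  have mX: "((\<lambda>s. m s \<bullet> X) has_vector_derivative \<eta> (Ad \<kappa> g (D X))) (at t within S)" for X
  proof -
    have "m s \<bullet> X = \<eta> (Ad \<kappa> g (Ad \<kappa> (- g + \<gamma> s) X))" for s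
      unfolding m_def covector_inner Ad_add[symmetric] by (simp add: add.assoc[symmetric])
    then show ?thesis using bounded_linear.has_vector_derivative[OF b D(1)] by simp
  qed
  have mw: "((\<lambda>s. m s \<bullet> w) has_vector_derivative 0) (at t within S)"
    using mX[of w] D(2) linear_0[OF bounded_linear.linear[OF b]] by simp
  define m' where "m' = (\<Sum>i\<in>Basis. \<eta> (Ad \<kappa> g (D i)) *\<^sub>R (i::'e))"
  have "((\<lambda>s. \<Sum>i\<in>Basis. (m s \<bullet> i) *\<^sub>R i) has_vector_derivative m') (at t within S)"
    unfolding m'_def
    by (intro has_vector_derivative_sum bounded_linear.has_vector_derivative[OF bounded_linear_scaleR_left] mX)
  then have m': "(m has_vector_derivative m') (at t within S)" by (simp add: euclidean_representation)
  obtain L where L: "L-lipschitz_on UNIV dual" using dual_lipschitz .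
  have L0: "L \<ge> 0" using L lipschitz_on_nonneg by auto
  have md: "((\<lambda>s. m s - m t) has_derivative (\<lambda>h. h *\<^sub>R m')) (at t within S)"
    using has_derivative_diff[OF m'[unfolded has_vector_derivative_def] has_derivative_const] by simp
  have "((\<lambda>s. L * ((m s - m t) \<bullet> (m s - m t))) has_derivative (\<lambda>h. h *\<^sub>R 0)) (at t within S)"
    using has_derivative_mult_right[OF has_derivative_inner[OF md md], of L] by simp
  then have sq: "((\<lambda>s. L * ((m s - m t) \<bullet> (m s - m t))) has_vector_derivative 0) (at t within S)"
    by (simp add: has_vector_derivative_def)
  \<comment> \<open>By convexity the increment is at least (m s - m t) \<bullet> w and at most (m s
    - m t) \<bullet> dual (m s). Replacing dual (m s) by w costs at most L times the squared norm of
    m s - m t.\<close>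
  show ?thesis
  proof (rule has_vector_derivative_0_squeeze[OF mw sq])
    fix s assume "s \<in> S"
    have up: "energy_level (\<gamma> s) - energy_level (\<gamma> t) \<ge> (m s - m t) \<bullet> w"
      using hamiltonian_diff_ge[of "m s" "m t"] by (simp add: energy_level_def m_def w_def optimal_control_def g_def)
    have "energy_level (\<gamma> s) - energy_level (\<gamma> t) \<le> (m s - m t) \<bullet> dual (m s)"
      using hamiltonian_diff_ge[of "m t" "m s"] by (simp add: energy_level_def m_def inner_diff_left)
    also have "\<dots> = (m s - m t) \<bullet> w + (m s - m t) \<bullet> (dual (m s) - w)"
      by (simp add: inner_diff_right)
    also have "(m s - m t) \<bullet> (dual (m s) - w) \<le> norm (m s - m t) * norm (dual (m s) - w)"
      by (rule norm_cauchy_schwarz)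
    also have "norm (dual (m s) - w) \<le> L * norm (m s - m t)"
      using lipschitz_onD[OF L, of "m s" "m t"] by (simp add: dist_norm w_def optimal_control_def m_def g_def)
    finally have dn: "energy_level (\<gamma> s) - energy_level (\<gamma> t) \<le> (m s - m t) \<bullet> w + norm (m s - m t) * (L * norm (m s - m t))"
      by (simp add: mult_left_mono)
    have "norm (m s - m t) * (L * norm (m s - m t)) = L * ((m s - m t) \<bullet> (m s - m t))"
      by (simp only: dot_square_norm power2_eq_square mult_ac)
    moreover have "0 \<le> L * ((m s - m t) \<bullet> (m s - m t))" using L0 by (intro mult_nonneg_nonneg inner_ge_zero)
    moreover have "L * ((m t - m t) \<bullet> (m t - m t)) = 0" by simp
    moreover have "m s \<bullet> w - m t \<bullet> w = (m s - m t) \<bullet> w" by (rule inner_diff_left[symmetric])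
    ultimately show "\<bar>energy_level (\<gamma> s) - energy_level (\<gamma> t)\<bar> \<le>
        \<bar>m s \<bullet> w - m t \<bullet> w\<bar> + \<bar>L * ((m s - m t) \<bullet> (m s - m t)) - L * ((m t - m t) \<bullet> (m t - m t))\<bar>"
      using up dn by linarith
  qed
qed

subsection \<open>Integral curves of the normal equation\<close>

definition integral_curve :: "real \<Rightarrow> real \<Rightarrow> (real \<Rightarrow> 'g) \<Rightarrow> bool" where
  "integral_curve a b \<gamma> \<longleftrightarrow> continuous_on {a..b} \<gamma> \<and>
     (\<forall>t\<in>{a..b}. \<forall>c\<in>A. \<gamma> t \<in> chart_dom c \<longrightarrow>
        ((\<lambda>s. coord c (\<gamma> s)) has_vector_derivative dL \<kappa> c (\<gamma> t) (optimal_control (\<gamma> t))) (at t within {a..b}))"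

lemma integral_curve_continuous: "integral_curve a b \<gamma> \<Longrightarrow> continuous_on {a..b} \<gamma>"
  by (simp add: integral_curve_def)

lemma integral_curve_derivative:
  assumes "integral_curve a b \<gamma>" "c \<in> A" "t \<in> {a..b}" "\<gamma> t \<in> chart_dom c"
  shows "((\<lambda>s. coord c (\<gamma> s)) has_vector_derivative chart_field c (coord c (\<gamma> t))) (at t within {a..b})"
  using assms by (simp add: integral_curve_def chart_field_coord)

lemma integral_curve_subset:
  assumes "integral_curve a b \<gamma>" "a \<le> a'" "b' \<le> b"
  shows "integral_curve a' b' \<gamma>"
proof -
  have sub: "{a'..b'} \<subseteq> {a..b}" using assms by auto
  show ?thesis unfolding integral_curve_def
  proof (intro conjI ballI impI)
    show "continuous_on {a'..b'} \<gamma>"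
      using integral_curve_continuous[OF assms(1)] sub by (rule continuous_on_subset)
    fix t c assume "t \<in> {a'..b'}" "c \<in> A" "\<gamma> t \<in> chart_dom c"
    then have "((\<lambda>s. coord c (\<gamma> s)) has_vector_derivative dL \<kappa> c (\<gamma> t) (optimal_control (\<gamma> t))) (at t within {a..b})"
      using assms(1) sub unfolding integral_curve_def by blast
    then show "((\<lambda>s. coord c (\<gamma> s)) has_vector_derivative dL \<kappa> c (\<gamma> t) (optimal_control (\<gamma> t))) (at t within {a'..b'})"
      using sub by (rule has_vector_derivative_within_subset)
  qed
qed

text \<open>Regularity of curves is defined on compact intervals inside one chart. The equality of
  the two filters transfers derivatives at t between such an interval and the whole one.\<close>

lemma chart_subinterval:
  fixes \<gamma> :: "real \<Rightarrow> 'g"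
  assumes "continuous_on {a..b} \<gamma>" "a < b" "t \<in> {a..b}" "c \<in> A" "\<gamma> t \<in> chart_dom c" "e > 0"
  obtains a' b' where "a \<le> a'" "a' < b'" "b' \<le> b" "t \<in> {a'..b'}" "b' - a' \<le> e" "\<gamma> ` {a'..b'} \<subseteq> chart_dom c"
    "at t within {a'..b'} = at t within {a..b}"
proof -
  have "(\<gamma> \<longlongrightarrow> \<gamma> t) (at t within {a..b})"
    using assms(1,3) by (simp add: continuous_on_def)
  from topological_tendstoD[OF this chart_open(1)[OF assms(4)] assms(5)]
  obtain d where d: "d > 0" "\<forall>s\<in>{a..b}. s \<noteq> t \<and> dist s t < d \<longrightarrow> \<gamma> s \<in> chart_dom c"
    unfolding eventually_at by blast
  define q where "q = min (d / 2) (e / 2)"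
  have q: "q > 0" "q < d" "q \<le> e / 2" using d assms(6) by (auto simp: q_def)
  define a' b' where "a' = max a (t - q)" and "b' = min b (t + q)"
  have ab: "a \<le> a'" "a' < b'" "b' \<le> b" "t \<in> {a'..b'}" "b' - a' \<le> e"
    using q assms(2,3) by (auto simp: a'_def b'_def)
  moreover have "\<gamma> ` {a'..b'} \<subseteq> chart_dom c"
  proof clarify
    fix s assume s: "s \<in> {a'..b'}"
    then have "s \<in> {a..b}" "dist s t < d" using q ab by (auto simp: a'_def b'_def dist_real_def)
    then show "\<gamma> s \<in> chart_dom c" using d(2) assms(5) by (cases "s = t") auto
  qed
  moreover have "at t within {a'..b'} = at t within {a..b}"
    by (rule at_within_nhd[of _ "ball t q"])
      (use q ab in \<open>auto simp: a'_def b'_def dist_real_def\<close>)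
  ultimately show thesis by (rule that)
qed

lemma continuous_on_chart_curve:
  assumes "integral_curve a b \<gamma>" "c \<in> A" "\<gamma> ` {a..b} \<subseteq> chart_dom c"
  shows "continuous_on {a..b} (\<lambda>s. coord c (\<gamma> s))" "continuous_on {a..b} (\<lambda>s. chart_field c (coord c (\<gamma> s)))"
proof -
  show 1: "continuous_on {a..b} (\<lambda>s. coord c (\<gamma> s))"
    by (rule continuous_on_compose2[OF continuous_on_coord[OF assms(2)] integral_curve_continuous[OF assms(1)] assms(3)])
  show "continuous_on {a..b} (\<lambda>s. chart_field c (coord c (\<gamma> s)))"
    by (rule continuous_on_compose2[OF loc_lip_imp_continuous_on[OF loc_lip_chart_field[OF assms(2)]] 1])
      (use assms(3) in auto)
qed

text \<open>A bootstrap: the velocity is continuous, so the coordinates are Lipschitz; their image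
  is compact, so \<open>chart_field c\<close> is Lipschitz on it, and so is the velocity, the
  composition of the two.\<close>

lemma integral_curve_C11:
  assumes "integral_curve 0 1 \<gamma>" shows "C11_curve A {0..1} \<gamma>"
  unfolding C11_curve_def
proof (intro conjI ballI allI impI)
  show "continuous_on {0..1} \<gamma>" using integral_curve_continuous[OF assms] .
  fix c a b assume c: "c \<in> A" and ab: "a < b \<and> {a..b} \<subseteq> {0..1::real} \<and> \<gamma> ` {a..b} \<subseteq> chart_dom c"
  then have int: "integral_curve a b \<gamma>" by (intro integral_curve_subset[OF assms]) auto
  have im: "\<gamma> ` {a..b} \<subseteq> chart_dom c" using ab by blast
  let ?x = "\<lambda>t. coord c (\<gamma> t)"
  have der: "(?x has_vector_derivative chart_field c (?x t)) (at t within {a..b})" if "t \<in> {a..b}" for t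
    using im that by (intro integral_curve_derivative[OF int c]) auto
  note cont = continuous_on_chart_curve[OF int c im]
  obtain M where M: "M-lipschitz_on {a..b} ?x"
    using continuous_vector_derivative_imp_lipschitz[OF der cont(2)] by blast
  have "compact (?x ` {a..b})" using cont(1) by (intro compact_continuous_image) auto
  moreover have "?x ` {a..b} \<subseteq> chart_img c" using im by auto
  ultimately obtain L where L: "L-lipschitz_on (?x ` {a..b}) (chart_field c)"
    using loc_lip_compact[OF loc_lip_chart_field[OF c]] by blast
  have "(L * M)-lipschitz_on {a..b} (\<lambda>t. chart_field c (?x t))"
    by (rule lipschitz_on_compose2[OF M L])
  then show "\<exists>d L. (\<forall>t\<in>{a..b}. (?x has_vector_derivative d t) (at t within {a..b})) \<and> L-lipschitz_on {a..b} d"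
    by (intro exI[of _ "\<lambda>t. chart_field c (?x t)"] exI[of _ "L * M"] conjI ballI der)
qed

section \<open>Normal curves as integral curves\<close>

lemma integral_curve_imp_normal:
  assumes "integral_curve 0 1 \<gamma>" shows "normal_curve A \<kappa> V N \<eta> {0..1} \<gamma>"
proof -
  have cont: "continuous_on {0..1} \<gamma>" using integral_curve_continuous[OF assms] .
  have ac: "abs_continuous_curve A {0..1} \<gamma>"
    unfolding abs_continuous_curve_def
  proof (intro conjI ballI allI impI cont)
    fix c a b assume c: "c \<in> A" and ab: "a < b \<and> {a..b} \<subseteq> {0..1::real} \<and> \<gamma> ` {a..b} \<subseteq> chart_dom c"
    then have int: "integral_curve a b \<gamma>" by (intro integral_curve_subset[OF assms]) auto
    have im: "\<gamma> ` {a..b} \<subseteq> chart_dom c" using ab by blast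
    have der: "((\<lambda>t. coord c (\<gamma> t)) has_vector_derivative chart_field c (coord c (\<gamma> t))) (at t within {a..b})"
      if "t \<in> {a..b}" for t
      using im that by (intro integral_curve_derivative[OF int c]) auto
    show "abs_continuous_on a b (\<lambda>t. coord c (\<gamma> t))"
      using continuous_vector_derivative_imp_lipschitz[OF der continuous_on_chart_curve(2)[OF int c im]]
        lipschitz_imp_abs_continuous_on by blast
  qed
  define u where "u = (\<lambda>t. optimal_control (\<gamma> t))"
  have uc: "continuous_on {0..1} u"
    unfolding u_def by (rule continuous_on_compose2[OF continuous_on_optimal_control cont]) auto
  have V: "u t \<in> V" for t by (simp add: u_def optimal_control_def dual_in)
  have "has_control A \<kappa> V {0..1} \<gamma> u"
    unfolding has_control_def
    using assms V by (intro AE_I2) (auto simp: integral_curve_def u_def)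
  moreover have "square_integrable_on {0..1} u"
    unfolding square_integrable_on_def
    using uc by (intro conjI continuous_imp_measurable_on_sets_lebesgue continuous_imp_integrable_real continuous_intros) auto
  moreover have "AE t in lebesgue_on {0..1}. (\<lambda>X. \<eta> (Ad \<kappa> (\<gamma> t) X)) \<in> subdifferential_on V (energy N) (u t)"
    using subdifferential_iff[OF V] by (intro AE_I2) (simp add: u_def)
  ultimately show ?thesis using ac unfolding normal_curve_def by blast
qed

lemma normal_imp_integral_curve:
  assumes "normal_curve A \<kappa> V N \<eta> {0..1} \<gamma>" shows "integral_curve 0 1 \<gamma>"
proof -
  obtain u where ac: "abs_continuous_curve A {0..1} \<gamma>" and u: "has_control A \<kappa> V {0..1} \<gamma> u"
    "AE t in lebesgue_on {0..1}. (\<lambda>X. \<eta> (Ad \<kappa> (\<gamma> t) X)) \<in> subdifferential_on V (energy N) (u t)"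
    using assms unfolding normal_curve_def by blast
  have cont: "continuous_on {0..1} \<gamma>" using ac by (simp add: abs_continuous_curve_def)
  \<comment> \<open>The charts are quantified inside \<open>AE\<close>: one null set serves the
    whole atlas, which may be infinite.\<close>
  have "AE t in lebesgue_on {0..1}. \<forall>c\<in>A. \<gamma> t \<in> chart_dom c \<longrightarrow>
      ((\<lambda>s. coord c (\<gamma> s)) has_vector_derivative dL \<kappa> c (\<gamma> t) (optimal_control (\<gamma> t))) (at t within {0..1})"
    using u(1)[unfolded has_control_def] u(2)
  proof eventually_elim
    case (elim t)
    then have "u t = optimal_control (\<gamma> t)" using subdifferential_iff by blast
    then show ?case using elim(1) by auto
  qed
  then obtain E where E: "negligible E" "\<And>t. t \<in> {0..1} \<Longrightarrow> t \<notin> E \<Longrightarrow> \<forall>c\<in>A. \<gamma> t \<in> chart_dom c \<longrightarrow>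
      ((\<lambda>s. coord c (\<gamma> s)) has_vector_derivative dL \<kappa> c (\<gamma> t) (optimal_control (\<gamma> t))) (at t within {0..1})"
    by (rule AE_lebesgue_on_negligible) auto
  show ?thesis unfolding integral_curve_def
  proof (intro conjI ballI impI cont)
    fix t c assume t: "t \<in> {0..1::real}" and c: "c \<in> A" "\<gamma> t \<in> chart_dom c"
    obtain a b where ab: "0 \<le> a" "a < b" "b \<le> 1" "t \<in> {a..b}" "\<gamma> ` {a..b} \<subseteq> chart_dom c"
      "at t within {a..b} = at t within {0..1}"
      using chart_subinterval[OF cont zero_less_one t c zero_less_one] by metis
    have sub: "{a..b} \<subseteq> {0..1}" using ab by auto
    have xc: "continuous_on {a..b} (\<lambda>s. coord c (\<gamma> s))"
      by (rule continuous_on_compose2[OF continuous_on_coord[OF c(1)] continuous_on_subset[OF cont sub] ab(5)])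
    have gc: "continuous_on {a..b} (\<lambda>s. chart_field c (coord c (\<gamma> s)))"
      by (rule continuous_on_compose2[OF loc_lip_imp_continuous_on[OF loc_lip_chart_field[OF c(1)]] xc])
        (use ab(5) in auto)
    have "abs_continuous_on a b (\<lambda>s. coord c (\<gamma> s))"
      using ac c(1) ab(2,5) sub unfolding abs_continuous_curve_def by blast
    then have "((\<lambda>s. coord c (\<gamma> s)) has_vector_derivative chart_field c (coord c (\<gamma> t))) (at t within {a..b})"
    proof (rule abs_continuous_AE_derivative[OF _ gc E(1) _ ab(4)])
      fix s assume s: "s \<in> {a..b}" "s \<notin> E"
      then have "\<gamma> s \<in> chart_dom c" using ab(5) by blast
      then have "((\<lambda>s. coord c (\<gamma> s)) has_vector_derivative chart_field c (coord c (\<gamma> s))) (at s within {0..1})"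
        using E(2)[of s] s sub c(1) by (auto simp: chart_field_coord)
      then show "((\<lambda>s. coord c (\<gamma> s)) has_vector_derivative chart_field c (coord c (\<gamma> s))) (at s within {a..b})"
        using sub by (rule has_vector_derivative_within_subset)
    qed
    then show "((\<lambda>s. coord c (\<gamma> s)) has_vector_derivative dL \<kappa> c (\<gamma> t) (optimal_control (\<gamma> t))) (at t within {0..1})"
      using ab(6) c by (simp add: chart_field_coord)
  qed
qed

text \<open>A connectedness argument, as no single chart need contain the curves. The set of
  agreement contains a, is closed as a zero set of the continuous difference in the group, and is
  open by the Lipschitz estimate in a chart.\<close>

lemma integral_curve_unique:
  assumes 1: "integral_curve a b \<gamma>\<^sub>1" and 2: "integral_curve a b \<gamma>\<^sub>2" and ab: "a < b"
    and eq: "\<gamma>\<^sub>1 a = \<gamma>\<^sub>2 a" and t: "t \<in> {a..b}"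
  shows "\<gamma>\<^sub>1 t = \<gamma>\<^sub>2 t"
proof -
  define T where "T = {t \<in> {a..b}. \<gamma>\<^sub>1 t = \<gamma>\<^sub>2 t}"
  have "continuous_on {a..b} (\<lambda>t. \<gamma>\<^sub>1 t - \<gamma>\<^sub>2 t)"
    using integral_curve_continuous[OF 1] integral_curve_continuous[OF 2] by (rule continuous_on_diff)
  from continuous_closedin_preimage[OF this closed_singleton[of 0]]
  have "closedin (top_of_set {a..b}) T" by (simp add: T_def vimage_def Int_def)
  moreover have "openin (top_of_set {a..b}) T"
    unfolding openin_contains_ball
  proof (intro conjI ballI)
    show "T \<subseteq> {a..b}" by (auto simp: T_def)
    fix t0 assume "t0 \<in> T"
    then have t0: "t0 \<in> {a..b}" "\<gamma>\<^sub>1 t0 = \<gamma>\<^sub>2 t0" by (auto simp: T_def)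
    obtain c where c: "c \<in> A" "\<gamma>\<^sub>1 t0 \<in> chart_dom c" using chart_at .
    let ?x0 = "coord c (\<gamma>\<^sub>1 t0)"
    have "?x0 \<in> chart_img c" using c by simp
    then obtain r L where r: "r > 0" "L-lipschitz_on (chart_img c \<inter> ball ?x0 r) (chart_field c)"
      using loc_lip_chart_field[OF c(1)] unfolding loc_lip_def by blast
    have L: "L \<ge> 0" using r lipschitz_on_nonneg by blast
    define U where "U = {g \<in> chart_dom c. coord c g \<in> ball ?x0 r}"
    have U: "open U"
    proof -
      have "U = chart_dom c \<inter> coord c -` ball ?x0 r" by (auto simp: U_def)
      then show ?thesis
        using continuous_open_preimage[OF continuous_on_coord[OF c(1)] chart_open(1)[OF c(1)] open_ball] by simp
    qed
    have ev: "\<exists>d>0. \<forall>s\<in>{a..b}. dist s t0 < d \<longrightarrow> \<gamma> s \<in> U" if "integral_curve a b \<gamma>" "\<gamma> t0 = \<gamma>\<^sub>1 t0" for \<gamma>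
    proof -
      have "(\<gamma> \<longlongrightarrow> \<gamma> t0) (at t0 within {a..b})"
        using integral_curve_continuous[OF that(1)] t0 by (simp add: continuous_on_def)
      moreover have "\<gamma> t0 \<in> U" using that(2) c r by (simp add: U_def)
      ultimately have "\<forall>\<^sub>F s in at t0 within {a..b}. \<gamma> s \<in> U" using topological_tendstoD[OF _ U] by blast
      then show ?thesis unfolding eventually_at using \<open>\<gamma> t0 \<in> U\<close> by metis
    qed
    obtain d1 where d1: "d1 > 0" "\<forall>s\<in>{a..b}. dist s t0 < d1 \<longrightarrow> \<gamma>\<^sub>1 s \<in> U" using ev[OF 1] by blast
    obtain d2 where d2: "d2 > 0" "\<forall>s\<in>{a..b}. dist s t0 < d2 \<longrightarrow> \<gamma>\<^sub>2 s \<in> U" using ev[OF 2] t0 by metis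
    \<comment> \<open>Half the minimum keeps both curves in U; the second bound makes L times the
      interval length at most 1 / 2, as \<open>vector_derivative_le_imp_zero\<close>
      requires.\<close>
    define d where "d = min (min d1 d2 / 2) (1 / (4 * (L + 1)))"
    have d: "d > 0" "d < d1" "d < d2" "L * (2 * d) \<le> 1 / 2"
    proof -
      show "d > 0" "d < d1" "d < d2" using d1 d2 L by (auto simp: d_def)
      have "L * (2 * d) \<le> L * (2 * (1 / (4 * (L + 1))))" using L by (intro mult_left_mono) (auto simp: d_def)
      also have "\<dots> \<le> 1 / 2" using L by (simp add: field_simps)
      finally show "L * (2 * d) \<le> 1 / 2" .
    qed
    define a' b' where "a' = max a (t0 - d)" and "b' = min b (t0 + d)"
    have ab': "a \<le> a'" "b' \<le> b" "t0 \<in> {a'..b'}" "b' - a' \<le> 2 * d"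
      using t0 d by (auto simp: a'_def b'_def)
    have in_U: "\<gamma>\<^sub>1 s \<in> U" "\<gamma>\<^sub>2 s \<in> U" if "s \<in> {a'..b'}" for s
    proof -
      have "s \<in> {a..b}" "dist s t0 \<le> d" using that ab' by (auto simp: a'_def b'_def dist_real_def)
      then show "\<gamma>\<^sub>1 s \<in> U" "\<gamma>\<^sub>2 s \<in> U" using d1 d2 d by auto
    qed
    let ?z = "\<lambda>s. coord c (\<gamma>\<^sub>1 s) - coord c (\<gamma>\<^sub>2 s)"
    let ?z' = "\<lambda>s. chart_field c (coord c (\<gamma>\<^sub>1 s)) - chart_field c (coord c (\<gamma>\<^sub>2 s))"
    have agree: "\<gamma>\<^sub>1 s = \<gamma>\<^sub>2 s" if s: "s \<in> {a'..b'}" for s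
    proof -
      have "?z s = 0"
      proof (rule vector_derivative_le_imp_zero[where z = ?z and z' = ?z' and L = L, OF _ _ L _ ab'(3) _ s])
        fix s assume s: "s \<in> {a'..b'}"
        show "(?z has_vector_derivative ?z' s) (at s within {a'..b'})"
          using s in_U[OF s]
          by (intro has_vector_derivative_diff integral_curve_derivative[OF integral_curve_subset[OF 1 ab'(1,2)] c(1)]
              integral_curve_derivative[OF integral_curve_subset[OF 2 ab'(1,2)] c(1)]) (auto simp: U_def)
        show "norm (?z' s) \<le> L * norm (?z s)"
          using lipschitz_onD[OF r(2), of "coord c (\<gamma>\<^sub>1 s)" "coord c (\<gamma>\<^sub>2 s)"] in_U[OF s]
          by (auto simp: U_def dist_norm)
      next
        show "L * (b' - a') \<le> 1 / 2" using mult_left_mono[OF ab'(4) L] d(4) by linarith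
        show "?z t0 = 0" using t0 by simp
      qed
      then have "coord c (\<gamma>\<^sub>1 s) = coord c (\<gamma>\<^sub>2 s)" by simp
      then show ?thesis using in_U[OF s] coord_inv_coord[OF c(1)] unfolding U_def by (metis (mono_tags, lifting) mem_Collect_eq)
    qed
    have "ball t0 d \<inter> {a..b} \<subseteq> T"
    proof
      fix s assume s: "s \<in> ball t0 d \<inter> {a..b}"
      then have "s \<in> {a'..b'}" by (auto simp: a'_def b'_def dist_real_def)
      then show "s \<in> T" using agree s by (simp add: T_def)
    qed
    then show "\<exists>e>0. ball t0 e \<inter> {a..b} \<subseteq> T" using d(1) by blast
  qed
  ultimately have "T = {} \<or> T = {a..b}" using connected_Icc[of a b] unfolding connected_clopen by blast
  moreover have "a \<in> T" using eq ab by (simp add: T_def)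
  ultimately have "t \<in> T" using t by blast
  then show ?thesis by (simp add: T_def)
qed

subsection \<open>Existence\<close>

text \<open>
  Truncating the control makes the field bounded near the identity, uniformly in \<open>p\<close>, and still leaves
  the energy level constant; hence the truncation is never active.
\<close>
lemma integral_curve_local:
  obtains \<tau> where "\<tau> > 0" "\<And>p. energy_level p = h \<Longrightarrow>
    \<exists>\<gamma>. integral_curve 0 \<tau> \<gamma> \<and> \<gamma> 0 = p \<and> energy_level (\<gamma> \<tau>) = h"
proof -
  let ?e = "coord \<kappa> 0"
  have "?e \<in> chart_img \<kappa>" using kappa by simp
  then obtain r where r: "r > 0" "cball ?e r \<subseteq> chart_img \<kappa>"
    using chart_open(2)[OF kappa(1)] open_contains_cball by blast
  have "continuous_on (cball ?e r) (\<lambda>x. \<Sum>i\<in>Basis. norm (dL \<kappa> \<kappa> (coord_inv \<kappa> x) i))"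
    using Ck_dL[OF kappa(1), of 0] by (intro continuous_intros continuous_on_subset[OF _ r(2)]) simp
  then have "bounded ((\<lambda>x. \<Sum>i\<in>Basis. norm (dL \<kappa> \<kappa> (coord_inv \<kappa> x) i)) ` cball ?e r)"
    by (intro compact_imp_bounded compact_continuous_image) auto
  then obtain K where K: "\<forall>x\<in>cball ?e r. norm (\<Sum>i\<in>Basis. norm (dL \<kappa> \<kappa> (coord_inv \<kappa> x) i)) \<le> K"
    unfolding bounded_iff by blast
  have K0: "K \<ge> 0" using K r by (meson centre_in_cball less_imp_le norm_ge_zero order_trans)
  have Kb: "norm (dL \<kappa> \<kappa> (coord_inv \<kappa> x) X) \<le> K * norm X" if x: "x \<in> cball ?e r" for x X
  proof -
    have "x \<in> chart_img \<kappa>" using x r by blast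
    then have "dL \<kappa> \<kappa> (coord_inv \<kappa> x) X = (\<Sum>i\<in>Basis. (X \<bullet> i) *\<^sub>R dL \<kappa> \<kappa> (coord_inv \<kappa> x) i)"
      by (intro linear_sum_Basis linear_dL kappa coord_inv_in)
    also have "norm \<dots> \<le> (\<Sum>i\<in>Basis. norm X * norm (dL \<kappa> \<kappa> (coord_inv \<kappa> x) i))"
      by (rule sum_norm_le) (auto intro!: mult_right_mono simp: Basis_le_norm)
    also have "\<dots> = norm X * (\<Sum>i\<in>Basis. norm (dL \<kappa> \<kappa> (coord_inv \<kappa> x) i))" by (simp add: sum_distrib_left)
    also have "\<dots> \<le> norm X * K" using K x by (intro mult_left_mono) force+
    finally show ?thesis by (simp add: mult.commute)
  qed
  obtain C where C: "C > 0" "\<And>m. (norm (dual m))\<^sup>2 \<le> C * hamiltonian V N m"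
    using norm_dual_le_hamiltonian by blast
  \<comment> \<open>At level h the squared control is at most C h. The absolute value spares a
    discussion of the sign of h, and the \<open>+ 1\<close> makes R positive.\<close>
  define R where "R = sqrt \<bar>C * h\<bar> + 1"
  have R: "R > 0" unfolding R_def by (intro add_nonneg_pos) auto
  have bound: "norm (optimal_control g) \<le> R" if "energy_level g = h" for g
  proof -
    have "(norm (optimal_control g))\<^sup>2 \<le> \<bar>C * h\<bar>"
      using C(2)[of "covector g"] that by (simp add: optimal_control_def energy_level_def)
    then show ?thesis unfolding R_def using real_le_rsqrt by force
  qed
  \<comment> \<open>For this long a curve of speed at most K R stays within r of its start; the
    \<open>+ 1\<close> avoids division by 0. Only r, K and R enter, so p does not.\<close>
  define \<tau> where "\<tau> = r / (K * R + 1)"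
  have KR: "K * R \<ge> 0" using K0 R by simp
  have \<tau>: "\<tau> > 0" "K * R * \<tau> \<le> r" using r(1) KR by (auto simp: \<tau>_def field_simps)
  show thesis
  proof (rule that[OF \<tau>(1)])
    fix p assume p: "energy_level p = h"
    \<comment> \<open>Here x stands for the coordinates of - p + \<gamma>. The point p enters only
      through the control, whose truncation is bounded by R.\<close>
    define u where "u = (\<lambda>x. truncate_norm R (optimal_control (p + coord_inv \<kappa> x)))"
    define F where "F = (\<lambda>x. dL \<kappa> \<kappa> (coord_inv \<kappa> x) (u x))"
    have "loc_lip (chart_img \<kappa>) u" unfolding u_def
      by (rule loc_lip_compose[OF loc_lip_optimal_control[OF kappa(1)] loc_lip_lipschitz[OF truncate_norm_lipschitz[OF R]]]) auto
    then have "loc_lip (chart_img \<kappa>) F" unfolding F_def by (rule loc_lip_dL[OF kappa(1)])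
    then obtain L where L: "L-lipschitz_on (cball ?e r) F"
      using loc_lip_compact[OF _ compact_cball r(2)] by blast
    have Fb: "norm (F x) \<le> K * R" if "x \<in> cball ?e r" for x
    proof -
      have "norm (F x) \<le> K * norm (u x)" unfolding F_def by (rule Kb[OF that])
      also have "\<dots> \<le> K * R" unfolding u_def using K0 norm_truncate_norm_le[OF R] by (intro mult_left_mono)
      finally show ?thesis .
    qed
    obtain x where x: "x 0 = ?e" "\<And>t. t \<in> {0..\<tau>} \<Longrightarrow> x t \<in> cball ?e r"
      "\<And>t. t \<in> {0..\<tau>} \<Longrightarrow> (x has_vector_derivative F (x t)) (at t within {0..\<tau>})"
      using picard_ball[OF L Fb less_imp_le[OF r(1)] KR less_imp_le[OF \<tau>(1)] \<tau>(2)] by metis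
    have xi: "x t \<in> chart_img \<kappa>" if "t \<in> {0..\<tau>}" for t using x(2)[OF that] r(2) by blast
    have xc: "continuous_on {0..\<tau>} x"
      using x(3) has_vector_derivative_continuous continuous_on_eq_continuous_within by blast
    define \<gamma> where "\<gamma> = (\<lambda>t. p + coord_inv \<kappa> (x t))"
    have \<gamma>c: "continuous_on {0..\<tau>} \<gamma>" unfolding \<gamma>_def
      by (intro continuous_on_add continuous_on_const continuous_on_compose2[OF continuous_on_coord_inv[OF kappa(1)] xc])
        (use xi in auto)
    have der: "((\<lambda>s. coord c (\<gamma> s)) has_vector_derivative
        dL \<kappa> c (\<gamma> t) (truncate_norm R (optimal_control (\<gamma> t)))) (at t within {0..\<tau>})"
      if t: "t \<in> {0..\<tau>}" and c: "c \<in> A" "\<gamma> t \<in> chart_dom c" for t c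
    proof -
      have h: "coord_inv \<kappa> (x t) \<in> chart_dom \<kappa>" "p + coord_inv \<kappa> (x t) \<in> chart_dom c"
        using xi[OF t] c kappa by (auto simp: \<gamma>_def)
      let ?T = "\<lambda>y. coord c (p + coord_inv \<kappa> y)"
      have T: "(?T has_derivative frechet_derivative ?T (at (x t))) (at (x t))"
        using translation_has_derivative[OF kappa(1) c(1) h] xi[OF t] kappa by simp
      have "((\<lambda>s. ?T (x s)) has_vector_derivative frechet_derivative ?T (at (x t)) (F (x t))) (at t within {0..\<tau>})"
        using vector_derivative_diff_chain_within[OF x(3)[OF t] has_derivative_at_withinI[OF T]] by (simp add: o_def)
      moreover have "frechet_derivative ?T (at (x t)) (F (x t)) = dL \<kappa> c (\<gamma> t) (u (x t))"
        using dL_translation[OF kappa(1) c(1) h, of "u (x t)"] xi[OF t] kappa by (simp add: F_def \<gamma>_def)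
      ultimately show ?thesis by (simp add: \<gamma>_def u_def)
    qed
    have stat: "((\<lambda>s. energy_level (\<gamma> s)) has_vector_derivative 0) (at t within {0..\<tau>})" if t: "t \<in> {0..\<tau>}" for t
    proof -
      obtain c where c: "c \<in> A" "\<gamma> t \<in> chart_dom c" using chart_at .
      have "continuous (at t within {0..\<tau>}) \<gamma>"
        using \<gamma>c t by (simp add: continuous_on_eq_continuous_within)
      \<comment> \<open>Unfolded, the truncated control is a multiple of the optimal one; its factor
        is the \<rho> of that lemma.\<close>
      from energy_level_stationary[OF this t c der[OF t c, unfolded truncate_norm_def]]
      show ?thesis .
    qed
    have "convex {0..\<tau>}" by simp
    from has_vector_derivative_zero_constant[OF this stat]
    obtain k where k: "\<And>t. t \<in> {0..\<tau>} \<Longrightarrow> energy_level (\<gamma> t) = k" by blast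
    have \<gamma>0: "\<gamma> 0 = p" using x(1) by (simp add: \<gamma>_def)
    have lev: "energy_level (\<gamma> t) = h" if "t \<in> {0..\<tau>}" for t
      using k that \<gamma>0 p \<tau>(1) by (metis atLeastAtMost_iff less_imp_le order_refl)
    have "integral_curve 0 \<tau> \<gamma>"
      unfolding integral_curve_def using \<gamma>c der bound[OF lev] truncate_norm_id[OF R] by force
    then show "\<exists>\<gamma>. integral_curve 0 \<tau> \<gamma> \<and> \<gamma> 0 = p \<and> energy_level (\<gamma> \<tau>) = h"
      using \<gamma>0 lev[of \<tau>] \<tau>(1) by auto
  qed
qed

section \<open>Shifting and joining integral curves\<close>

lemma integral_curve_shift:
  assumes "integral_curve 0 \<tau> \<gamma>"
  shows "integral_curve a (a + \<tau>) (\<lambda>s. \<gamma> (s - a))"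
  unfolding integral_curve_def
proof (intro conjI ballI impI)
  show "continuous_on {a..a + \<tau>} (\<lambda>s. \<gamma> (s - a))"
    by (rule continuous_on_compose2[OF integral_curve_continuous[OF assms]]) (auto intro!: continuous_intros)
  fix t c assume t: "t \<in> {a..a + \<tau>}" and c: "c \<in> A" "\<gamma> (t - a) \<in> chart_dom c"
  have im: "(\<lambda>s. s - a) ` {a..a + \<tau>} = {0..\<tau>}"
    using image_add_atLeastAtMost'[of "-a" a "a + \<tau>"] by simp
  have "((\<lambda>s. coord c (\<gamma> s)) has_vector_derivative dL \<kappa> c (\<gamma> (t - a)) (optimal_control (\<gamma> (t - a)))) (at (t - a) within {0..\<tau>})"
    using assms c t unfolding integral_curve_def by auto
  moreover have "((\<lambda>s. s - a) has_vector_derivative 1) (at t within {a..a + \<tau>})"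
    by (auto intro!: derivative_eq_intros)
  ultimately show "((\<lambda>s. coord c (\<gamma> (s - a))) has_vector_derivative
      dL \<kappa> c (\<gamma> (t - a)) (optimal_control (\<gamma> (t - a)))) (at t within {a..a + \<tau>})"
    using vector_diff_chain_within[of "\<lambda>s. s - a" 1 t "{a..a + \<tau>}" "\<lambda>s. coord c (\<gamma> s)"]
    by (simp add: im o_def)
qed

lemma integral_curve_join:
  assumes 1: "integral_curve a b \<gamma>\<^sub>1" and 2: "integral_curve b c \<gamma>\<^sub>2" and abc: "a \<le> b" "b \<le> c"
    and eq: "\<gamma>\<^sub>1 b = \<gamma>\<^sub>2 b"
  shows "integral_curve a c (\<lambda>t. if t \<in> {a..b} then \<gamma>\<^sub>1 t else \<gamma>\<^sub>2 t)"
proof -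
  have un: "{a..c} = {a..b} \<union> {b..c}" using abc by auto
  have int: "{a..b} \<inter> {b..c} = {b}" using abc by auto
  show ?thesis unfolding integral_curve_def
  proof (intro conjI ballI impI)
    show "continuous_on {a..c} (\<lambda>t. if t \<in> {a..b} then \<gamma>\<^sub>1 t else \<gamma>\<^sub>2 t)"
      unfolding un using integral_curve_continuous[OF 1] integral_curve_continuous[OF 2] eq
      by (intro continuous_on_If) auto
    fix t d assume t: "t \<in> {a..c}" and d: "d \<in> A" "(if t \<in> {a..b} then \<gamma>\<^sub>1 t else \<gamma>\<^sub>2 t) \<in> chart_dom d"
    let ?f = "\<lambda>\<gamma> t. dL \<kappa> d (\<gamma> t) (optimal_control (\<gamma> t))"
    \<comment> \<open>At t = b the two one-sided derivatives agree: both are the value of the field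
      at the common point.\<close>
    have "((\<lambda>s. if s \<in> {a..b} then coord d (\<gamma>\<^sub>1 s) else coord d (\<gamma>\<^sub>2 s)) has_vector_derivative
        (if t \<in> {a..b} then ?f \<gamma>\<^sub>1 t else ?f \<gamma>\<^sub>2 t)) (at t within {a..c})"
    proof (rule has_vector_derivative_If_within_closures[where T = "{b..c}"])
      have cl: "closure {a..b} \<inter> closure {b..c} = {b}" using int by simp
      show "((\<lambda>s. coord d (\<gamma>\<^sub>1 s)) has_vector_derivative ?f \<gamma>\<^sub>1 t) (at t within {a..b} \<union> closure {a..b} \<inter> closure {b..c})"
        if "t \<in> {a..b} \<union> closure {a..b} \<inter> closure {b..c}"
      proof -
        have "t \<in> {a..b}" "{a..b} \<union> closure {a..b} \<inter> closure {b..c} = {a..b}" using that cl abc by auto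
        then show ?thesis using 1 d unfolding integral_curve_def by simp
      qed
      show "((\<lambda>s. coord d (\<gamma>\<^sub>2 s)) has_vector_derivative ?f \<gamma>\<^sub>2 t) (at t within {b..c} \<union> closure {a..b} \<inter> closure {b..c})"
        if "t \<in> {b..c} \<union> closure {a..b} \<inter> closure {b..c}"
      proof -
        have tb: "t \<in> {b..c}" "{b..c} \<union> closure {a..b} \<inter> closure {b..c} = {b..c}" using that cl abc by auto
        have "t = b" if "t \<in> {a..b}" using that tb(1) by simp
        then have "\<gamma>\<^sub>2 t \<in> chart_dom d" using d(2) eq by metis
        then show ?thesis using 2 d(1) tb unfolding integral_curve_def by simp
      qed
    qed (use t un eq in auto)
    moreover have "coord d (if s \<in> {a..b} then \<gamma>\<^sub>1 s else \<gamma>\<^sub>2 s) = (if s \<in> {a..b} then coord d (\<gamma>\<^sub>1 s) else coord d (\<gamma>\<^sub>2 s))" for s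
      by simp
    ultimately show "((\<lambda>s. coord d (if s \<in> {a..b} then \<gamma>\<^sub>1 s else \<gamma>\<^sub>2 s)) has_vector_derivative
        dL \<kappa> d (if t \<in> {a..b} then \<gamma>\<^sub>1 t else \<gamma>\<^sub>2 t) (optimal_control (if t \<in> {a..b} then \<gamma>\<^sub>1 t else \<gamma>\<^sub>2 t))) (at t within {a..c})"
      by (auto split: if_splits)
  qed
qed

lemma integral_curve_exists: "\<exists>\<gamma>. integral_curve 0 1 \<gamma> \<and> \<gamma> 0 = p"
proof -
  define h where "h = energy_level p"
  obtain \<tau> where \<tau>: "\<tau> > 0" "\<And>p. energy_level p = h \<Longrightarrow>
      \<exists>\<gamma>. integral_curve 0 \<tau> \<gamma> \<and> \<gamma> 0 = p \<and> energy_level (\<gamma> \<tau>) = h"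
    using integral_curve_local by blast
  \<comment> \<open>The level of the end point is carried along because \<tau> serves only starting
    points of level h. Starting with one full step avoids the degenerate interval {0..0}.\<close>
  have "\<exists>\<gamma>. integral_curve 0 (real (Suc n) * \<tau>) \<gamma> \<and> \<gamma> 0 = p \<and> energy_level (\<gamma> (real (Suc n) * \<tau>)) = h" for n
  proof (induction n)
    case 0
    then show ?case using \<tau>(2)[of p] by (simp add: h_def)
  next
    case (Suc n)
    let ?b = "real (Suc n) * \<tau>"
    have b: "?b \<ge> 0" "real (Suc (Suc n)) * \<tau> = ?b + \<tau>" using \<tau>(1) by (auto simp: algebra_simps)
    obtain \<gamma>\<^sub>1 where 1: "integral_curve 0 ?b \<gamma>\<^sub>1" "\<gamma>\<^sub>1 0 = p" "energy_level (\<gamma>\<^sub>1 ?b) = h" using Suc by blast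
    obtain \<gamma>\<^sub>2 where 2: "integral_curve 0 \<tau> \<gamma>\<^sub>2" "\<gamma>\<^sub>2 0 = \<gamma>\<^sub>1 ?b" "energy_level (\<gamma>\<^sub>2 \<tau>) = h" using \<tau>(2)[OF 1(3)] by blast
    let ?\<gamma> = "\<lambda>t. if t \<in> {0..?b} then \<gamma>\<^sub>1 t else \<gamma>\<^sub>2 (t - ?b)"
    have "integral_curve 0 (?b + \<tau>) ?\<gamma>"
      using 2(2) \<tau>(1) b(1) by (intro integral_curve_join[OF 1(1) integral_curve_shift[OF 2(1)]]) auto
    moreover have "?\<gamma> 0 = p" using 1(2) b(1) by simp
    moreover have "energy_level (?\<gamma> (?b + \<tau>)) = h" using 2(3) \<tau>(1) by simp
    ultimately show ?case unfolding b(2) by blast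
  qed
  moreover obtain n where "1 / \<tau> < real n" using reals_Archimedean2 by blast
  then have "1 \<le> real (Suc n) * \<tau>" using \<tau>(1) by (simp add: field_simps)
  ultimately show ?thesis using integral_curve_subset[of 0 _ _ 0 1] by (metis order_refl)
qed

lemma normal_curve_iff: "normal_curve A \<kappa> V N \<eta> {0..1} \<gamma> \<longleftrightarrow> integral_curve 0 1 \<gamma>"
  using normal_imp_integral_curve integral_curve_imp_normal by blast

lemma integral_curve_cong:
  assumes "integral_curve a b \<gamma>" "\<And>t. t \<in> {a..b} \<Longrightarrow> \<gamma>' t = \<gamma> t"
  shows "integral_curve a b \<gamma>'"
  unfolding integral_curve_def
proof (intro conjI ballI impI)
  show "continuous_on {a..b} \<gamma>'"
    by (rule continuous_on_eq[OF integral_curve_continuous[OF assms(1)]]) (simp add: assms(2))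
  fix t c assume t: "t \<in> {a..b}" and c: "c \<in> A" "\<gamma>' t \<in> chart_dom c"
  then have "((\<lambda>s. coord c (\<gamma> s)) has_vector_derivative dL \<kappa> c (\<gamma>' t) (optimal_control (\<gamma>' t))) (at t within {a..b})"
    using assms unfolding integral_curve_def by auto
  from has_vector_derivative_transform[OF t _ this, of "\<lambda>s. coord c (\<gamma>' s)"]
  show "((\<lambda>s. coord c (\<gamma>' s)) has_vector_derivative dL \<kappa> c (\<gamma>' t) (optimal_control (\<gamma>' t))) (at t within {a..b})"
    using assms(2) by simp
qed

text \<open>Functions are total, whereas \<open>normal_curve\<close> sees \<gamma> on {0..1} only;
  \<open>extensional\<close> fixes the remaining values, so that uniqueness means agreement on
  {0..1}.\<close>

theorem normal_curve_exists_unique: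
  "\<exists>!\<gamma>. \<gamma> \<in> extensional {0..1} \<and> normal_curve A \<kappa> V N \<eta> {0..1} \<gamma> \<and> \<gamma> 0 = p"
proof -
  obtain \<gamma> where \<gamma>: "integral_curve 0 1 \<gamma>" "\<gamma> 0 = p" using integral_curve_exists by blast
  show ?thesis unfolding normal_curve_iff
  proof (rule ex1I[of _ "restrict \<gamma> {0..1}"])
    show "restrict \<gamma> {0..1} \<in> extensional {0..1} \<and> integral_curve 0 1 (restrict \<gamma> {0..1}) \<and> restrict \<gamma> {0..1} 0 = p"
      using \<gamma> integral_curve_cong[OF \<gamma>(1), of "restrict \<gamma> {0..1}"] by simp
    fix \<gamma>' assume \<gamma>': "\<gamma>' \<in> extensional {0..1} \<and> integral_curve 0 1 \<gamma>' \<and> \<gamma>' 0 = p"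
    show "\<gamma>' = restrict \<gamma> {0..1}"
    proof (rule extensionalityI[of _ "{0..1}"])
      show "\<gamma>' t = restrict \<gamma> {0..1} t" if "t \<in> {0..1}" for t
        using integral_curve_unique[OF _ \<gamma>(1) zero_less_one _ that, of \<gamma>'] \<gamma>' \<gamma>(2) that by simp
    qed (use \<gamma>' in auto)
  qed
qed

end

theorem proposition3p9:
  fixes A :: "('g::{topological_group_add, t2_space, second_countable_topology},
               'e::euclidean_space) chart set"
    and \<kappa> :: "('g, 'e) chart" and V :: "'e set" and N :: "'e \<Rightarrow> real"
    and p :: 'g and \<eta> :: "'e \<Rightarrow> real"
  assumes "sub_finsler_lie_group A \<kappa> V N"
    and "strongly_convex_norm_on V N"
    and "linear \<eta>"
  shows "(\<exists>!\<gamma>. \<gamma> \<in> extensional {0..1} \<and> normal_curve A \<kappa> V N \<eta> {0..1} \<gamma> \<and> \<gamma> 0 = p) \<and>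
         (\<forall>\<gamma>. normal_curve A \<kappa> V N \<eta> {0..1} \<gamma> \<and> \<gamma> 0 = p \<longrightarrow> C11_curve A {0..1} \<gamma>)"
proof -
  interpret normal_equation A \<kappa> V N \<eta>
    using assms by (simp add: normal_equation_def normal_equation_axioms_def)
  show ?thesis
    using normal_curve_exists_unique integral_curve_C11[OF normal_imp_integral_curve] by blast
qed

end
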